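(* Let $d\geq 3$ be an integer and let $s=(d-3)+2\lambda$, with $0<\lambda<1$. Assume that the external field $Q$ is given by $$Q(x)=\frac{q}{(r^2+h^2)^{s/2}},\quad q>0,\ h>0,\quad x=(0,r\overline{x})\in\mathbb{D},\ \overline{x}\in\mathbb{S}^{d-2},\ 0\leq r\leq 1,$$ with $h>\max\{h_-,h_+\}$, where $$h_-:=\left(\frac{q\,((1-\lambda)(d-2\lambda+1)+1)^2\sin(\lambda\pi)}{8\pi(d+2\lambda-1)(1-\lambda)}\,\mathrm{B}\Big(\lambda,\frac{d-1}{2}\Big)\right)^{1/(d+2\lambda-3)},$$ and $h_+$ is the largest positive root of the function $$\begin{aligned}p(h)=\ &\frac{2\,\Gamma((d-1)/2+\lambda)}{\Gamma(\lambda)\,\Gamma((d-1)/2)}\left\{\frac{\Gamma((d-1)/2)}{2\,\pi^{(d-1)/2}}+q\,c_{d,\lambda}\right\}\\&-\frac{q\,\sin(\lambda\pi)\,\Gamma((d-1)/2)}{\pi^{(d+1)/2}}\left\{\frac{d-2\lambda-1}{2}\,\frac{1}{h^{d-1}}\,\mathrm{B}\Big(\frac{1}{1+h^2};\lambda,\frac{d-2\lambda-1}{2}\Big)+\frac{1}{h^{2\lambda}(1+h^2)^{(d-3)/2}}\right\},\end{aligned}$$ with $$\begin{aligned}c_{d,\lambda}:=\ &\frac{\sin(\lambda\pi)\,\Gamma((d-1)/2)}{\pi^{(d+1)/2}}\,h^{2(1-\lambda)}\bigg\{\frac{d-2\lambda-1}{2}\int_0^1\frac{t^{d-2}}{(h^2+t^2)^{(d-2\lambda+1)/2}}\,\mathrm{B}\Big(\frac{1-t^2}{1+h^2};\lambda,\frac{d-2\lambda-1}{2}\Big)\,dt\\&+\frac{\Gamma(\lambda)\,\Gamma((d-1)/2)}{2\,\Gamma((d-1)/2+\lambda)}\,\frac{1}{(1+h^2)^{(d-1)/2}}\,{}_2F_1\Big(1,\lambda;\frac{d+2\lambda-1}{2};\frac{1}{1+h^2}\Big)\bigg\}.\end{aligned}$$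 Then the $s$-extremal measure $\mu_Q$ corresponding to $Q$ is given by $$d\mu_Q(x)=f(r)\,r^{d-2}\,dr\,d\sigma_{d-1}(\overline{x}),\quad x=(0,r\overline{x})\in\mathbb{D},\ \overline{x}\in\mathbb{S}^{d-2},\ 0\leq r\leq 1,$$ where $$f(r)=C_Q\,(1-r^2)^{\lambda-1}+F(r),\quad 0\leq r\leq 1.$$ Here $$\begin{aligned}F(r)=-\frac{q\,\sin(\lambda\pi)\,\Gamma((d-1)/2)}{\pi^{(d+1)/2}}\,h^{2(1-\lambda)}\bigg\{&\frac{d-2\lambda-1}{2}\,\frac{1}{(h^2+r^2)^{(d-2\lambda+1)/2}}\,\mathrm{B}\Big(\frac{1-r^2}{1+h^2};\lambda,\frac{d-2\lambda-1}{2}\Big)\\&+\frac{(1-r^2)^{\lambda-1}}{(1+h^2)^{(d-3)/2}\,(h^2+r^2)}\bigg\},\quad 0\leq r\leq 1,\end{aligned}$$ and the positive constant $C_Q$ is given by $$C_Q=\frac{2\,\Gamma((d-1)/2+\lambda)}{\Gamma(\lambda)\,\Gamma((d-1)/2)}\left\{\frac{\Gamma((d-1)/2)}{2\,\pi^{(d-1)/2}}+q\,c_{d,\lambda}\right\}.$$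
   Context: $|\cdot|$ is the Euclidean norm on $\mathbb{R}^d$, $\mathbb{S}^{d-2}$ is the unit sphere of $\mathbb{R}^{d-1}$, and $\sigma_{d-1}$ is the (unnormalized) surface area measure on $\mathbb{S}^{d-2}$. The unit disk is $\mathbb{D}=\{(x_1,\ldots,x_d)\in\mathbb{R}^d:x_1=0,\ x_2^2+\cdots+x_d^2\leq 1\}$; its points are written $x=(0,r\overline{x})$ with $\overline{x}\in\mathbb{S}^{d-2}$, $0\leq r\leq 1$. The incomplete Beta function is $\mathrm{B}(z;a,b)=\int_0^z t^{a-1}(1-t)^{b-1}\,dt$, and $\mathrm{B}(a,b)=\mathrm{B}(1;a,b)$. ${}_2F_1(a,b;c;z)=\sum_{n=0}^\infty\frac{(a)_n(b)_n}{(c)_n}\frac{z^n}{n!}$, $|z|<1$, is the Gauss hypergeometric function, with $(a)_0=1$, $(a)_n=a(a+1)\cdots(a+n-1)$. The quantity $c_{d,\lambda}$ depends on $h$; in the definition of the function $p(h)$ it is regarded as a function of $h>0$. $\mathcal{M}(\mathbb{D})$ is the class of unit positive Borel measures supported on $\mathbb{D}$, and $I_s(\mu)=\iint|x-y|^{-s}\,d\mu(x)\,d\mu(y)$. For the external field $Q$, the weighted energy is $I_Q(\mu)=I_s(\mu)+2\int Q\,d\mu$, $V_Q=\inf\{I_Q(\mu):\mu\in\mathcal{M}(\mathbb{D})\}$, and the $s$-extremal measure $\mu_Q\in\mathcal{M}(\mathbb{D})$ is the (unique) measure with $I_Q(\mu_Q)=V_Q$. *)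

theory Defs
  imports "HOL-Analysis.Analysis" "HOL-Probability.Probability_Measure"
begin

section \<open>Riesz energy with an external field\<close>

text \<open>The kernel has to be infinite on the diagonal, whereas \<^term>\<open>0 powr a = (0::real)\<close>;
  hence the case distinction.\<close>

definition riesz_kernel :: "real \<Rightarrow> 'a::real_normed_vector \<Rightarrow> 'a \<Rightarrow> ennreal" where
  "riesz_kernel s x y = (if x = y then \<infinity> else ennreal (norm (x - y) powr (- s)))"

definition riesz_energy :: "real \<Rightarrow> 'a::real_normed_vector measure \<Rightarrow> ennreal" where
  "riesz_energy s \<mu> = (\<integral>\<^sup>+x. (\<integral>\<^sup>+y. riesz_kernel s x y \<partial>\<mu>) \<partial>\<mu>)"

definition weighted_energy ::
    "real \<Rightarrow> ('a \<Rightarrow> ennreal) \<Rightarrow> 'a::real_normed_vector measure \<Rightarrow> ennreal" where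
  "weighted_energy s Q \<mu> = riesz_energy s \<mu> + 2 * (\<integral>\<^sup>+x. Q x \<partial>\<mu>)"

text \<open>Unit positive Borel measures supported on a closed set \<open>D\<close>.\<close>

definition unit_measures_on :: "'a::topological_space set \<Rightarrow> 'a measure set" where
  "unit_measures_on D = {\<mu>. sets \<mu> = sets borel \<and> prob_space \<mu> \<and> emeasure \<mu> (- D) = 0}"

definition min_weighted_energy ::
    "real \<Rightarrow> ('a \<Rightarrow> ennreal) \<Rightarrow> 'a::real_normed_vector set \<Rightarrow> ennreal" where
  "min_weighted_energy s Q D = (INF \<mu>\<in>unit_measures_on D. weighted_energy s Q \<mu>)"

definition is_extremal_measure ::
    "real \<Rightarrow> ('a \<Rightarrow> ennreal) \<Rightarrow> 'a::real_normed_vector set \<Rightarrow> 'a measure \<Rightarrow> bool" where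
  "is_extremal_measure s Q D \<mu> \<longleftrightarrow>
     \<mu> \<in> unit_measures_on D \<and> weighted_energy s Q \<mu> = min_weighted_energy s Q D"


section \<open>The unit disk and measures with a radial density\<close>

text \<open>The space \<open>\<real>\<^sup>d\<close> is modelled as \<^typ>\<open>real \<times> (real^'m)\<close> with \<open>CARD('m) = d - 1\<close>: the first
  component is \<open>x\<^sub>1\<close>, the second is \<open>(x\<^sub>2, \<dots>, x\<^sub>d)\<close>. The norm of the product type is the
  Euclidean one.\<close>

definition unit_disk :: "(real \<times> (real^'m)) set" where
  "unit_disk = {x. fst x = 0 \<and> (\<Sum>i\<in>UNIV. (snd x $ i)\<^sup>2) \<le> 1}"

text \<open>The unnormalized surface area of a Borel set \<open>A\<close> of the unit sphere of an \<open>n\<close>-dimensional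
  Euclidean space is \<open>n\<close> times the Lebesgue measure of the cone \<open>{t u | 0 < t < 1, u \<in> A}\<close>; this
  cone is the preimage of \<open>A\<close> under \<^term>\<open>sgn\<close>, i.e. \<open>x \<mapsto> x / \<bar>x\<bar>\<close>, in the punctured unit ball.\<close>

definition surface_measure :: "'a::euclidean_space measure" where
  "surface_measure = scale_measure (of_nat DIM('a))
     (distr (restrict_space lborel (ball 0 1 - {0})) (restrict_space borel (sphere 0 1)) sgn)"

text \<open>The measure \<open>f(r) r\<^sup>d\<^sup>-\<^sup>2 dr d\<sigma>(u)\<close> at the points \<open>(0, r u)\<close>, \<open>0 \<le> r \<le> 1\<close>, \<open>\<bar>u\<bar> = 1\<close>.
  Note that \<^const>\<open>ennreal\<close> cuts off negative values, so this reading is only adequate when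
  \<open>f \<ge> 0\<close> almost everywhere on \<open>[0,1]\<close>.\<close>

definition radial_disk_measure :: "nat \<Rightarrow> (real \<Rightarrow> real) \<Rightarrow> (real \<times> (real^'m)) measure" where
  "radial_disk_measure d f =
     distr
       (density (lborel \<Otimes>\<^sub>M surface_measure)
          (\<lambda>(r, u). ennreal (f r * r ^ (d - 2)) * indicator {0..1} r))
       borel (\<lambda>(r, u). (0, r *\<^sub>R u))"


section \<open>Special functions\<close>

definition inc_Beta :: "real \<Rightarrow> real \<Rightarrow> real \<Rightarrow> real" where
  "inc_Beta z a b = integral {0..z} (\<lambda>t. t powr (a - 1) * (1 - t) powr (b - 1))"

definition hyp2F1 :: "real \<Rightarrow> real \<Rightarrow> real \<Rightarrow> real \<Rightarrow> real" where
  "hyp2F1 a b c z = (\<Sum>n. pochhammer a n * pochhammer b n / pochhammer c n * (z ^ n / fact n))"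


section \<open>The constants and functions describing the extremal measure\<close>

definition c_const :: "nat \<Rightarrow> real \<Rightarrow> real \<Rightarrow> real" where
  "c_const d l h =
     sin (l * pi) * Gamma ((real d - 1) / 2) / pi powr ((real d + 1) / 2) * h powr (2 * (1 - l)) *
     ((real d - 2 * l - 1) / 2 *
        integral {0..1} (\<lambda>t. t ^ (d - 2) / (h\<^sup>2 + t\<^sup>2) powr ((real d - 2 * l + 1) / 2) *
          inc_Beta ((1 - t\<^sup>2) / (1 + h\<^sup>2)) l ((real d - 2 * l - 1) / 2))
      + Gamma l * Gamma ((real d - 1) / 2) / (2 * Gamma ((real d - 1) / 2 + l)) *
        (1 / (1 + h\<^sup>2) powr ((real d - 1) / 2)) *
        hyp2F1 1 l ((real d + 2 * l - 1) / 2) (1 / (1 + h\<^sup>2)))"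

definition C_const :: "nat \<Rightarrow> real \<Rightarrow> real \<Rightarrow> real \<Rightarrow> real" where
  "C_const d l q h =
     2 * Gamma ((real d - 1) / 2 + l) / (Gamma l * Gamma ((real d - 1) / 2)) *
     (Gamma ((real d - 1) / 2) / (2 * pi powr ((real d - 1) / 2)) + q * c_const d l h)"

definition p_fun :: "nat \<Rightarrow> real \<Rightarrow> real \<Rightarrow> real \<Rightarrow> real" where
  "p_fun d l q h =
     2 * Gamma ((real d - 1) / 2 + l) / (Gamma l * Gamma ((real d - 1) / 2)) *
     (Gamma ((real d - 1) / 2) / (2 * pi powr ((real d - 1) / 2)) + q * c_const d l h)
     - q * sin (l * pi) * Gamma ((real d - 1) / 2) / pi powr ((real d + 1) / 2) *
     ((real d - 2 * l - 1) / 2 * (1 / h ^ (d - 1)) *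
        inc_Beta (1 / (1 + h\<^sup>2)) l ((real d - 2 * l - 1) / 2)
      + 1 / (h powr (2 * l) * (1 + h\<^sup>2) powr ((real d - 3) / 2)))"

definition h_minus :: "nat \<Rightarrow> real \<Rightarrow> real \<Rightarrow> real" where
  "h_minus d l q =
     (q * ((1 - l) * (real d - 2 * l + 1) + 1)\<^sup>2 * sin (l * pi) /
        (8 * pi * (real d + 2 * l - 1) * (1 - l)) *
      inc_Beta 1 l ((real d - 1) / 2)) powr (1 / (real d + 2 * l - 3))"

definition is_largest_positive_root :: "(real \<Rightarrow> real) \<Rightarrow> real \<Rightarrow> bool" where
  "is_largest_positive_root p x \<longleftrightarrow> 0 < x \<and> p x = 0 \<and> (\<forall>y>0. p y = 0 \<longrightarrow> y \<le> x)"

definition F_fun :: "nat \<Rightarrow> real \<Rightarrow> real \<Rightarrow> real \<Rightarrow> real \<Rightarrow> real" where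
  "F_fun d l q h r =
     - (q * sin (l * pi) * Gamma ((real d - 1) / 2) / pi powr ((real d + 1) / 2)) *
     h powr (2 * (1 - l)) *
     ((real d - 2 * l - 1) / 2 * (1 / (h\<^sup>2 + r\<^sup>2) powr ((real d - 2 * l + 1) / 2)) *
        inc_Beta ((1 - r\<^sup>2) / (1 + h\<^sup>2)) l ((real d - 2 * l - 1) / 2)
      + (1 - r\<^sup>2) powr (l - 1) / ((1 + h\<^sup>2) powr ((real d - 3) / 2) * (h\<^sup>2 + r\<^sup>2)))"

definition f_density :: "nat \<Rightarrow> real \<Rightarrow> real \<Rightarrow> real \<Rightarrow> real \<Rightarrow> real" where
  "f_density d l q h r = C_const d l q h * (1 - r\<^sup>2) powr (l - 1) + F_fun d l q h r"


section \<open>Consistency checks\<close>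

lemma inc_Beta_1_eq_Beta:
  assumes "a > 0" "b > 0"
  shows "inc_Beta 1 a b = Beta a b"
  using has_integral_Beta_real[OF assms] by (simp add: inc_Beta_def integral_unique)

lemma space_surface_measure: "space (surface_measure :: 'a::euclidean_space measure) = sphere 0 1"
  by (simp add: surface_measure_def space_scale_measure space_restrict_space)

lemma measurable_sgn_surface:
  "sgn \<in> measurable (restrict_space lborel (ball 0 1 - {0 :: 'a::euclidean_space}))
                    (restrict_space borel (sphere 0 1))"
proof (rule measurable_restrict_space2)
  show "sgn \<in> space (restrict_space lborel (ball 0 1 - {0 :: 'a})) \<rightarrow> sphere 0 1"
    by (auto simp: space_restrict_space norm_sgn)
  have "(sgn :: 'a \<Rightarrow> 'a) \<in> borel_measurable borel"
    unfolding sgn_div_norm[abs_def] by measurable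
  then show "sgn \<in> borel_measurable (restrict_space lborel (ball 0 1 - {0 :: 'a}))"
    by (intro measurable_restrict_space1) simp
qed

lemma emeasure_surface_measure:
  fixes A :: "'a::euclidean_space set"
  assumes "A \<in> sets borel" "A \<subseteq> sphere 0 1"
  shows "emeasure surface_measure A =
    of_nat DIM('a) * emeasure lborel {t *\<^sub>R u | t u. 0 < t \<and> t < 1 \<and> u \<in> A}"
proof -
  let ?N = "restrict_space lborel (ball 0 1 - {0 :: 'a})"
  have A: "A \<in> sets (restrict_space borel (sphere 0 1))"
    using assms by (subst sets_restrict_space_iff) auto
  have cone: "sgn -` A \<inter> space ?N = {t *\<^sub>R u | t u. 0 < t \<and> t < 1 \<and> u \<in> A}"
  proof (intro equalityI subsetI)
    fix x assume "x \<in> sgn -` A \<inter> space ?N"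
    then have "x = norm x *\<^sub>R sgn x" "0 < norm x" "norm x < 1" "sgn x \<in> A"
      by (auto simp: space_restrict_space sgn_div_norm)
    then show "x \<in> {t *\<^sub>R u | t u. 0 < t \<and> t < 1 \<and> u \<in> A}" by blast
  next
    fix x assume "x \<in> {t *\<^sub>R u | t u. 0 < t \<and> t < 1 \<and> u \<in> A}"
    then obtain t u where tu: "x = t *\<^sub>R u" "0 < t" "t < 1" "u \<in> A" by auto
    moreover from tu assms have "norm u = 1" by auto
    ultimately show "x \<in> sgn -` A \<inter> space ?N"
      by (auto simp: space_restrict_space sgn_div_norm)
  qed
  have "emeasure surface_measure A = of_nat DIM('a) * emeasure ?N (sgn -` A \<inter> space ?N)"
    unfolding surface_measure_def emeasure_scale_measure
    by (subst emeasure_distr[OF measurable_sgn_surface A]) simp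
  also have "emeasure ?N (sgn -` A \<inter> space ?N) = emeasure lborel (sgn -` A \<inter> space ?N)"
    by (rule emeasure_restrict_space) (auto simp: space_restrict_space)
  finally show ?thesis unfolding cone .
qed

lemma emeasure_surface_measure_sphere:
  "emeasure surface_measure (sphere 0 1 :: 'a::euclidean_space set) =
     ennreal (2 * pi powr (real DIM('a) / 2) / Gamma (real DIM('a) / 2))"
proof -
  have eq: "{t *\<^sub>R u | t u. 0 < t \<and> t < 1 \<and> u \<in> sphere 0 (1::real)} = ball 0 1 - {0 :: 'a}"
  proof (intro equalityI subsetI)
    fix x :: 'a assume "x \<in> ball 0 1 - {0}"
    then have "x = norm x *\<^sub>R sgn x" "0 < norm x" "norm x < 1" "sgn x \<in> sphere 0 1"
      by (auto simp: sgn_div_norm)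
    then show "x \<in> {t *\<^sub>R u | t u. 0 < t \<and> t < 1 \<and> u \<in> sphere 0 1}" by blast
  qed auto
  have "emeasure lborel (ball 0 1 - {0 :: 'a}) = emeasure lborel (ball 0 1 :: 'a set)"
    by (subst emeasure_Diff) auto
  also have "\<dots> = ennreal (unit_ball_vol (real DIM('a)))"
    by (subst emeasure_ball) auto
  finally have "emeasure surface_measure (sphere 0 1 :: 'a set) =
      ennreal (real DIM('a)) * ennreal (unit_ball_vol (real DIM('a)))"
    by (subst emeasure_surface_measure) (simp_all only: eq order_refl closed_sphere borel_closed ennreal_of_nat_eq_real_of_nat)
  also have "\<dots> = ennreal (real DIM('a) * unit_ball_vol (real DIM('a)))"
    by (simp add: ennreal_mult)
  also have "real DIM('a) * unit_ball_vol (real DIM('a)) =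
      2 * pi powr (real DIM('a) / 2) / Gamma (real DIM('a) / 2)"
  proof -
    have pos: "real DIM('a) / 2 > 0" by simp
    then have "Gamma (real DIM('a) / 2 + 1) = real DIM('a) / 2 * Gamma (real DIM('a) / 2)"
      by (intro Gamma_plus1) (auto dest: nonpos_Ints_nonpos)
    moreover have "Gamma (real DIM('a) / 2) \<noteq> 0"
      using Gamma_real_pos[OF pos] by linarith
    ultimately show ?thesis
      unfolding unit_ball_vol_def by (simp only:) (simp add: divide_simps)
  qed
  finally show ?thesis .
qed

end

theory Submission
  imports Defs
begin

text \<open>The powers \<open>E\<^sub>w(y) = (w - |y|\<^sup>2)\<^sup>\<lambda>\<^sup>-\<^sup>1\<close> have constant potential on the ball \<open>|y|\<^sup>2 \<le> w\<close>: in polar coordinates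
  about \<open>x\<close> the two halves of a chord through \<open>x\<close> together contribute a constant. Hence the mutual energy
  of \<open>E\<^sub>w\<close> and \<open>E\<^sub>T\<close> is a multiple of \<open>(min w T)\<^sup>s\<^sup>/\<^sup>2\<close>, and since \<open>T\<close> is arbitrary this is an Abel equation
  that determines the potential of \<open>E\<^sub>w\<close> outside its ball as well. Stacking the \<open>E\<^sub>w\<close> with the weight
  \<open>- G'(w)\<close>, \<open>G(w) \<propto> (w + h\<^sup>2)\<^sup>-\<^sup>(\<^sup>d\<^sup>-\<^sup>1\<^sup>)\<^sup>/\<^sup>2\<close>, then gives a measure on the disk whose potential there is that of the
  point charge at height \<open>h\<close>. Subtracting \<open>q\<close> times it from a multiple of \<open>E\<^sub>1\<close> makes the weighted potential
  constant on the disk, and the resulting density is nonnegative as soon as it is nonnegative at the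
  centre, where its value is \<open>p(h)\<close>. Positive definiteness of the Riesz kernel, a superposition of Gaussians, turns
  the constancy of the weighted potential into extremality and uniqueness.\<close>

section \<open>Integration in polar coordinates\<close>

text \<open>Put n = d - 1, so that s = n - 2 + 2 \<lambda>; for this exponent E_w is a multiple of
  the equilibrium density of its ball in the hyperplane. The obstacle is its potential outside the
  ball: at x the stack contains layers with w < |x|^2, about which chords say nothing. The mutual
  energy involves interior values only, which is why it can supply the missing equation. It
  determines the potential for almost every radius, and this suffices because the layers are
  integrated over w. The exponent of G is chosen because the stacked potential at |x|^2 = v is, up
  to a factor, the integral of u^(s/2-1) (v-u)^(-\<lambda>) G(u) over (0, v), and s/2 +
  (1-\<lambda>) = n/2 is the condition under which a Moebius substitution turns this into a Beta
  integral, a multiple of (v + h^2)^(-s/2). The constant c_{d,\<lambda>} is the mass of the swept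
  charge over the area of the unit sphere. Computed from the density it is the formula of the
  statement; computed from the layers it is an incomplete Beta function, visibly continuous in h.
  Continuity, with positivity of p far out, keeps p positive beyond its largest root.\<close>

lemma set_nn_integral_eq_ennreal_iff:
  fixes h :: "real \<Rightarrow> real"
  assumes [measurable]: "h \<in> borel_measurable borel" "S \<in> sets borel"
    and nn: "\<And>x. x \<in> S \<Longrightarrow> 0 \<le> h x" and "0 \<le> b"
  shows "(\<integral>\<^sup>+x\<in>S. ennreal (h x) \<partial>lborel) = ennreal b \<longleftrightarrow>
    h absolutely_integrable_on S \<and> integral S h = b"
proof
  assume *: "(\<integral>\<^sup>+x\<in>S. ennreal (h x) \<partial>lborel) = ennreal b"
  have 1: "(\<integral>\<^sup>+x\<in>S. ennreal (h x) \<partial>lborel) = integral S h"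
    by (rule set_nn_integral_lborel_eq_integral) (use nn * in \<open>auto simp: set_borel_measurable_def\<close>)
  have "(\<lambda>x. indicator S x * h x) integrable_on UNIV"
  proof (rule nn_integral_integrable_on)
    have "(\<integral>\<^sup>+ x. ennreal (indicator S x * h x) \<partial>lborel) = (\<integral>\<^sup>+x\<in>S. ennreal (h x) \<partial>lborel)"
      by (intro nn_integral_cong) (auto simp: indicator_def)
    then show "(\<integral>\<^sup>+ x. ennreal (indicator S x * h x) \<partial>lborel) < \<infinity>" using * by simp
  qed (use nn in \<open>auto simp: indicator_def\<close>)
  then have "h integrable_on S"
    using integrable_restrict_UNIV[of S h] by (simp add: indicator_def if_distrib[of "\<lambda>x. x * _"] of_bool_def cong: if_cong)
  then have "h absolutely_integrable_on S"
    using nn by (simp add: absolutely_integrable_on_iff_nonneg)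
  moreover have "integral S h \<ge> 0"
    using nn by (intro integral_nonneg \<open>h integrable_on S\<close>) auto
  ultimately show "h absolutely_integrable_on S \<and> integral S h = b"
    using 1 * \<open>0 \<le> b\<close> by simp
next
  assume "h absolutely_integrable_on S \<and> integral S h = b"
  then have "(h has_integral b) S"
    using absolutely_integrable_on_def integrable_integral by blast
  then show "(\<integral>\<^sup>+x\<in>S. ennreal (h x) \<partial>lborel) = ennreal b"
    by (intro nn_integral_has_integral_lebesgue' nn)
qed

text \<open>Both sides are integrals of \<open>f\<close> against measures: Lebesgue measure on the
  image, and the push-forward of the density |g'|. The change of variables for real-valued
  functions, applied to indicators, shows that these measures agree, so the formula holds for every
  Borel function with values in [0, \<infinity>], integrable or not.\<close>

lemma nn_integral_substitution_inj:
  fixes g g' :: "real \<Rightarrow> real" and f :: "real \<Rightarrow> ennreal"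
  assumes [measurable]: "S \<in> sets borel" "g ` S \<in> sets borel"
    "g \<in> borel_measurable borel" "g' \<in> borel_measurable borel" "f \<in> borel_measurable borel"
    and der: "\<And>x. x \<in> S \<Longrightarrow> (g has_field_derivative g' x) (at x)"
    and inj: "inj_on g S"
  shows "(\<integral>\<^sup>+y\<in>g ` S. f y \<partial>lborel) = (\<integral>\<^sup>+x\<in>S. ennreal \<bar>g' x\<bar> * f (g x) \<partial>lborel)"
proof -
  define M1 where "M1 = density lborel (indicator (g ` S) :: real \<Rightarrow> ennreal)"
  define M2 where "M2 = distr (density lborel (\<lambda>x. ennreal \<bar>g' x\<bar> * indicator S x)) borel g"
  have eq: "emeasure M1 A = emeasure M2 A" if [measurable]: "A \<in> sets borel" for A
  proof -
    let ?f = "indicator A :: real \<Rightarrow> real" and ?h = "\<lambda>x. \<bar>g' x\<bar> * indicator A (g x) :: real"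
    have cov: "?h absolutely_integrable_on S \<and> integral S ?h = b \<longleftrightarrow>
       ?f absolutely_integrable_on (g ` S) \<and> integral (g ` S) ?f = b" for b
      by (rule has_absolute_integral_change_of_variables_1')
        (use der inj in \<open>auto intro: has_field_derivative_at_within\<close>)
    have e1: "emeasure M1 A = (\<integral>\<^sup>+y\<in>g ` S. ennreal (?f y) \<partial>lborel)"
      unfolding M1_def by (subst emeasure_density) (auto intro!: nn_integral_cong simp: indicator_def)
    have [measurable]: "g -` A \<in> sets borel"
      using measurable_sets[of g borel borel A] by simp
    have e2: "emeasure M2 A = (\<integral>\<^sup>+x\<in>S. ennreal (?h x) \<partial>lborel)"
      unfolding M2_def by (subst emeasure_distr, simp, simp, subst emeasure_density)
        (auto intro!: nn_integral_cong simp: indicator_def)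
    \<comment> \<open>Agreement for every finite \<open>b\<close> also settles the infinite case: if
      one of the integrals is finite, so is the other.\<close>
    have key: "(\<integral>\<^sup>+y\<in>g ` S. ennreal (?f y) \<partial>lborel) = ennreal b \<longleftrightarrow>
        (\<integral>\<^sup>+x\<in>S. ennreal (?h x) \<partial>lborel) = ennreal b" if "b \<ge> 0" for b
      using set_nn_integral_eq_ennreal_iff[of ?f "g ` S" b] set_nn_integral_eq_ennreal_iff[of ?h S b] cov[of b] that
      by simp
    show ?thesis unfolding e1 e2
    proof (cases "\<integral>\<^sup>+y\<in>g ` S. ennreal (?f y) \<partial>lborel" rule: ennreal_cases)
      case (real r)
      then show "(\<integral>\<^sup>+y\<in>g ` S. ennreal (?f y) \<partial>lborel) = (\<integral>\<^sup>+x\<in>S. ennreal (?h x) \<partial>lborel)"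
        using key[of r] by simp
    next
      case top
      then show "(\<integral>\<^sup>+y\<in>g ` S. ennreal (?f y) \<partial>lborel) = (\<integral>\<^sup>+x\<in>S. ennreal (?h x) \<partial>lborel)"
        using key by (cases "\<integral>\<^sup>+x\<in>S. ennreal (?h x) \<partial>lborel" rule: ennreal_cases) auto
    qed
  qed
  have "M1 = M2"
    by (rule measure_eqI) (use eq in \<open>auto simp: M1_def M2_def\<close>)
  then have "(\<integral>\<^sup>+y. f y \<partial>M1) = (\<integral>\<^sup>+y. f y \<partial>M2)" by simp
  then show ?thesis
    unfolding M1_def M2_def
    by (subst (asm) nn_integral_density, simp, simp, subst (asm) nn_integral_distr, simp, simp,
        subst (asm) nn_integral_density) (auto simp: mult_ac)
qed

lemma nn_integral_euclidean_affine:
  fixes t :: "'a::euclidean_space" and f :: "'a \<Rightarrow> ennreal"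
  assumes [measurable]: "f \<in> borel_measurable borel" and "c \<noteq> 0"
  shows "(\<integral>\<^sup>+x. f x \<partial>lborel) = ennreal (\<bar>c\<bar> ^ DIM('a)) * (\<integral>\<^sup>+x. f (t + c *\<^sub>R x) \<partial>lborel)"
  by (subst lborel_affine[OF assms(2), of t])
     (simp add: nn_integral_density nn_integral_distr nn_integral_cmult ennreal_power)

text \<open>A translation-invariant measure is determined up to a factor; testing on the unit ball,
  which an isometry preserves, shows that the factor is one.\<close>

lemma nn_integral_isometry:
  fixes T :: "'a::euclidean_space \<Rightarrow> 'a" and f :: "'a \<Rightarrow> ennreal"
  assumes T: "orthogonal_transformation T" and [measurable]: "f \<in> borel_measurable borel"
  shows "(\<integral>\<^sup>+x. f (T x) \<partial>lborel) = (\<integral>\<^sup>+x. f x \<partial>lborel)"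
proof -
  interpret T: linear T using T by (rule orthogonal_transformation_linear)
  have [measurable]: "T \<in> borel_measurable borel"
    by (intro borel_measurable_continuous_onI linear_continuous_on T.linear_axioms)
       (simp add: linear_conv_bounded_linear[symmetric] T.linear_axioms)
  let ?g = "indicator {y. norm y < 1} :: 'a \<Rightarrow> ennreal"
  define V where "V = emeasure lborel {y :: 'a. norm y < 1}"
  have V: "V \<noteq> \<infinity>" "V \<noteq> 0"
  proof -
    have "V = ennreal (unit_ball_vol (real DIM('a)))" using emeasure_ball[of 1 "0::'a"] by (simp add: V_def ball_def)
    moreover have "unit_ball_vol (real DIM('a)) > 0" by simp
    ultimately show "V \<noteq> \<infinity>" "V \<noteq> 0" by (auto simp del: unit_ball_vol_pos)
  qed
  obtain S where S: "linear S" "\<And>x. T (S x) = x" "\<And>x. S (T x) = x"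
    using T by (metis orthogonal_transformation_inv orthogonal_transformation_linear bij_inv_eq_iff orthogonal_transformation_bij)
  \<comment> \<open>The double integral of f(Tx + y) over all x and over |y| < 1 is evaluated in
    both orders. Taking x first gives the left-hand integral times V by translation invariance.
    Taking y first, after shifting y by Tx, gives the right-hand integral times V, because y - Tx
    lies in the unit ball iff x lies in the unit ball about S y.\<close>
  have shift: "(\<integral>\<^sup>+x. f (T x + y) \<partial>lborel) = (\<integral>\<^sup>+x. f (T x) \<partial>lborel)" for y
  proof -
    have "(\<integral>\<^sup>+x. f (T x) \<partial>lborel) = (\<integral>\<^sup>+x. f (T (S y + x)) \<partial>lborel)"
      using nn_integral_euclidean_affine[of "\<lambda>x. f (T x)" 1 "S y"] by simp
    then show ?thesis by (simp add: T.add S add.commute)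
  qed
  have "(\<integral>\<^sup>+x. f (T x) \<partial>lborel) * V = (\<integral>\<^sup>+y. (\<integral>\<^sup>+x. f (T x + y) * ?g y \<partial>lborel) \<partial>lborel)"
  proof -
    have "(\<integral>\<^sup>+x. f (T x + y) * ?g y \<partial>lborel) = (\<integral>\<^sup>+x. f (T x) \<partial>lborel) * ?g y" for y
      unfolding shift[of y, symmetric] by (rule nn_integral_multc) measurable
    then show ?thesis
      unfolding V_def by (simp only:) (rule nn_integral_cmult_indicator[symmetric], measurable)
  qed
  also have "\<dots> = (\<integral>\<^sup>+x. (\<integral>\<^sup>+y. f (T x + y) * ?g y \<partial>lborel) \<partial>lborel)"
    by (rule lborel_pair.Fubini') simp
  also have "\<dots> = (\<integral>\<^sup>+x. (\<integral>\<^sup>+y. f y * ?g (y - T x) \<partial>lborel) \<partial>lborel)"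
  proof (rule nn_integral_cong, goal_cases)
    case (1 x)
    show ?case
      using nn_integral_euclidean_affine[of "\<lambda>y. f y * ?g (y - T x)" 1 "T x"] by simp
  qed
  also have "\<dots> = (\<integral>\<^sup>+y. (\<integral>\<^sup>+x. f y * ?g (y - T x) \<partial>lborel) \<partial>lborel)"
    by (rule lborel_pair.Fubini'[symmetric]) simp
  also have "\<dots> = (\<integral>\<^sup>+y. f y * V \<partial>lborel)"
  proof (rule nn_integral_cong, goal_cases)
    case (1 y)
    have "(\<integral>\<^sup>+x. f y * ?g (y - T x) \<partial>lborel) = f y * (\<integral>\<^sup>+x. ?g (y - T x) \<partial>lborel)"
      by (rule nn_integral_cmult) simp
    also have "(\<integral>\<^sup>+x. ?g (y - T x) \<partial>lborel) = (\<integral>\<^sup>+x. indicator {x. dist (S y) x < 1} x \<partial>lborel)"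
    proof (rule nn_integral_cong, goal_cases)
      case (1 x)
      have "norm (y - T x) = norm (T (S y - x))" by (simp add: T.diff S)
      also have "\<dots> = norm (S y - x)" using T by (simp add: orthogonal_transformation_norm)
      finally show ?case
        by (auto simp: indicator_def dist_norm)
    qed
    also have "\<dots> = V"
      using emeasure_ball[of 1 "0::'a"] emeasure_ball[of 1 "S y"] by (simp add: V_def ball_def)
    finally show ?case .
  qed
  also have "\<dots> = (\<integral>\<^sup>+y. f y \<partial>lborel) * V" by (rule nn_integral_multc) simp
  finally show ?thesis using V
    by (subst (asm) (1 2) mult.commute) (simp add: ennreal_mult_cancel_left)
qed

lemma borel_measurable_sgn_euclidean [measurable]:
  "(sgn :: 'a::euclidean_space \<Rightarrow> 'a) \<in> borel_measurable borel"
  unfolding sgn_div_norm[abs_def] by measurable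

lemma sets_surface_measure [measurable_cong]:
  "sets (surface_measure :: 'a::euclidean_space measure) = sets (restrict_space borel (sphere 0 1))"
  by (simp add: surface_measure_def)

lemma nn_integral_surface_measure:
  fixes f :: "'a::euclidean_space \<Rightarrow> ennreal"
  assumes [measurable]: "f \<in> borel_measurable borel"
  shows "(\<integral>\<^sup>+u. f u \<partial>surface_measure) =
     of_nat DIM('a) * (\<integral>\<^sup>+y\<in>{y. 0 < norm y \<and> norm y < 1}. f (sgn y) \<partial>lborel)"
proof -
  have f: "f \<in> borel_measurable (restrict_space borel (sphere 0 1))"
    by (rule measurable_restrict_space1) simp
  have "(\<integral>\<^sup>+u. f u \<partial>surface_measure) = of_nat DIM('a) *
      (\<integral>\<^sup>+u. f u \<partial>distr (restrict_space lborel (ball 0 1 - {0})) (restrict_space borel (sphere 0 1)) sgn)"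
    unfolding surface_measure_def using f by (subst nn_integral_scale_measure) auto
  also have "(\<integral>\<^sup>+u. f u \<partial>distr (restrict_space lborel (ball 0 1 - {0})) (restrict_space borel (sphere 0 1)) sgn)
     = (\<integral>\<^sup>+y. f (sgn y) \<partial>restrict_space lborel (ball 0 1 - {0}))"
    by (rule nn_integral_distr[OF measurable_sgn_surface]) (simp add: f)
  also have "\<dots> = (\<integral>\<^sup>+y\<in>ball 0 1 - {0}. f (sgn y) \<partial>lborel)"
    by (rule nn_integral_restrict_space) auto
  also have "ball 0 1 - {0 :: 'a} = {y. 0 < norm y \<and> norm y < 1}" by auto
  finally show ?thesis .
qed

lemma nn_integral_powr_Ioi:
  assumes "a > 0" "p > 0"
  shows "(\<integral>\<^sup>+t\<in>{a<..}. ennreal (t powr (- p - 1)) \<partial>lborel) = ennreal (a powr (- p) / p)"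
proof -
  have "(\<integral>\<^sup>+t\<in>{a<..}. ennreal (t powr (- p - 1)) \<partial>lborel) = (\<integral>\<^sup>+t. ennreal (t powr (- p - 1)) * indicator {a..} t \<partial>lborel)"
    by (intro nn_integral_cong_AE, use AE_lborel_singleton[of a] in eventually_elim) (auto simp: indicator_def)
  also have "\<dots> = ennreal (0 - (- (a powr (- p) / p)))"
  proof (rule nn_integral_FTC_atLeast)
    show "((\<lambda>x. - (x powr - p / p)) \<longlongrightarrow> 0) at_top"
    proof -
      have "((\<lambda>x. x powr - p) \<longlongrightarrow> 0) at_top"
        using tendsto_neg_powr[of "- p" "\<lambda>x. x" at_top] \<open>p > 0\<close> by (simp add: filterlim_ident)
      from tendsto_minus[OF tendsto_divide[OF this tendsto_const[of p]]] show ?thesis using \<open>p > 0\<close> by simp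
    qed
    show "((\<lambda>x. - (x powr - p / p)) has_real_derivative x powr (- p - 1)) (at x)" if "a \<le> x" for x
      using assms that by (auto intro!: derivative_eq_intros)
  qed auto
  finally show ?thesis by simp
qed

text \<open>\<open>surface_measure\<close> is defined through cones, so spherical charts are
  avoided. Spelled out, the right-hand side is a double integral over a radius r and a point y of
  the punctured unit ball. The substitutions r = |y| t and then z = t y turn the argument r y/|y| of
  \<open>f\<close> into z, and the remaining integral of n t^(-n-1) over t > |z| cancels the factor
  |z|^n.\<close>

lemma nn_integral_polar:
  fixes f :: "'a::euclidean_space \<Rightarrow> ennreal"
  assumes [measurable]: "f \<in> borel_measurable borel"
  shows "(\<integral>\<^sup>+y. f y \<partial>lborel) =
    (\<integral>\<^sup>+r\<in>{0<..}. ennreal (r ^ (DIM('a) - 1)) * (\<integral>\<^sup>+u. f (r *\<^sub>R u) \<partial>surface_measure) \<partial>lborel)"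
proof -
  let ?n = "DIM('a)"
  have n: "?n > 0" by simp
  let ?B = "{y :: 'a. 0 < norm y \<and> norm y < 1}"
  have "(\<integral>\<^sup>+r\<in>{0<..}. ennreal (r ^ (?n - 1)) * (\<integral>\<^sup>+u. f (r *\<^sub>R u) \<partial>surface_measure) \<partial>lborel)
    = (\<integral>\<^sup>+r. (\<integral>\<^sup>+y. of_nat ?n * (ennreal (r ^ (?n - 1)) * f (r *\<^sub>R sgn y)) * indicator {0<..} r * indicator ?B y \<partial>lborel) \<partial>lborel)"
  proof (rule nn_integral_cong, goal_cases)
    case (1 r)
    have "ennreal (r ^ (?n - 1)) * (\<integral>\<^sup>+u. f (r *\<^sub>R u) \<partial>surface_measure) * indicator {0<..} r =
      of_nat ?n * ennreal (r ^ (?n - 1)) * indicator {0<..} r * (\<integral>\<^sup>+y. f (r *\<^sub>R sgn y) * indicator ?B y \<partial>lborel)"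
      by (subst nn_integral_surface_measure) (auto simp: mult_ac)
    also have "\<dots> = (\<integral>\<^sup>+y. of_nat ?n * (ennreal (r ^ (?n - 1)) * f (r *\<^sub>R sgn y)) * indicator {0<..} r * indicator ?B y \<partial>lborel)"
      by (subst nn_integral_cmult[symmetric]) (measurable, simp only: mult_ac)
    finally show ?case .
  qed
  also have "\<dots> = (\<integral>\<^sup>+y. (\<integral>\<^sup>+r. of_nat ?n * (ennreal (r ^ (?n - 1)) * f (r *\<^sub>R sgn y)) * indicator {0<..} r * indicator ?B y \<partial>lborel) \<partial>lborel)"
    by (rule lborel_pair.Fubini') simp
  also have "\<dots> = (\<integral>\<^sup>+y. (\<integral>\<^sup>+t. of_nat ?n * (ennreal (t ^ (?n - 1)) * ennreal (norm y ^ ?n) * f (t *\<^sub>R y)) * indicator {0<..} t * indicator ?B y \<partial>lborel) \<partial>lborel)"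
  proof (rule nn_integral_cong, goal_cases)
    case (1 y)
    show ?case
    proof (cases "y = 0")
      case False
      then have y: "norm y > 0" by simp
      have ind: "indicator {0<..} (norm y * t) = (indicator {0<..} t :: ennreal)" for t
        using y by (auto simp: indicator_def zero_less_mult_iff)
      have pw: "ennreal (norm y) * ennreal ((norm y * t) ^ (?n - 1)) = ennreal (t ^ (?n - 1)) * ennreal (norm y ^ ?n)"
        if "t > 0" for t
      proof -
        have "norm y * (norm y * t) ^ (?n - 1) = t ^ (?n - 1) * norm y ^ ?n"
          using n by (cases ?n) (auto simp: power_mult_distrib)
        with that y show ?thesis by (simp add: ennreal_mult[symmetric])
      qed
      have sg: "(norm y * t) *\<^sub>R sgn y = t *\<^sub>R y" for t
        using False by (simp add: sgn_div_norm)
      let ?A = "\<lambda>r. of_nat ?n * (ennreal (r ^ (?n - 1)) * f (r *\<^sub>R sgn y)) * indicator {0<..} r * indicator ?B y"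
      have "(\<integral>\<^sup>+r. ?A r \<partial>lborel) = ennreal \<bar>norm y\<bar> * (\<integral>\<^sup>+t. ?A (0 + norm y * t) \<partial>lborel)"
        by (rule nn_integral_real_affine) (use y in auto)
      also have "\<dots> = (\<integral>\<^sup>+t. ennreal \<bar>norm y\<bar> * ?A (0 + norm y * t) \<partial>lborel)"
        by (rule nn_integral_cmult[symmetric]) measurable
      also have "\<dots> = (\<integral>\<^sup>+t. of_nat ?n * (ennreal (t ^ (?n - 1)) * ennreal (norm y ^ ?n) * f (t *\<^sub>R y)) * indicator {0<..} t * indicator ?B y \<partial>lborel)"
      proof (rule nn_integral_cong, goal_cases)
        case (1 t)
        show ?case
        proof (cases "t > 0")
          case True
          have "ennreal \<bar>norm y\<bar> * ?A (0 + norm y * t) =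
            of_nat ?n * ((ennreal (norm y) * ennreal ((norm y * t) ^ (?n - 1))) * f ((norm y * t) *\<^sub>R sgn y)) * indicator {0<..} (norm y * t) * indicator ?B y"
            by (simp only: abs_norm_cancel add_0_left mult_ac)
          then show ?thesis unfolding pw[OF True] sg ind .
        next
          case False
          then have "indicator {0<..} (0 + norm y * t) = (0 :: ennreal)" using ind[of t] by simp
          with False show ?thesis by simp
        qed
      qed
      finally show ?thesis .
    qed simp
  qed
  also have "\<dots> = (\<integral>\<^sup>+t. (\<integral>\<^sup>+y. of_nat ?n * (ennreal (t ^ (?n - 1)) * ennreal (norm y ^ ?n) * f (t *\<^sub>R y)) * indicator {0<..} t * indicator ?B y \<partial>lborel) \<partial>lborel)"
    by (rule lborel_pair.Fubini') simp
  \<comment> \<open>Here z = t y: the condition |y| < 1 becomes t > |z|, and the Jacobian together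
    with t^(n-1) |y|^n leaves t^(-n-1) |z|^n.\<close>
  also have "\<dots> = (\<integral>\<^sup>+t. (\<integral>\<^sup>+z. of_nat ?n * (ennreal (t powr (- real ?n - 1)) * ennreal (norm z ^ ?n) * f z) * indicator {0<..} t * indicator {z. 0 < norm z \<and> norm z < t} z \<partial>lborel) \<partial>lborel)"
  proof (rule nn_integral_cong, goal_cases)
    case (1 t)
    show ?case
    proof (cases "t > 0")
      case True
      have ind: "indicator {z. 0 < norm z \<and> norm z < t} (t *\<^sub>R y) = (indicator ?B y :: ennreal)" for y
        using True by (auto simp: indicator_def)
      have pw: "ennreal (t ^ ?n) * (ennreal (t powr (- real ?n - 1)) * ennreal (norm (t *\<^sub>R y) ^ ?n)) =
          ennreal (t ^ (?n - 1)) * ennreal (norm y ^ ?n)" for y :: 'a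
      proof -
        have "t powr (- real ?n - 1) = 1 / (t ^ ?n * t)"
          using True by (simp add: powr_diff powr_minus powr_realpow divide_simps)
        moreover have "t ^ (?n - 1) = t ^ ?n / t"
          using n True by (cases ?n) auto
        ultimately have "t ^ ?n * (t powr (- real ?n - 1) * norm (t *\<^sub>R y) ^ ?n) = t ^ (?n - 1) * norm y ^ ?n"
          using True by (simp add: power_mult_distrib)
        then show ?thesis using True by (simp add: ennreal_mult[symmetric])
      qed
      have "(\<integral>\<^sup>+z. of_nat ?n * (ennreal (t powr (- real ?n - 1)) * ennreal (norm z ^ ?n) * f z) * indicator {0<..} t * indicator {z. 0 < norm z \<and> norm z < t} z \<partial>lborel)
        = (\<integral>\<^sup>+y. ennreal (t ^ ?n) * (of_nat ?n * (ennreal (t powr (- real ?n - 1)) * ennreal (norm (t *\<^sub>R y) ^ ?n) * f (t *\<^sub>R y)) * indicator {0<..} t * indicator ?B y) \<partial>lborel)"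
      proof -
        let ?A = "\<lambda>z. of_nat ?n * (ennreal (t powr (- real ?n - 1)) * ennreal (norm z ^ ?n) * f z) * indicator {0<..} t * indicator {z. 0 < norm z \<and> norm z < t} z"
        have "(\<integral>\<^sup>+z. ?A z \<partial>lborel) = ennreal (\<bar>t\<bar> ^ ?n) * (\<integral>\<^sup>+y. ?A (0 + t *\<^sub>R y) \<partial>lborel)"
          by (rule nn_integral_euclidean_affine) (use True in auto)
        also have "\<dots> = (\<integral>\<^sup>+y. ennreal (\<bar>t\<bar> ^ ?n) * ?A (0 + t *\<^sub>R y) \<partial>lborel)"
          by (rule nn_integral_cmult[symmetric]) measurable
        finally show ?thesis using True unfolding add_0_left ind by simp
      qed
      also have "\<dots> = (\<integral>\<^sup>+y. of_nat ?n * ((ennreal (t ^ ?n) * (ennreal (t powr (- real ?n - 1)) * ennreal (norm (t *\<^sub>R y) ^ ?n))) * f (t *\<^sub>R y)) * indicator {0<..} t * indicator ?B y \<partial>lborel)"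
        by (simp only: mult_ac)
      finally show ?thesis unfolding pw by (simp only: mult_ac)
    qed simp
  qed
  also have "\<dots> = (\<integral>\<^sup>+z. (\<integral>\<^sup>+t. of_nat ?n * (ennreal (t powr (- real ?n - 1)) * ennreal (norm z ^ ?n) * f z) * indicator {0<..} t * indicator {z. 0 < norm z \<and> norm z < t} z \<partial>lborel) \<partial>lborel)"
    by (rule lborel_pair.Fubini') (simp add: indicator_def)
  also have "\<dots> = (\<integral>\<^sup>+z. f z \<partial>lborel)"
  proof (intro nn_integral_cong_AE, use AE_lborel_singleton[of 0] in eventually_elim)
    fix z :: 'a assume "z \<noteq> 0"
    then have z: "norm z > 0" by simp
    have "(\<integral>\<^sup>+t. of_nat ?n * (ennreal (t powr (- real ?n - 1)) * ennreal (norm z ^ ?n) * f z) * indicator {0<..} t * indicator {z. 0 < norm z \<and> norm z < t} z \<partial>lborel)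
      = (\<integral>\<^sup>+t. of_nat ?n * ennreal (norm z ^ ?n) * f z * (ennreal (t powr (- real ?n - 1)) * indicator {norm z<..} t) \<partial>lborel)"
      by (intro nn_integral_cong) (use z in \<open>auto simp: indicator_def mult_ac dest: order_le_less_trans[OF norm_ge_zero]\<close>)
    also have "\<dots> = of_nat ?n * ennreal (norm z ^ ?n) * f z * ennreal (norm z powr (- real ?n) / real ?n)"
      by (subst nn_integral_cmult) (use z n in \<open>auto simp: nn_integral_powr_Ioi\<close>)
    also have "\<dots> = ennreal (real ?n * norm z ^ ?n * (norm z powr (- real ?n) / real ?n)) * f z"
      by (simp only: ennreal_mult ennreal_of_nat_eq_real_of_nat mult_ac zero_le_power norm_ge_zero
        of_nat_0_le_iff mult_nonneg_nonneg divide_nonneg_nonneg powr_ge_zero)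
    also have "real ?n * norm z ^ ?n * (norm z powr (- real ?n) / real ?n) = 1"
      using z n by (simp add: powr_minus powr_realpow)
    finally show "(\<integral>\<^sup>+t. of_nat ?n * (ennreal (t powr (- real ?n - 1)) * ennreal (norm z ^ ?n) * f z) * indicator {0<..} t * indicator {z. 0 < norm z \<and> norm z < t} z \<partial>lborel) = f z"
      by simp
  qed
  finally show ?thesis by simp
qed


section \<open>Beta integrals and chords of a ball\<close>

lemma nn_integral_Beta:
  assumes "a > 0" "b > (0::real)"
  shows "(\<integral>\<^sup>+t\<in>{0<..<1}. ennreal (t powr (a - 1) * (1 - t) powr (b - 1)) \<partial>lborel) = ennreal (Beta a b)"
proof (rule nn_integral_has_integral_lebesgue')
  show "((\<lambda>t. t powr (a - 1) * (1 - t) powr (b - 1)) has_integral Beta a b) {0<..<1}"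
    using has_integral_Beta_real[OF assms] by (simp add: has_integral_Icc_iff_Ioo)
qed auto

lemma nn_integral_Beta_Ioo:
  assumes "a > 0" "b > (0::real)" "u < w"
  shows "(\<integral>\<^sup>+v\<in>{u<..<w}. ennreal ((v - u) powr (a - 1) * (w - v) powr (b - 1)) \<partial>lborel) =
    ennreal ((w - u) powr (a + b - 1) * Beta a b)"
proof -
  let ?f = "\<lambda>v. ennreal ((v - u) powr (a - 1) * (w - v) powr (b - 1)) * indicator {u<..<w} v"
  have wu: "w - u > 0" using assms by simp
  have "(\<integral>\<^sup>+v. ?f v \<partial>lborel) = ennreal \<bar>w - u\<bar> * (\<integral>\<^sup>+t. ?f (u + (w - u) * t) \<partial>lborel)"
    by (rule nn_integral_real_affine) (use wu in auto)
  also have "(\<integral>\<^sup>+t. ?f (u + (w - u) * t) \<partial>lborel) = (\<integral>\<^sup>+t. ennreal ((w - u) powr (a + b - 2)) *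
      (ennreal (t powr (a - 1) * (1 - t) powr (b - 1)) * indicator {0<..<1} t) \<partial>lborel)"
  proof (rule nn_integral_cong, goal_cases)
    case (1 t)
    have ind: "u + (w - u) * t \<in> {u<..<w} \<longleftrightarrow> t \<in> {0<..<1}"
    proof -
      have "u + (w - u) * t < w \<longleftrightarrow> (w - u) * t < (w - u) * 1" by auto
      then show ?thesis using wu by (simp add: zero_less_mult_iff mult_less_cancel_left_pos)
    qed
    show ?case
    proof (cases "t \<in> {0<..<1}")
      case True
      have "w - (u + (w - u) * t) = (w - u) * (1 - t)" by (simp add: algebra_simps)
      then have "(u + (w - u) * t - u) powr (a - 1) * (w - (u + (w - u) * t)) powr (b - 1) =
         ((w - u) powr (a - 1) * (w - u) powr (b - 1)) * (t powr (a - 1) * (1 - t) powr (b - 1))"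
        using True wu by (simp add: powr_mult)
      also have "(w - u) powr (a - 1) * (w - u) powr (b - 1) = (w - u) powr (a + b - 2)"
        using wu by (simp add: powr_add[symmetric])
      finally show ?thesis using True ind by (simp add: ennreal_mult)
    next
      case False
      then show ?thesis by (simp only: indicator_def ind if_False of_bool_def mult_zero_right)
    qed
  qed
  also have "\<dots> = ennreal ((w - u) powr (a + b - 2)) * ennreal (Beta a b)"
    by (subst nn_integral_cmult) (auto simp: nn_integral_Beta assms)
  also have "ennreal \<bar>w - u\<bar> * \<dots> = ennreal ((w - u) powr (a + b - 1) * Beta a b)"
  proof -
    have "Beta a b > 0" using assms by (simp add: Beta_def Gamma_real_pos)
    moreover have "(w - u) * (w - u) powr (a + b - 2) = (w - u) powr (a + b - 1)"
      using wu powr_mult_base[of "w - u" "a + b - 2"] by simp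
    ultimately show ?thesis using wu
      by (simp add: ennreal_mult[symmetric] mult.assoc[symmetric])
  qed
  finally show ?thesis .
qed

lemma image_eq_if_right_inverse:
  fixes g :: "real \<Rightarrow> real"
  assumes "\<And>x. x \<in> S \<Longrightarrow> g x \<in> T" "\<And>y. y \<in> T \<Longrightarrow> k y \<in> S \<and> g (k y) = y"
  shows "g ` S = T"
  using assms by force

lemma nn_integral_powr_over_one_plus:
  assumes "0 < \<beta>" "\<beta> < (1::real)"
  shows "(\<integral>\<^sup>+w\<in>{0<..}. ennreal (w powr (- \<beta>) / (1 + w)) \<partial>lborel) = ennreal (Beta (1 - \<beta>) \<beta>)"
proof -
  let ?g = "\<lambda>t::real. t / (1 - t)"
  have img: "?g ` {0<..<1} = {0<..}"
    by (rule image_eq_if_right_inverse[where k = "\<lambda>w. w / (1 + w)"]) (auto simp: field_simps)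
  have "(\<integral>\<^sup>+w\<in>?g ` {0<..<1}. ennreal (w powr (- \<beta>) / (1 + w)) \<partial>lborel) =
    (\<integral>\<^sup>+t\<in>{0<..<1}. ennreal \<bar>1 / (1 - t)\<^sup>2\<bar> * ennreal (?g t powr (- \<beta>) / (1 + ?g t)) \<partial>lborel)"
  proof (rule nn_integral_substitution_inj)
    show "inj_on ?g {0<..<1}" by (auto simp: inj_on_def field_simps)
    show "(?g has_real_derivative 1 / (1 - t)\<^sup>2) (at t)" if "t \<in> {0<..<1}" for t
      using that by (auto intro!: derivative_eq_intros simp: power2_eq_square)
  qed (auto simp: img)
  also have "\<dots> = (\<integral>\<^sup>+t\<in>{0<..<1}. ennreal (t powr ((1 - \<beta>) - 1) * (1 - t) powr (\<beta> - 1)) \<partial>lborel)"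
  proof (rule nn_integral_cong, goal_cases)
    case (1 t)
    show ?case
    proof (cases "t \<in> {0<..<1}")
      case True
      then have t: "0 < t" "0 < 1 - t" by auto
      have "1 + ?g t = 1 / (1 - t)" using t by (simp add: field_simps)
      then have "\<bar>1 / (1 - t)\<^sup>2\<bar> * (?g t powr (- \<beta>) / (1 + ?g t)) = t powr (- \<beta>) * ((1 - t) powr \<beta> / (1 - t))"
        using t by (simp add: powr_divide powr_minus power2_eq_square divide_simps)
      also have "(1 - t) powr \<beta> / (1 - t) = (1 - t) powr (\<beta> - 1)"
        using t by (simp add: powr_diff)
      finally show ?thesis using t by (simp add: ennreal_mult[symmetric])
    qed simp
  qed
  finally show ?thesis using assms nn_integral_Beta[of "1 - \<beta>" \<beta>] by (simp add: img)
qed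

text \<open>The exponents p - 1, q - 1 and - p - q add up to - 2, which makes the integrand
  covariant under Moebius maps. The map sending 0, v, - c to 0, 1, \<infinity> therefore turns the
  integral into the Beta integral, up to constants.\<close>

lemma nn_integral_Beta_moebius:
  assumes "p > 0" "q > (0::real)" "v > 0" "c > 0"
  shows "(\<integral>\<^sup>+u\<in>{0<..<v}. ennreal (u powr (p - 1) * (v - u) powr (q - 1) * (u + c) powr (- p - q)) \<partial>lborel) =
    ennreal (Beta p q * v powr (p + q - 1) * c powr (- q) * (v + c) powr (- p))"
proof -
  let ?g = "\<lambda>u. (v + c) * u / (v * (u + c))"
  let ?g' = "\<lambda>u. (v + c) * c / (v * (u + c)\<^sup>2)"
  let ?K = "v powr (p + q - 1) * c powr (- q) * (v + c) powr (- p)"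
  have om: "1 - ?g u = c * (v - u) / (v * (u + c))" if "u > 0" for u
    using that assms by (simp add: divide_simps) (simp add: algebra_simps)
  have g1: "?g u < 1 \<longleftrightarrow> u < v" if "u > 0" for u
  proof -
    have "?g u < 1 \<longleftrightarrow> 0 < c * (v - u) / (v * (u + c))" unfolding om[OF that, symmetric] by auto
    also have "\<dots> \<longleftrightarrow> u < v" using that assms by (simp add: zero_less_divide_iff zero_less_mult_iff) (auto simp: not_less mult_less_0_iff)
    finally show ?thesis .
  qed
  have img: "?g ` {0<..<v} = {0<..<1}"
  proof (rule image_eq_if_right_inverse[where k = "\<lambda>y. v * c * y / (v * (1 - y) + c)"])
    show "?g u \<in> {0<..<1}" if "u \<in> {0<..<v}" for u
      using that assms g1[of u] by auto
    fix y :: real assume "y \<in> {0<..<1}"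
    then have y: "0 < y" "y < 1" by auto
    let ?k = "v * c * y / (v * (1 - y) + c)"
    have den: "v * (1 - y) + c > 0" using y assms by (intro add_pos_pos mult_pos_pos) auto
    have k0: "?k > 0" using y assms den by simp
    have "?k + c = c * (v + c) / (v * (1 - y) + c)" using den by (simp add: field_simps)
    then have "?g ?k = (v + c) * (v * c * y / (v * (1 - y) + c)) / (v * (c * (v + c) / (v * (1 - y) + c)))"
      by simp
    also have "\<dots> = y" using den assms by (simp add: divide_simps)
    finally have gk: "?g ?k = y" .
    then have "?k < v" using g1[OF k0] y by simp
    with k0 gk show "?k \<in> {0<..<v} \<and> ?g ?k = y" by simp
  qed
  have inj: "inj_on ?g {0<..<v}"
  proof (rule inj_onI)
    fix x y assume "x \<in> {0<..<v}" "y \<in> {0<..<v}" and eq: "?g x = ?g y"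
    then have xy: "x > 0" "y > 0" by auto
    have "c * (v - x) / (v * (x + c)) = c * (v - y) / (v * (y + c))"
      using eq om[OF xy(1)] om[OF xy(2)] by simp
    then have "(v - x) * (y + c) = (v - y) * (x + c)"
      using xy assms by (simp add: frac_eq_eq)
    then have "(v + c) * x = (v + c) * y" by (simp add: algebra_simps)
    then show "x = y" using assms by simp
  qed
  have "(\<integral>\<^sup>+y\<in>?g ` {0<..<v}. ennreal (y powr (p - 1) * (1 - y) powr (q - 1)) \<partial>lborel) =
    (\<integral>\<^sup>+u\<in>{0<..<v}. ennreal \<bar>?g' u\<bar> * ennreal (?g u powr (p - 1) * (1 - ?g u) powr (q - 1)) \<partial>lborel)"
  proof (rule nn_integral_substitution_inj)
    show "(?g has_real_derivative ?g' u) (at u)" if "u \<in> {0<..<v}" for u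
      using that assms by (auto intro!: derivative_eq_intros simp: power2_eq_square divide_simps) (simp add: algebra_simps)
  qed (auto simp: img inj)
  then have B: "ennreal (Beta p q) = \<dots>"
    unfolding img nn_integral_Beta[OF assms(1,2)] .
  have "ennreal ?K * ennreal (Beta p q) =
      (\<integral>\<^sup>+u\<in>{0<..<v}. ennreal (u powr (p - 1) * (v - u) powr (q - 1) * (u + c) powr (- p - q)) \<partial>lborel)"
    unfolding B
  proof (subst nn_integral_cmult[symmetric], measurable, intro nn_integral_cong)
    fix u :: real
    show "ennreal ?K * (ennreal \<bar>?g' u\<bar> * ennreal (?g u powr (p - 1) * (1 - ?g u) powr (q - 1)) * indicator {0<..<v} u) =
      ennreal (u powr (p - 1) * (v - u) powr (q - 1) * (u + c) powr (- p - q)) * indicator {0<..<v} u"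
    proof (cases "u \<in> {0<..<v}")
      case True
      \<comment> \<open>The linear factors are named so that the laws for \<open>powr\<close> apply
        to products and quotients of positive atoms.\<close>
      define x where "x = v + c"
      define y where "y = u + c"
      define z where "z = v - u"
      have pos: "u > 0" "z > 0" "v > 0" "c > 0" "x > 0" "y > 0" using True assms by (auto simp: x_def y_def z_def)
      have e: "1 - ?g u = c * z / (v * y)" using om[of u] pos by (simp add: y_def z_def)
      have "?K * (\<bar>?g' u\<bar> * (?g u powr (p - 1) * (1 - ?g u) powr (q - 1))) =
        v powr (p + q - 1) * c powr (- q) * x powr (- p) * ((x * c / (v * y\<^sup>2)) *
          ((x * u / (v * y)) powr (p - 1) * (c * z / (v * y)) powr (q - 1)))"
        unfolding e using pos by (simp add: x_def y_def)
      also have "\<dots> = u powr (p - 1) * z powr (q - 1) * y powr (- p - q)"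
        using pos by (simp add: powr_mult powr_divide powr_diff powr_add powr_minus power2_eq_square divide_simps)
      finally have "?K * (\<bar>?g' u\<bar> * (?g u powr (p - 1) * (1 - ?g u) powr (q - 1))) =
        u powr (p - 1) * (v - u) powr (q - 1) * (u + c) powr (- p - q)"
        by (simp only: x_def y_def z_def)
      then show ?thesis using True
        by (simp only: indicator_simps mult_1_right ennreal_mult[symmetric] abs_ge_zero powr_ge_zero mult_nonneg_nonneg)
    qed simp
  qed
  moreover have "Beta p q > 0" using assms by (simp add: Beta_def Gamma_real_pos)
  ultimately show ?thesis
    by (simp add: ennreal_mult[symmetric] mult_ac)
qed

text \<open>A point splits a chord into pieces of lengths a and b. The substitutions t = 1/z and t =
  1/(z + \<delta>) carry both pieces to the half-line z > 1/a with the same quadratic W(z) = (a z -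
  1)(b z + 1). Since 1 + W(z) = a b z (z + \<delta>), the factors 1/z and 1/(z + \<delta>) add up to
  the logarithmic derivative of 1 + W, and w = W(z) leaves an integral free of a and b.\<close>

lemma nn_integral_chord_pair:
  assumes \<beta>: "0 < \<beta>" "\<beta> < (1::real)" and ab: "0 < a" "0 < b"
  shows "(\<integral>\<^sup>+t\<in>{0<..<a}. ennreal (t powr (2 * \<beta> - 1) * ((a - t) * (t + b)) powr (- \<beta>)) \<partial>lborel) +
    (\<integral>\<^sup>+t\<in>{0<..<b}. ennreal (t powr (2 * \<beta> - 1) * ((b - t) * (t + a)) powr (- \<beta>)) \<partial>lborel) =
    ennreal (Beta (1 - \<beta>) \<beta>)"
proof -
  \<comment> \<open>With this shift b (z + \<delta>) - 1 = (b/a) (a z - 1) and a (z + \<delta>) + 1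
    = (a/b) (b z + 1), so the second piece leads to the same product W.\<close>
  define \<delta> where "\<delta> = 1 / b - 1 / a"
  define W where "W z = (a * z - 1) * (b * z + 1)" for z
  define W' where "W' z = 2 * a * b * z + a - b" for z
  have zpos: "z > 0" "z + \<delta> > 1 / b" "z + \<delta> > 0" "W z > 0" "a * z > 1" if "z \<in> {1/a<..}" for z
  proof -
    show "z > 0" using that ab by (auto intro: less_trans[of 0 "1/a"])
    moreover show "a * z > 1" using that ab by (simp add: field_simps)
    ultimately show "W z > 0" using ab by (simp add: W_def add_pos_pos)
    show "z + \<delta> > 1 / b" using that by (simp add: \<delta>_def)
    then show "z + \<delta> > 0" using ab by (auto intro: less_trans[of 0 "1/b"])
  qed
  have gen: "(\<integral>\<^sup>+t\<in>{0<..<a'}. ennreal (t powr (2 * \<beta> - 1) * ((a' - t) * (t + b')) powr (- \<beta>)) \<partial>lborel) =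
     (\<integral>\<^sup>+z\<in>{1/a<..}. ennreal (W z powr (- \<beta>) / (z + e)) \<partial>lborel)"
    if a': "a' > 0" "1 / a' = 1 / a + e" and W: "\<And>z. W z = (a' * (z + e) - 1) * (b' * (z + e) + 1)"
      and ze: "\<And>z. z \<in> {1/a<..} \<Longrightarrow> z + e > 0" for a' b' e
  proof -
    let ?g = "\<lambda>z. 1 / (z + e)"
    have img: "?g ` {1/a<..} = {0<..<a'}"
    proof (rule image_eq_if_right_inverse[where k = "\<lambda>t. 1 / t - e"])
      fix z assume z: "z \<in> {1/a<..}"
      then have "z + e > 1 / a'" using a' by simp
      then have "1 / (z + e) < a'" using ze[OF z] a'(1) by (simp only: divide_less_eq) (simp add: mult.commute)
      then show "?g z \<in> {0<..<a'}" using ze[OF z] by simp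
    next
      fix t assume "t \<in> {0<..<a'}"
      then have "t > 0" "1 / t > 1 / a'" by (auto intro!: divide_strict_left_mono)
      then show "1 / t - e \<in> {1/a<..} \<and> ?g (1 / t - e) = t" using a' by simp
    qed
    have "(\<integral>\<^sup>+t\<in>?g ` {1/a<..}. ennreal (t powr (2 * \<beta> - 1) * ((a' - t) * (t + b')) powr (- \<beta>)) \<partial>lborel) =
      (\<integral>\<^sup>+z\<in>{1/a<..}. ennreal \<bar>- 1 / (z + e)\<^sup>2\<bar> * ennreal (?g z powr (2 * \<beta> - 1) * ((a' - ?g z) * (?g z + b')) powr (- \<beta>)) \<partial>lborel)"
    proof (rule nn_integral_substitution_inj)
      show "(?g has_real_derivative - 1 / (z + e)\<^sup>2) (at z)" if "z \<in> {1/a<..}" for z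
        using ze[OF that] by (auto intro!: derivative_eq_intros simp: power2_eq_square)
      show "inj_on ?g {1/a<..}" by (auto simp: inj_on_def)
    qed (auto simp: img)
    also have "\<dots> = (\<integral>\<^sup>+z\<in>{1/a<..}. ennreal (W z powr (- \<beta>) / (z + e)) \<partial>lborel)"
    proof (rule nn_integral_cong, goal_cases)
      case (1 z)
      show ?case
      proof (cases "z \<in> {1/a<..}")
        case True
        define y where "y = z + e"
        have y: "y > 0" using ze[OF True] by (simp add: y_def)
        have Wp: "W z > 0" using zpos True by simp
        have e: "(a' - 1 / y) * (1 / y + b') = W z / y\<^sup>2"
        proof -
          have Wy: "W z = (a' * y - 1) * (b' * y + 1)" by (simp only: W y_def)
          show ?thesis unfolding Wy using y by (simp add: divide_simps power2_eq_square)
        qed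
        have y2: "(y * y) powr \<beta> = y powr (2 * \<beta>)"
          using y by (simp add: powr_mult powr_add[symmetric])
        have "\<bar>- 1 / y\<^sup>2\<bar> * ((1 / y) powr (2 * \<beta> - 1) * ((a' - 1 / y) * (1 / y + b')) powr (- \<beta>)) =
          W z powr (- \<beta>) / y"
          unfolding e using y Wp
          by (simp add: powr_divide powr_minus powr_diff y2 power2_eq_square divide_simps)
        then show ?thesis using True y
          by (simp add: ennreal_mult[symmetric] y_def)
      qed simp
    qed
    finally show ?thesis by (simp add: img)
  qed
  have 1: "(\<integral>\<^sup>+t\<in>{0<..<a}. ennreal (t powr (2 * \<beta> - 1) * ((a - t) * (t + b)) powr (- \<beta>)) \<partial>lborel) =
     (\<integral>\<^sup>+z\<in>{1/a<..}. ennreal (W z powr (- \<beta>) / z) \<partial>lborel)"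
    using gen[of a 0 b] ab zpos by (simp add: W_def)
  have 2: "(\<integral>\<^sup>+t\<in>{0<..<b}. ennreal (t powr (2 * \<beta> - 1) * ((b - t) * (t + a)) powr (- \<beta>)) \<partial>lborel) =
     (\<integral>\<^sup>+z\<in>{1/a<..}. ennreal (W z powr (- \<beta>) / (z + \<delta>)) \<partial>lborel)"
  proof (rule gen)
    show "W z = (b * (z + \<delta>) - 1) * (a * (z + \<delta>) + 1)" for z
      using ab by (simp add: W_def \<delta>_def field_simps)
  qed (use ab zpos in \<open>auto simp: \<delta>_def\<close>)
  have img: "W ` {1/a<..} = {0<..}"
  proof (rule set_eqI, rule iffI)
    fix w :: real assume "w \<in> W ` {1/a<..}" then show "w \<in> {0<..}" using zpos by auto
  next
    fix w :: real assume "w \<in> {0<..}"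
    then have w: "w > 0" by simp
    \<comment> \<open>At z = (w + 1) / a the first factor of W equals w and the second is at least
      1, so W has reached w by then.\<close>
    have le: "1 / a \<le> (w + 1) / a" using w ab by (simp add: divide_right_mono)
    have "w * 1 \<le> w * (b * ((w + 1) / a) + 1)" using w ab by (intro mult_left_mono) auto
    then have "w \<le> W ((w + 1) / a)" using ab by (simp add: W_def)
    moreover have "W (1 / a) = 0" using ab by (simp add: W_def)
    moreover have "continuous_on {1 / a..(w + 1) / a} W" unfolding W_def by (intro continuous_intros)
    ultimately obtain z where z: "1 / a \<le> z" "W z = w" using w le IVT'[of W "1/a" w "(w+1)/a"] by auto
    then have "z \<noteq> 1 / a" using \<open>W (1 / a) = 0\<close> w by auto
    with z show "w \<in> W ` {1/a<..}" by auto
  qed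
  have inj: "inj_on W {1/a<..}"
  proof (rule linorder_inj_onI)
    fix x y assume xy: "x < y" "x \<in> {1/a<..}" "y \<in> {1/a<..}"
    have "W x < W y" unfolding W_def
      using xy ab zpos(1,5)[OF xy(2)] zpos(1,5)[OF xy(3)] by (intro mult_strict_mono) (auto intro: add_pos_pos)
    then show "W x \<noteq> W y" by simp
  qed auto
  have "ennreal (Beta (1 - \<beta>) \<beta>) = (\<integral>\<^sup>+w\<in>W ` {1/a<..}. ennreal (w powr (- \<beta>) / (1 + w)) \<partial>lborel)"
    unfolding img by (rule nn_integral_powr_over_one_plus[OF \<beta>, symmetric])
  also have "\<dots> = (\<integral>\<^sup>+z\<in>{1/a<..}. ennreal \<bar>W' z\<bar> * ennreal (W z powr (- \<beta>) / (1 + W z)) \<partial>lborel)"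
  proof (rule nn_integral_substitution_inj)
    show "(W has_real_derivative W' z) (at z)" for z
      unfolding W_def[abs_def] W'_def by (auto intro!: derivative_eq_intros simp: algebra_simps)
  qed (auto simp: img inj, auto simp: W_def[abs_def] W'_def[abs_def])
  also have "\<dots> = (\<integral>\<^sup>+z\<in>{1/a<..}. ennreal (W z powr (- \<beta>) / z) + ennreal (W z powr (- \<beta>) / (z + \<delta>)) \<partial>lborel)"
  proof (rule nn_integral_cong, goal_cases)
    case (1 z)
    show ?case
    proof (cases "z \<in> {1/a<..}")
      case True
      note z = zpos[OF True]
      have "1 + W z = a * b * z * (z + \<delta>)" using ab by (simp add: W_def \<delta>_def field_simps)
      moreover have "W' z = a * b * (z + (z + \<delta>))" using ab by (simp add: W'_def \<delta>_def field_simps)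
      ultimately have "\<bar>W' z\<bar> / (1 + W z) = 1 / z + 1 / (z + \<delta>)"
        using z ab by (simp add: divide_simps)
      then have "W z powr (- \<beta>) * (\<bar>W' z\<bar> / (1 + W z)) = W z powr (- \<beta>) * (1 / z + 1 / (z + \<delta>))" by (rule arg_cong)
      then have "\<bar>W' z\<bar> * (W z powr (- \<beta>) / (1 + W z)) = W z powr (- \<beta>) / z + W z powr (- \<beta>) / (z + \<delta>)"
        by (simp add: distrib_left mult.commute)
      then show ?thesis using True z by (simp add: ennreal_mult[symmetric] ennreal_plus[symmetric] del: ennreal_plus)
    qed simp
  qed
  also have "\<dots> = (\<integral>\<^sup>+z\<in>{1/a<..}. ennreal (W z powr (- \<beta>) / z) \<partial>lborel) +
      (\<integral>\<^sup>+z\<in>{1/a<..}. ennreal (W z powr (- \<beta>) / (z + \<delta>)) \<partial>lborel)"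
    by (subst nn_integral_add[symmetric]) (auto simp: distrib_right W_def[abs_def])
  finally show ?thesis unfolding 1 2 by simp
qed

text \<open>The degenerate case b = 0 of a point on the sphere: the powers of t merge to
  t^(\<beta>-1), and a plain Beta integral gives the same constant as a genuine pair.\<close>

lemma nn_integral_chord_tangent:
  assumes "0 < \<beta>" "\<beta> < (1::real)" "0 < a"
  shows "(\<integral>\<^sup>+t\<in>{0<..<a}. ennreal (t powr (2 * \<beta> - 1) * ((a - t) * t) powr (- \<beta>)) \<partial>lborel) =
    ennreal (Beta (1 - \<beta>) \<beta>)"
proof -
  have "(\<integral>\<^sup>+t\<in>{0<..<a}. ennreal (t powr (2 * \<beta> - 1) * ((a - t) * t) powr (- \<beta>)) \<partial>lborel) =
    (\<integral>\<^sup>+t\<in>{0<..<a}. ennreal ((t - 0) powr (\<beta> - 1) * (a - t) powr ((1 - \<beta>) - 1)) \<partial>lborel)"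
  proof (intro nn_integral_cong, goal_cases)
    case (1 t)
    have "t powr (2 * \<beta> - 1) * ((a - t) * t) powr (- \<beta>) = (a - t) powr (- \<beta>) * (t powr (2 * \<beta> - 1) * t powr (- \<beta>))"
      if "0 < t" "t < a"
      using that by (simp add: powr_mult)
    then show ?case
      by (auto simp: indicator_def powr_add[symmetric] mult_ac)
  qed
  also have "\<dots> = ennreal (Beta (1 - \<beta>) \<beta>)"
    using assms by (subst nn_integral_Beta_Ioo) (auto simp: Beta_commute)
  finally show ?thesis .
qed


section \<open>Riesz potentials of powers of the distance to the sphere\<close>

lemma emeasure_surface_measure_space:
  "emeasure (surface_measure :: 'a::euclidean_space measure) (space surface_measure) =
     ennreal (2 * pi powr (real DIM('a) / 2) / Gamma (real DIM('a) / 2))"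
  by (simp add: space_surface_measure emeasure_surface_measure_sphere)

lemma finite_measure_surface_measure: "finite_measure (surface_measure :: 'a::euclidean_space measure)"
  by (rule finite_measureI) (simp add: emeasure_surface_measure_space)

lemma measurable_scaleR_surface_measure:
  "(\<lambda>(r, u). r *\<^sub>R u) \<in> borel_measurable (lborel \<Otimes>\<^sub>M (surface_measure :: 'a::euclidean_space measure))"
proof -
  have "(\<lambda>u. u) \<in> borel_measurable (surface_measure :: 'a measure)"
    by (subst measurable_cong_sets[OF sets_surface_measure refl])
       (intro measurable_restrict_space1, simp)
  then have [measurable]: "snd \<in> borel_measurable (lborel \<Otimes>\<^sub>M (surface_measure :: 'a measure))"
    by (rule measurable_compose[OF measurable_snd, where g = "\<lambda>u. u", simplified])
  show ?thesis unfolding case_prod_unfold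
    by (intro borel_measurable_scaleR) auto
qed

lemma nn_integral_polar':
  fixes f :: "'a::euclidean_space \<Rightarrow> ennreal"
  assumes [measurable]: "f \<in> borel_measurable borel"
  shows "(\<integral>\<^sup>+y. f y \<partial>lborel) =
    (\<integral>\<^sup>+u. (\<integral>\<^sup>+r\<in>{0<..}. ennreal (r ^ (DIM('a) - 1)) * f (r *\<^sub>R u) \<partial>lborel) \<partial>surface_measure)"
proof -
  interpret S: finite_measure "surface_measure :: 'a measure" by (rule finite_measure_surface_measure)
  interpret P: pair_sigma_finite "lborel :: real measure" "surface_measure :: 'a measure" ..
  have fm: "(\<lambda>p. f (fst p *\<^sub>R snd p)) \<in> borel_measurable (lborel \<Otimes>\<^sub>M (surface_measure :: 'a measure))"
    using measurable_compose[OF measurable_scaleR_surface_measure assms] by (simp add: case_prod_unfold)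
  have "(\<integral>\<^sup>+y. f y \<partial>lborel) = (\<integral>\<^sup>+r. (\<integral>\<^sup>+u. ennreal (r ^ (DIM('a) - 1)) * f (r *\<^sub>R u) * indicator {0<..} r \<partial>surface_measure) \<partial>lborel)"
    unfolding nn_integral_polar[OF assms]
  proof (rule nn_integral_cong, goal_cases)
    case (1 r)
    have "(\<lambda>u. f (r *\<^sub>R u)) \<in> borel_measurable surface_measure"
      using measurable_compose[OF measurable_Pair1' fm, of r] by simp
    then show ?case
      by (simp add: nn_integral_cmult nn_integral_multc)
  qed
  also have "\<dots> = (\<integral>\<^sup>+u. (\<integral>\<^sup>+r. ennreal (r ^ (DIM('a) - 1)) * f (r *\<^sub>R u) * indicator {0<..} r \<partial>lborel) \<partial>surface_measure)"
    using fm by (intro P.Fubini'[symmetric]) (simp add: case_prod_unfold)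
  finally show ?thesis .
qed

text \<open>The half comes from using the squared radius v = r^2 as radial variable, r^(n-1) dr =
  v^(n/2-1) dv / 2. This variable is the natural one because all weights depend on w -
  |y|^2.\<close>

abbreviation half_sphere_area :: "real \<Rightarrow> real" where
  "half_sphere_area n \<equiv> pi powr (n / 2) / Gamma (n / 2)"

lemma nn_integral_radial:
  fixes \<phi> :: "real \<Rightarrow> ennreal"
  assumes [measurable]: "\<phi> \<in> borel_measurable borel"
  shows "(\<integral>\<^sup>+y. \<phi> ((norm y)\<^sup>2) \<partial>(lborel :: 'a::euclidean_space measure)) =
    (\<integral>\<^sup>+v\<in>{0<..}. ennreal (half_sphere_area (real DIM('a)) * v powr (real DIM('a) / 2 - 1)) * \<phi> v \<partial>lborel)"
proof -
  let ?n = "DIM('a)" and ?\<omega> = "2 * pi powr (real DIM('a) / 2) / Gamma (real DIM('a) / 2)"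
  have "?\<omega> > 0" by (simp add: Gamma_real_pos)
  have img: "(\<lambda>r. r\<^sup>2) ` {0<..} = {0::real<..}"
    by (rule image_eq_if_right_inverse[where k = sqrt]) auto
  have "(\<integral>\<^sup>+v\<in>(\<lambda>r. r\<^sup>2) ` {0<..}. ennreal (?\<omega> / 2 * v powr (real ?n / 2 - 1)) * \<phi> v \<partial>lborel) =
    (\<integral>\<^sup>+r\<in>{0<..}. ennreal \<bar>2 * r\<bar> * (ennreal (?\<omega> / 2 * r\<^sup>2 powr (real ?n / 2 - 1)) * \<phi> (r\<^sup>2)) \<partial>lborel)"
  proof (rule nn_integral_substitution_inj)
    show "inj_on (\<lambda>r::real. r\<^sup>2) {0<..}"
      by (auto simp: inj_on_def)
  qed (auto simp: img intro!: derivative_eq_intros)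
  also have "\<dots> = (\<integral>\<^sup>+r\<in>{0<..}. ennreal (r ^ (?n - 1)) * (\<integral>\<^sup>+u. \<phi> ((norm (r *\<^sub>R u))\<^sup>2) \<partial>(surface_measure :: 'a measure)) \<partial>lborel)"
  proof (rule nn_integral_cong, goal_cases)
    case (1 r)
    show ?case
    proof (cases "r > 0")
      case True
      have "(\<integral>\<^sup>+u. \<phi> ((norm (r *\<^sub>R u))\<^sup>2) \<partial>(surface_measure :: 'a measure)) =
        (\<integral>\<^sup>+u. \<phi> (r\<^sup>2) \<partial>(surface_measure :: 'a measure))"
        by (rule nn_integral_cong) (simp add: space_surface_measure power_mult_distrib)
      also have "\<dots> = \<phi> (r\<^sup>2) * ennreal ?\<omega>"
        by (simp add: emeasure_surface_measure_space)
      finally have 1: "(\<integral>\<^sup>+u. \<phi> ((norm (r *\<^sub>R u))\<^sup>2) \<partial>(surface_measure :: 'a measure)) = \<phi> (r\<^sup>2) * ennreal ?\<omega>" .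
      have "r\<^sup>2 powr (real ?n / 2 - 1) = r powr (real ?n - 2)"
      proof -
        have "r\<^sup>2 powr (real ?n / 2 - 1) = (r powr 2) powr (real ?n / 2 - 1)" using True by simp
        also have "\<dots> = r powr (real ?n - 2)" unfolding powr_powr by (simp add: algebra_simps)
        finally show ?thesis .
      qed
      moreover have "r powr (real ?n - 2) * r = r ^ (?n - 1)"
      proof -
        have "r powr (real ?n - 2) * r powr 1 = r powr (real (?n - 1))"
          unfolding powr_add[symmetric] by (simp add: of_nat_diff)
        then show ?thesis using True by (simp only: powr_one less_imp_le powr_realpow)
      qed
      ultimately have "\<bar>2 * r\<bar> * (?\<omega> / 2 * r\<^sup>2 powr (real ?n / 2 - 1)) = r ^ (?n - 1) * ?\<omega>"
        using True by (simp add: mult_ac)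
      then have "ennreal \<bar>2 * r\<bar> * ennreal (?\<omega> / 2 * r\<^sup>2 powr (real ?n / 2 - 1)) = ennreal (r ^ (?n - 1)) * ennreal ?\<omega>"
        using True \<open>?\<omega> > 0\<close> by (subst (1 2) ennreal_mult[symmetric]) auto
      then show ?thesis unfolding 1 mult.assoc[symmetric] by (simp only: mult_ac)
    qed simp
  qed
  also have "\<dots> = (\<integral>\<^sup>+y. \<phi> ((norm y)\<^sup>2) \<partial>(lborel :: 'a measure))"
    by (rule nn_integral_polar[symmetric]) measurable
  finally show ?thesis by (simp add: img)
qed

text \<open>The cone over the exceptional directions lies in a hyperplane and is null. For x on the
  sphere bounding the ball this discards the tangential directions, along which both pieces of the
  chord are empty.\<close>

lemma AE_surface_measure_inner_nonzero:
  fixes x :: "'a::euclidean_space"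
  assumes "x \<noteq> 0"
  shows "AE u in surface_measure. x \<bullet> u \<noteq> 0"
proof -
  have neg: "{y. x \<bullet> y = 0} \<in> null_sets lborel"
    using negligible_hyperplane[of x 0] assms
    by (simp add: negligible_iff_null_sets null_sets_completion_iff)
  have "(\<integral>\<^sup>+u. indicator {u. x \<bullet> u = 0} u \<partial>surface_measure) = of_nat DIM('a) *
      (\<integral>\<^sup>+y\<in>{y. 0 < norm y \<and> norm y < 1}. indicator {u. x \<bullet> u = 0} (sgn y) \<partial>lborel)"
    by (rule nn_integral_surface_measure) measurable
  also have "(\<integral>\<^sup>+y\<in>{y. 0 < norm y \<and> norm y < 1}. indicator {u. x \<bullet> u = 0} (sgn y) \<partial>lborel) = (\<integral>\<^sup>+y. 0 \<partial>(lborel :: 'a measure))"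
    by (intro nn_integral_cong_AE, use AE_not_in[OF neg] in eventually_elim)
       (auto simp: indicator_def sgn_div_norm)
  finally have "(\<integral>\<^sup>+u. indicator {u. x \<bullet> u = 0} u \<partial>(surface_measure :: 'a measure)) = 0" by simp
  moreover have "(indicator {u. x \<bullet> u = 0} :: 'a \<Rightarrow> ennreal) \<in> borel_measurable surface_measure"
    by (subst measurable_cong_sets[OF sets_surface_measure refl], rule measurable_restrict_space1) measurable
  ultimately have "AE u in (surface_measure :: 'a measure). (indicator {u. x \<bullet> u = 0} u :: ennreal) = 0"
    by (subst (asm) nn_integral_0_iff_AE) auto
  then show ?thesis by eventually_elim (auto simp: indicator_def split: if_splits)
qed

section \<open>Riesz potentials of the layers E_w\<close>

lemma borel_measurable_riesz_kernel [measurable (raw)]: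
  fixes f g :: "'b \<Rightarrow> 'a::euclidean_space"
  assumes [measurable]: "f \<in> borel_measurable M" "g \<in> borel_measurable M"
  shows "(\<lambda>p. riesz_kernel s (f p) (g p)) \<in> borel_measurable M"
proof -
  have "riesz_kernel s (f p) (g p) = (if norm (f p - g p) = 0 then \<infinity> else ennreal (norm (f p - g p) powr (- s)))" for p
    by (simp add: riesz_kernel_def)
  then show ?thesis by (simp only:) measurable
qed

lemma riesz_kernel_commute: "riesz_kernel s x y = riesz_kernel s y x"
  by (simp add: riesz_kernel_def norm_minus_commute)

definition riesz_potential :: "real \<Rightarrow> ('a::euclidean_space \<Rightarrow> ennreal) \<Rightarrow> 'a \<Rightarrow> ennreal" where
  "riesz_potential s f x = (\<integral>\<^sup>+y. riesz_kernel s x y * f y \<partial>lborel)"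

text \<open>The function E_w of the overview, extended by zero from the open ball of radius sqrt
  w.\<close>

definition ball_weight :: "real \<Rightarrow> real \<Rightarrow> 'a::euclidean_space \<Rightarrow> ennreal" where
  "ball_weight l w y = (if (norm y)\<^sup>2 < w then ennreal ((w - (norm y)\<^sup>2) powr (l - 1)) else 0)"

lemma borel_measurable_ball_weight [measurable (raw)]:
  fixes g :: "'b \<Rightarrow> 'a::euclidean_space"
  assumes [measurable]: "f \<in> borel_measurable M" "g \<in> borel_measurable M"
  shows "(\<lambda>p. ball_weight l (f p) (g p)) \<in> borel_measurable M"
  unfolding ball_weight_def by measurable

lemma borel_measurable_riesz_potential [measurable (raw)]:
  fixes g :: "'b \<Rightarrow> 'a::euclidean_space"
  assumes [measurable]: "f \<in> borel_measurable borel" "g \<in> borel_measurable M"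
  shows "(\<lambda>p. riesz_potential s f (g p)) \<in> borel_measurable M"
  unfolding riesz_potential_def by measurable

text \<open>On the ray from \<open>x\<close> in the direction \<open>u\<close> the quantity \<open>w - |x + r u|\<^sup>2\<close> factors as
  \<open>(a - r) (r + b)\<close>, where \<open>a\<close> and \<open>- b\<close> are the parameters at which the line through \<open>x\<close> leaves the ball.\<close>

lemma chord_potential:
  fixes x u :: "'a::euclidean_space"
  assumes s: "s = real DIM('a) - 2 + 2 * l" and u: "norm u = 1" and le: "(norm x)\<^sup>2 \<le> w"
  defines "R \<equiv> sqrt ((x \<bullet> u)\<^sup>2 + w - (norm x)\<^sup>2)"
  shows "(\<integral>\<^sup>+r\<in>{0<..}. ennreal (r ^ (DIM('a) - 1)) * (riesz_kernel s x (x + r *\<^sub>R u) * ball_weight l w (x + r *\<^sub>R u)) \<partial>lborel) =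
    (\<integral>\<^sup>+t\<in>{0<..<R - x \<bullet> u}. ennreal (t powr (2 * (1 - l) - 1) * ((R - x \<bullet> u - t) * (t + (R + x \<bullet> u))) powr (- (1 - l))) \<partial>lborel)"
proof (rule nn_integral_cong, goal_cases)
  case (1 r)
  let ?c = "x \<bullet> u" and ?n = "DIM('a)"
  have R2: "R\<^sup>2 = ?c\<^sup>2 + w - (norm x)\<^sup>2" unfolding R_def by (rule real_sqrt_pow2) (use le zero_le_power2[of ?c] in linarith)
  have "\<bar>?c\<bar> = sqrt (?c\<^sup>2)" by simp
  also have "\<dots> \<le> R" unfolding R_def using le by (intro real_sqrt_le_mono) simp
  finally have Rc: "\<bar>?c\<bar> \<le> R" .
  have u2: "u \<bullet> u = 1" using u by (simp add: norm_eq_1)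
  have "(norm (x + r *\<^sub>R u))\<^sup>2 = (norm x)\<^sup>2 + 2 * r * ?c + r\<^sup>2"
    unfolding power2_norm_eq_inner by (simp add: inner_add_left inner_add_right inner_commute u2 power2_eq_square)
  then have fac: "w - (norm (x + r *\<^sub>R u))\<^sup>2 = (R - ?c - r) * (r + (R + ?c))"
    using R2 by (simp add: algebra_simps power2_eq_square)
  show ?case
  proof (cases "r > 0")
    case True
    have pos: "(norm (x + r *\<^sub>R u))\<^sup>2 < w \<longleftrightarrow> r < R - ?c"
    proof -
      have "(norm (x + r *\<^sub>R u))\<^sup>2 < w \<longleftrightarrow> 0 < (R - ?c - r) * (r + (R + ?c))" unfolding fac[symmetric] by auto
      also have "\<dots> \<longleftrightarrow> r < R - ?c" using True Rc by (auto simp: zero_less_mult_iff)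
      finally show ?thesis .
    qed
    have "u \<noteq> 0" using u by auto
    then have k: "riesz_kernel s x (x + r *\<^sub>R u) = ennreal (r powr (- s))"
      using True u by (simp add: riesz_kernel_def)
    \<comment> \<open>Polar coordinates and the kernel together give r^(n-1-s); the choice of s
      turns the exponent into 2 (1 - \<lambda>) - 1, independent of the dimension, as the chord
      integrals require.\<close>
    have "r ^ (?n - 1) * r powr (- s) = r powr (2 * (1 - l) - 1)"
    proof -
      have "r ^ (?n - 1) = r powr (real ?n - 1)" using True by (simp add: powr_realpow[symmetric] of_nat_diff)
      then show ?thesis by (simp add: powr_add[symmetric] s)
    qed
    then have "ennreal (r ^ (?n - 1)) * ennreal (r powr (- s)) = ennreal (r powr (2 * (1 - l) - 1))"
      using True by (simp add: ennreal_mult[symmetric])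
    then show ?thesis using True
      by (simp add: k ball_weight_def pos fac mult.assoc[symmetric] ennreal_mult)
  qed simp
qed

text \<open>The closed ball is covered, because points on the rim of the disk lie on the sphere
  bounding the ball of E_1; there the argument holds for almost every direction only.\<close>

lemma riesz_potential_ball_weight_inside:
  fixes x :: "'a::euclidean_space"
  assumes l: "0 < l" "l < 1" and s: "s = real DIM('a) - 2 + 2 * l" and w: "w > 0" "(norm x)\<^sup>2 \<le> w"
  shows "riesz_potential s (ball_weight l w) x =
    ennreal (half_sphere_area (real DIM('a)) * Beta l (1 - l))"
proof -
  let ?n = "DIM('a)" and ?\<omega> = "2 * pi powr (real DIM('a) / 2) / Gamma (real DIM('a) / 2)"
  define h where "h z = riesz_kernel s x (x + z) * ball_weight l w (x + z)" for z
  have [measurable]: "h \<in> borel_measurable borel" unfolding h_def[abs_def] by measurable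
  have U: "riesz_potential s (ball_weight l w) x = (\<integral>\<^sup>+z. h z \<partial>lborel)"
    unfolding riesz_potential_def h_def
    using nn_integral_euclidean_affine[of "\<lambda>y. riesz_kernel s x y * ball_weight l w y" 1 x] by simp
  \<comment> \<open>Reflection in x: adding the two expressions for the potential pairs the
    direction u with - u, so that whole chords appear.\<close>
  also have "\<dots> = (\<integral>\<^sup>+z. h (- z) \<partial>lborel)"
    using nn_integral_euclidean_affine[of h "- 1" 0] by simp
  finally have U': "riesz_potential s (ball_weight l w) x = (\<integral>\<^sup>+z. h (- z) \<partial>lborel)" .
  define J where "J u = (\<integral>\<^sup>+r\<in>{0<..}. ennreal (r ^ (?n - 1)) * h (r *\<^sub>R u) \<partial>lborel)" for u
  have Jeq: "J u + J (- u) = ennreal (Beta l (1 - l))" if u: "norm u = 1" and ne: "(norm x)\<^sup>2 = w \<Longrightarrow> x \<bullet> u \<noteq> 0" for u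
  proof -
    define R where "R = sqrt ((x \<bullet> u)\<^sup>2 + w - (norm x)\<^sup>2)"
    have J1: "J u = (\<integral>\<^sup>+t\<in>{0<..<R - x \<bullet> u}. ennreal (t powr (2 * (1 - l) - 1) * ((R - x \<bullet> u - t) * (t + (R + x \<bullet> u))) powr (- (1 - l))) \<partial>lborel)"
      using chord_potential[OF s u w(2)] by (simp add: J_def h_def R_def)
    have J2: "J (- u) = (\<integral>\<^sup>+t\<in>{0<..<R + x \<bullet> u}. ennreal (t powr (2 * (1 - l) - 1) * ((R + x \<bullet> u - t) * (t + (R - x \<bullet> u))) powr (- (1 - l))) \<partial>lborel)"
      using chord_potential[OF s _ w(2), of "- u"] u by (simp add: J_def h_def R_def)
    show ?thesis
    proof (cases "(norm x)\<^sup>2 = w")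
      case False
      then have lt: "(norm x)\<^sup>2 < w" using w by simp
      have "\<bar>x \<bullet> u\<bar> = sqrt ((x \<bullet> u)\<^sup>2)" by simp
      also have "\<dots> < R" unfolding R_def using lt by (intro real_sqrt_less_mono) simp
      finally have "R - x \<bullet> u > 0" "R + x \<bullet> u > 0" by auto
      from nn_integral_chord_pair[OF _ _ this, of "1 - l"] show ?thesis
        unfolding J1 J2 using l by simp
    next
      \<comment> \<open>On the boundary x is itself an end of each chord: one piece is empty and the
        other has length 2 |x \<bullet> u|.\<close>
      case True
      then have R: "R = \<bar>x \<bullet> u\<bar>" by (simp add: R_def)
      show ?thesis
      proof (cases "x \<bullet> u > 0")
        case True
        have "J u = 0" unfolding J1 R using True by simp
        moreover have "J (- u) = ennreal (Beta l (1 - l))"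
          unfolding J2 R using True l nn_integral_chord_tangent[of "1 - l" "2 * (x \<bullet> u)"] by simp
        ultimately show ?thesis by simp
      next
        case False
        with ne[OF \<open>(norm x)\<^sup>2 = w\<close>] have neg: "x \<bullet> u < 0" by simp
        have "J (- u) = 0" unfolding J2 R using neg by simp
        moreover have "J u = ennreal (Beta l (1 - l))"
          unfolding J1 R using neg l nn_integral_chord_tangent[of "1 - l" "- 2 * (x \<bullet> u)"] by simp
        ultimately show ?thesis by simp
      qed
    qed
  qed
  have AEJ: "AE u in surface_measure. J u + J (- u) = ennreal (Beta l (1 - l))"
  proof (cases "(norm x)\<^sup>2 = w")
    case True
    then have "x \<noteq> 0" using w by auto
    have "AE u in (surface_measure :: 'a measure). norm u = 1"
      by (rule AE_I2) (simp add: space_surface_measure)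
    with AE_surface_measure_inner_nonzero[OF \<open>x \<noteq> 0\<close>] show ?thesis
      by eventually_elim (rule Jeq)
  next
    case False
    then show ?thesis by (intro AE_I2 Jeq) (auto simp: space_surface_measure)
  qed
  have "riesz_potential s (ball_weight l w) x + riesz_potential s (ball_weight l w) x = (\<integral>\<^sup>+z. h z + h (- z) \<partial>lborel)"
    by (subst nn_integral_add) (measurable, simp only: U'[symmetric] U[symmetric])
  also have "\<dots> = (\<integral>\<^sup>+u. (\<integral>\<^sup>+r\<in>{0<..}. ennreal (r ^ (?n - 1)) * (h (r *\<^sub>R u) + h (- (r *\<^sub>R u))) \<partial>lborel) \<partial>surface_measure)"
    by (rule nn_integral_polar'[of "\<lambda>z. h z + h (- z)"]) measurable
  also have "\<dots> = (\<integral>\<^sup>+u. J u + J (- u) \<partial>surface_measure)"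
  proof (rule nn_integral_cong, goal_cases)
    case (1 u)
    have "J u + J (- u) = (\<integral>\<^sup>+r. ennreal (r ^ (?n - 1)) * h (r *\<^sub>R u) * indicator {0<..} r + ennreal (r ^ (?n - 1)) * h (r *\<^sub>R (- u)) * indicator {0<..} r \<partial>lborel)"
      unfolding J_def by (rule nn_integral_add[symmetric]) measurable
    then show ?case
      by (simp only: distrib_left distrib_right scaleR_minus_right)
  qed
  also have "\<dots> = (\<integral>\<^sup>+u. ennreal (Beta l (1 - l)) \<partial>(surface_measure :: 'a measure))"
    by (rule nn_integral_cong_AE[OF AEJ])
  also have "\<dots> = ennreal (Beta l (1 - l)) * ennreal ?\<omega>"
    by (simp only: nn_integral_const emeasure_surface_measure_space)
  finally have "2 * riesz_potential s (ball_weight l w) x = ennreal (Beta l (1 - l)) * ennreal ?\<omega>"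
    by (simp only: mult_2)
  also have "\<dots> = 2 * ennreal (pi powr (real ?n / 2) / Gamma (real ?n / 2) * Beta l (1 - l))"
  proof -
    define c where "c = pi powr (real ?n / 2) / Gamma (real ?n / 2)"
    have c: "c > 0" by (simp add: c_def Gamma_real_pos)
    have B: "Beta l (1 - l) > 0" using l by (simp add: Beta_def Gamma_real_pos)
    have "ennreal (Beta l (1 - l)) * ennreal ?\<omega> = ennreal (Beta l (1 - l) * (2 * c))"
      using B c by (subst ennreal_mult) (simp_all add: c_def)
    also have "\<dots> = ennreal (2 * (c * Beta l (1 - l)))" by (simp add: mult_ac)
    also have "\<dots> = 2 * ennreal (c * Beta l (1 - l))"
      using B c by (subst ennreal_mult) simp_all
    finally show ?thesis unfolding c_def .

  qed
  finally show ?thesis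
    by (subst (asm) ennreal_mult_cancel_left) simp
qed

lemma nn_integral_ball_weight:
  assumes l: "0 < l" "l < 1" and w: "w > 0"
  shows "(\<integral>\<^sup>+y. ball_weight l w y \<partial>(lborel :: 'a::euclidean_space measure)) =
    ennreal (half_sphere_area (real DIM('a)) * Beta (real DIM('a) / 2) l * w powr (real DIM('a) / 2 + l - 1))"
proof -
  let ?n = "real DIM('a)" and ?c = "half_sphere_area (real DIM('a))"
  have c: "?c > 0" by (simp add: Gamma_real_pos)
  have "(\<integral>\<^sup>+y. ball_weight l w y \<partial>(lborel :: 'a measure)) =
    (\<integral>\<^sup>+v\<in>{0<..}. ennreal (?c * v powr (?n / 2 - 1)) * (if v < w then ennreal ((w - v) powr (l - 1)) else 0) \<partial>lborel)"
    unfolding ball_weight_def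
    by (rule nn_integral_radial[of "\<lambda>v. if v < w then ennreal ((w - v) powr (l - 1)) else 0"]) measurable
  also have "\<dots> = (\<integral>\<^sup>+v. ennreal ?c * (ennreal ((v - 0) powr (?n / 2 - 1) * (w - v) powr (l - 1)) * indicator {0<..<w} v) \<partial>lborel)"
    using c by (intro nn_integral_cong) (auto simp: indicator_def ennreal_mult[symmetric] mult.assoc)
  also have "\<dots> = ennreal ?c * ennreal ((w - 0) powr (?n / 2 + l - 1) * Beta (?n / 2) l)"
    by (subst nn_integral_cmult, measurable, subst nn_integral_Beta_Ioo) (use l w in auto)
  also have "\<dots> = ennreal (?c * Beta (?n / 2) l * w powr (?n / 2 + l - 1))"
    using c by (subst ennreal_mult'[symmetric]) (auto simp: mult_ac)
  finally show ?thesis .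
qed

lemma riesz_potential_symmetric:
  fixes f g :: "'a::euclidean_space \<Rightarrow> ennreal"
  assumes [measurable]: "f \<in> borel_measurable borel" "g \<in> borel_measurable borel"
  shows "(\<integral>\<^sup>+x. f x * riesz_potential s g x \<partial>lborel) = (\<integral>\<^sup>+x. g x * riesz_potential s f x \<partial>lborel)"
proof -
  have "(\<integral>\<^sup>+x. f x * riesz_potential s g x \<partial>lborel) = (\<integral>\<^sup>+x. (\<integral>\<^sup>+y. f x * (riesz_kernel s x y * g y) \<partial>lborel) \<partial>lborel)"
    unfolding riesz_potential_def by (simp add: nn_integral_cmult)
  also have "\<dots> = (\<integral>\<^sup>+y. (\<integral>\<^sup>+x. f x * (riesz_kernel s x y * g y) \<partial>lborel) \<partial>lborel)"
    by (rule lborel_pair.Fubini') measurable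
  also have "\<dots> = (\<integral>\<^sup>+y. (\<integral>\<^sup>+x. g y * (riesz_kernel s y x * f x) \<partial>lborel) \<partial>lborel)"
    by (simp only: riesz_kernel_commute mult_ac)
  also have "\<dots> = (\<integral>\<^sup>+x. g x * riesz_potential s f x \<partial>lborel)"
    unfolding riesz_potential_def by (simp add: nn_integral_cmult)
  finally show ?thesis .
qed

text \<open>On the smaller ball the potential of the other weight is constant, so the energy is this
  constant times the mass of the smaller weight. Symmetry of the kernel covers the other order; the
  value of a potential outside its ball never enters.\<close>

lemma ball_weight_mutual_energy:
  assumes l: "0 < l" "l < 1" and s: "s = real DIM('a) - 2 + 2 * l" and pos: "v > 0" "w > 0"
  shows "(\<integral>\<^sup>+x. ball_weight l v x * riesz_potential s (ball_weight l w) x \<partial>(lborel :: 'a::euclidean_space measure)) =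
    ennreal (half_sphere_area (real DIM('a)) * Beta l (1 - l)) *
    ennreal (half_sphere_area (real DIM('a)) * Beta (real DIM('a) / 2) l * (min v w) powr (s / 2))"
proof -
  have *: "(\<integral>\<^sup>+x. ball_weight l v x * riesz_potential s (ball_weight l w) x \<partial>(lborel :: 'a measure)) =
    ennreal (half_sphere_area (real DIM('a)) * Beta l (1 - l)) *
    ennreal (half_sphere_area (real DIM('a)) * Beta (real DIM('a) / 2) l * v powr (s / 2))"
    if vw: "0 < v" "v \<le> w" for v w
  proof -
    have "(\<integral>\<^sup>+x. ball_weight l v x * riesz_potential s (ball_weight l w) x \<partial>(lborel :: 'a measure)) =
      (\<integral>\<^sup>+x. ennreal (half_sphere_area (real DIM('a)) * Beta l (1 - l)) * ball_weight l v x \<partial>(lborel :: 'a measure))"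
    proof (rule nn_integral_cong, goal_cases)
      case (1 x)
      show ?case
      proof (cases "(norm x)\<^sup>2 < v")
        case True
        then show ?thesis using vw by (subst riesz_potential_ball_weight_inside[OF l s]) (auto simp: mult_ac)
      qed (simp add: ball_weight_def)
    qed
    also have "\<dots> = ennreal (half_sphere_area (real DIM('a)) * Beta l (1 - l)) *
      ennreal (half_sphere_area (real DIM('a)) * Beta (real DIM('a) / 2) l * v powr (real DIM('a) / 2 + l - 1))"
      using vw by (subst nn_integral_cmult) (auto simp: nn_integral_ball_weight l)
    also have "real DIM('a) / 2 + l - 1 = s / 2" by (simp add: s field_simps)
    finally show ?thesis .
  qed
  show ?thesis
  proof (cases "v \<le> w")
    case True
    then show ?thesis using *[OF pos(1) True] by (simp add: min_def)
  next
    case False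
    then have wv: "w \<le> v" by simp
    show ?thesis
      using *[OF pos(2) wv] False by (subst riesz_potential_symmetric) (auto simp: min_def)
  qed
qed


section \<open>Abel's equation\<close>

text \<open>Fractional integration of order \<lambda> followed by order 1 - \<lambda> is ordinary
  integration up to a factor: after an exchange the inner integral over T in (v, S) is a Beta
  integral that depends on neither v nor S.\<close>

lemma abel_inversion:
  fixes f :: "real \<Rightarrow> ennreal"
  assumes l: "0 < l" "l < 1" and [measurable]: "f \<in> borel_measurable borel"
  shows "(\<integral>\<^sup>+T\<in>{0<..<S}. ennreal ((S - T) powr (- l)) *
      (\<integral>\<^sup>+v\<in>{0<..<T}. ennreal ((T - v) powr (l - 1)) * f v \<partial>lborel) \<partial>lborel) =
    ennreal (Beta l (1 - l)) * (\<integral>\<^sup>+v\<in>{0<..<S}. f v \<partial>lborel)"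
proof -
  have "(\<integral>\<^sup>+T\<in>{0<..<S}. ennreal ((S - T) powr (- l)) *
      (\<integral>\<^sup>+v\<in>{0<..<T}. ennreal ((T - v) powr (l - 1)) * f v \<partial>lborel) \<partial>lborel) =
    (\<integral>\<^sup>+T. (\<integral>\<^sup>+v. f v * indicator {0<..<S} v *
      (ennreal ((T - v) powr (l - 1) * (S - T) powr ((1 - l) - 1)) * indicator {v<..<S} T) \<partial>lborel) \<partial>lborel)"
  proof (rule nn_integral_cong)
    fix T :: real
    have "ennreal ((S - T) powr (- l)) * (\<integral>\<^sup>+v\<in>{0<..<T}. ennreal ((T - v) powr (l - 1)) * f v \<partial>lborel) * indicator {0<..<S} T
      = (\<integral>\<^sup>+v. (ennreal ((S - T) powr (- l)) * indicator {0<..<S} T) * (ennreal ((T - v) powr (l - 1)) * f v * indicator {0<..<T} v) \<partial>lborel)"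
      by (subst nn_integral_cmult) (auto simp: mult_ac)
    also have "\<dots> = (\<integral>\<^sup>+v. f v * indicator {0<..<S} v *
      (ennreal ((T - v) powr (l - 1) * (S - T) powr ((1 - l) - 1)) * indicator {v<..<S} T) \<partial>lborel)"
      by (intro nn_integral_cong) (auto simp: indicator_def ennreal_mult mult_ac)
    finally show "ennreal ((S - T) powr (- l)) * (\<integral>\<^sup>+v\<in>{0<..<T}. ennreal ((T - v) powr (l - 1)) * f v \<partial>lborel) * indicator {0<..<S} T = \<dots>" .
  qed
  also have "\<dots> = (\<integral>\<^sup>+v. (\<integral>\<^sup>+T. f v * indicator {0<..<S} v *
      (ennreal ((T - v) powr (l - 1) * (S - T) powr ((1 - l) - 1)) * indicator {v<..<S} T) \<partial>lborel) \<partial>lborel)"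
    by (rule lborel_pair.Fubini') (simp add: indicator_def)
  also have "\<dots> = (\<integral>\<^sup>+v. ennreal (Beta l (1 - l)) * (f v * indicator {0<..<S} v) \<partial>lborel)"
  proof (rule nn_integral_cong, goal_cases)
    case (1 v)
    have "(\<integral>\<^sup>+T. f v * indicator {0<..<S} v *
      (ennreal ((T - v) powr (l - 1) * (S - T) powr ((1 - l) - 1)) * indicator {v<..<S} T) \<partial>lborel) =
      f v * indicator {0<..<S} v *
      (\<integral>\<^sup>+T\<in>{v<..<S}. ennreal ((T - v) powr (l - 1) * (S - T) powr ((1 - l) - 1)) \<partial>lborel)"
      by (rule nn_integral_cmult) measurable
    also have "\<dots> = ennreal (Beta l (1 - l)) * (f v * indicator {0<..<S} v)"
    proof (cases "v < S")
      case True
      then show ?thesis using l by (subst nn_integral_Beta_Ioo) (auto simp: mult.commute)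
    qed (simp add: indicator_def)
    finally show ?case .
  qed
  also have "\<dots> = ennreal (Beta l (1 - l)) * (\<integral>\<^sup>+v\<in>{0<..<S}. f v \<partial>lborel)"
    by (rule nn_integral_cmult) measurable
  finally show ?thesis .
qed

text \<open>By \<open>abel_inversion\<close> equal Abel transforms give equal integrals over every
  interval (0, S), and finite integrals over such intervals determine a density almost
  everywhere.\<close>

lemma abel_integral_unique:
  fixes f g :: "real \<Rightarrow> ennreal"
  assumes l: "0 < l" "l < 1" and [measurable]: "f \<in> borel_measurable borel" "g \<in> borel_measurable borel"
    and eq: "\<And>T. T > 0 \<Longrightarrow> (\<integral>\<^sup>+v\<in>{0<..<T}. ennreal ((T - v) powr (l - 1)) * f v \<partial>lborel) =
      (\<integral>\<^sup>+v\<in>{0<..<T}. ennreal ((T - v) powr (l - 1)) * g v \<partial>lborel)"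
    and fin: "\<And>T. T > 0 \<Longrightarrow> (\<integral>\<^sup>+v\<in>{0<..<T}. ennreal ((T - v) powr (l - 1)) * f v \<partial>lborel) < \<infinity>"
  shows "AE v in lborel. v > 0 \<longrightarrow> f v = g v"
proof -
  have B: "Beta l (1 - l) > 0" using l by (simp add: Beta_def Gamma_real_pos)
  have int_eq: "(\<integral>\<^sup>+v\<in>{0<..<S}. f v \<partial>lborel) = (\<integral>\<^sup>+v\<in>{0<..<S}. g v \<partial>lborel)" for S
  proof -
    have "ennreal (Beta l (1 - l)) * (\<integral>\<^sup>+v\<in>{0<..<S}. f v \<partial>lborel) =
      ennreal (Beta l (1 - l)) * (\<integral>\<^sup>+v\<in>{0<..<S}. g v \<partial>lborel)"
      unfolding abel_inversion[OF l assms(3), symmetric] abel_inversion[OF l assms(4), symmetric]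
    proof (rule nn_integral_cong)
      fix T
      show "ennreal ((S - T) powr (- l)) * (\<integral>\<^sup>+v\<in>{0<..<T}. ennreal ((T - v) powr (l - 1)) * f v \<partial>lborel) * indicator {0<..<S} T =
        ennreal ((S - T) powr (- l)) * (\<integral>\<^sup>+v\<in>{0<..<T}. ennreal ((T - v) powr (l - 1)) * g v \<partial>lborel) * indicator {0<..<S} T"
      proof (cases "T > 0")
        case True
        show ?thesis unfolding eq[OF True] ..
      qed simp
    qed
    then show ?thesis using B by (subst (asm) ennreal_mult_cancel_left) auto
  qed
  \<comment> \<open>The kernel (S - v)^(\<lambda>-1) is at least S^(\<lambda>-1) on (0, S), so
    finiteness passes from the Abel transform to the plain integral. It is what permits the
    cancellation of the part over (0, x) below.\<close>
  have fin': "(\<integral>\<^sup>+v\<in>{0<..<S}. f v \<partial>lborel) < \<infinity>" if "S > 0" for S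
  proof -
    have "ennreal (S powr (l - 1)) * (\<integral>\<^sup>+v\<in>{0<..<S}. f v \<partial>lborel) =
      (\<integral>\<^sup>+v. ennreal (S powr (l - 1)) * (f v * indicator {0<..<S} v) \<partial>lborel)"
      by (rule nn_integral_cmult[symmetric]) measurable
    also have "\<dots> \<le> (\<integral>\<^sup>+v\<in>{0<..<S}. ennreal ((S - v) powr (l - 1)) * f v \<partial>lborel)"
      using l by (intro nn_integral_mono) (auto simp: indicator_def intro!: mult_right_mono ennreal_leI powr_mono2')
    also have "\<dots> < \<infinity>" by (rule fin[OF that])
    finally show ?thesis using that by (auto simp: ennreal_mult_less_top)
  qed
  \<comment> \<open>Restricted to (0, N), both densities give finite measures that agree on all
    half-lines; countably many N exhaust v > 0.\<close>
  have "AE v in lborel. f v * indicator {0<..<real N} v = g v * indicator {0<..<real N} v" for N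
  proof (cases "N = 0")
    case False
    then have N: "real N > 0" by simp
    let ?F = "\<lambda>v. f v * indicator {0<..<real N} v" and ?G = "\<lambda>v. g v * indicator {0<..<real N} v"
    have tail: "emeasure (density lborel (\<lambda>v. k v * indicator {0<..<real N} v)) {x<..} =
        (\<integral>\<^sup>+v\<in>{max 0 x<..<real N}. k v \<partial>lborel)"
      if [measurable]: "k \<in> borel_measurable borel" for k x
      by (subst emeasure_density) (auto intro!: nn_integral_cong simp: indicator_def)
    have split: "(\<integral>\<^sup>+v\<in>{0<..<real N}. k v \<partial>lborel) = (\<integral>\<^sup>+v\<in>{0<..<x}. k v \<partial>lborel) + (\<integral>\<^sup>+v\<in>{x<..<real N}. k v \<partial>lborel)"
      if [measurable]: "k \<in> borel_measurable borel" and x: "0 < x" "x < real N" for k :: "real \<Rightarrow> ennreal" and x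
    proof -
      have "(\<integral>\<^sup>+v\<in>{0<..<x}. k v \<partial>lborel) + (\<integral>\<^sup>+v\<in>{x<..<real N}. k v \<partial>lborel) =
        (\<integral>\<^sup>+v. k v * indicator {0<..<x} v + k v * indicator {x<..<real N} v \<partial>lborel)"
        by (rule nn_integral_add[symmetric]) measurable
      also have "\<dots> = (\<integral>\<^sup>+v\<in>{0<..<real N}. k v \<partial>lborel)"
        by (intro nn_integral_cong_AE, use AE_lborel_singleton[of x] in eventually_elim)
           (use x in \<open>auto simp: indicator_def\<close>)
      finally show ?thesis by simp
    qed
    have "density lborel ?F = density lborel ?G"
    proof (rule measure_eqI_lessThan)
      fix x
      have "emeasure (density lborel ?F) {x<..} \<le> (\<integral>\<^sup>+v\<in>{0<..<real N}. f v \<partial>lborel)"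
        by (subst emeasure_density) (auto intro!: nn_integral_mono simp: indicator_def)
      then show "emeasure (density lborel ?F) {x<..} < \<infinity>" using fin'[OF N] by (rule le_less_trans)
      show "emeasure (density lborel ?F) {x<..} = emeasure (density lborel ?G) {x<..}"
      proof (cases "0 < x \<and> x < real N")
        case True
        have "(\<integral>\<^sup>+v\<in>{0<..<x}. f v \<partial>lborel) + (\<integral>\<^sup>+v\<in>{x<..<real N}. f v \<partial>lborel) =
          (\<integral>\<^sup>+v\<in>{0<..<real N}. f v \<partial>lborel)"
          by (rule split[symmetric]) (use True in auto)
        also have "\<dots> = (\<integral>\<^sup>+v\<in>{0<..<real N}. g v \<partial>lborel)" by (rule int_eq)
        also have "\<dots> = (\<integral>\<^sup>+v\<in>{0<..<x}. g v \<partial>lborel) + (\<integral>\<^sup>+v\<in>{x<..<real N}. g v \<partial>lborel)"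
          by (rule split) (use True in auto)
        also have "(\<integral>\<^sup>+v\<in>{0<..<x}. g v \<partial>lborel) = (\<integral>\<^sup>+v\<in>{0<..<x}. f v \<partial>lborel)" by (rule int_eq[symmetric])
        finally have "(\<integral>\<^sup>+v\<in>{x<..<real N}. f v \<partial>lborel) = (\<integral>\<^sup>+v\<in>{x<..<real N}. g v \<partial>lborel)"
          using fin'[of x] True by (auto simp: ennreal_add_left_cancel)
        then show ?thesis using True by (simp add: tail)
      qed (auto simp: tail int_eq max_def)
    qed auto
    then show ?thesis by (intro sigma_finite_measure.density_unique[OF sigma_finite_lborel]) auto
  qed simp
  then have "AE v in lborel. \<forall>N. f v * indicator {0<..<real N} v = g v * indicator {0<..<real N} v"
    by (simp add: AE_all_countable)
  then show ?thesis
  proof eventually_elim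
    case (elim v)
    obtain N where "v < real N" using reals_Archimedean2 by blast
    with elim[rule_format, of N] show ?case by (auto simp: indicator_def split: if_splits)
  qed
qed

section \<open>Rotation and dilation invariance of the layer potentials\<close>

lemma riesz_potential_ball_weight_isometric:
  fixes x y :: "real ^ 'm"
  assumes "norm x = norm y"
  shows "riesz_potential s (ball_weight l w) x = riesz_potential s (ball_weight l w) y"
proof -
  obtain T where T: "orthogonal_transformation T" "T x = y"
    using orthogonal_transformation_exists[OF assms] by blast
  interpret T: linear T using T(1) by (rule orthogonal_transformation_linear)
  have nT: "norm (T z) = norm z" for z using T(1) by (simp add: orthogonal_transformation_norm)
  have "riesz_potential s (ball_weight l w) y = (\<integral>\<^sup>+z. riesz_kernel s (T x) (T z) * ball_weight l w (T z) \<partial>lborel)"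
    unfolding riesz_potential_def T(2)
    by (rule nn_integral_isometry[OF T(1), symmetric]) measurable
  also have "\<dots> = riesz_potential s (ball_weight l w) x"
    unfolding riesz_potential_def
  proof (rule nn_integral_cong, goal_cases)
    case (1 z)
    have "norm (T x - T z) = norm (x - z)" by (simp add: T.diff[symmetric] nT)
    then have "riesz_kernel s (T x) (T z) = riesz_kernel s x z"
      unfolding riesz_kernel_def by (metis eq_iff_diff_eq_0 norm_eq_zero)
    then show ?case
      by (simp add: ball_weight_def nT)
  qed
  finally show ?thesis by simp
qed

text \<open>Under dilation by c the Lebesgue measure, the kernel and the weight contribute the
  exponents n, - s and 2 (\<lambda> - 1), which cancel by the choice of s. The lemma trades a
  varying point for a varying ball.\<close>

lemma riesz_potential_ball_weight_scale:
  fixes x :: "'a::euclidean_space"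
  assumes s: "s = real DIM('a) - 2 + 2 * l" and c: "c > 0"
  shows "riesz_potential s (ball_weight l (c\<^sup>2 * w)) (c *\<^sub>R x) = riesz_potential s (ball_weight l w) x"
proof -
  have k: "riesz_kernel s (c *\<^sub>R x) (c *\<^sub>R z) = ennreal (c powr (- s)) * riesz_kernel s x z" for z :: 'a
  proof (cases "x = z")
    case False
    have "norm (c *\<^sub>R x - c *\<^sub>R z) = c * norm (x - z)"
      using c by (simp add: scaleR_diff_right[symmetric])
    then show ?thesis using False c by (simp add: riesz_kernel_def powr_mult ennreal_mult)
  qed (use c in \<open>simp add: riesz_kernel_def ennreal_mult_eq_top_iff ennreal_mult_top\<close>)
  have e: "ball_weight l (c\<^sup>2 * w) (c *\<^sub>R z) = ennreal (c powr (2 * (l - 1))) * ball_weight l w z" for z :: 'a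
  proof -
    have "(norm (c *\<^sub>R z))\<^sup>2 < c\<^sup>2 * w \<longleftrightarrow> (norm z)\<^sup>2 < w"
      using c by (simp add: power_mult_distrib)
    moreover have "(c\<^sup>2 * w - (norm (c *\<^sub>R z))\<^sup>2) powr (l - 1) = c powr (2 * (l - 1)) * (w - (norm z)\<^sup>2) powr (l - 1)"
      if "(norm z)\<^sup>2 < w"
    proof -
      have "c\<^sup>2 * w - (norm (c *\<^sub>R z))\<^sup>2 = c\<^sup>2 * (w - (norm z)\<^sup>2)"
        using c by (simp add: power_mult_distrib algebra_simps)
      moreover have "c\<^sup>2 powr (l - 1) = c powr (2 * (l - 1))"
      proof -
        have "c\<^sup>2 = c powr 2" using c by simp
        then show ?thesis by (simp only: powr_powr)
      qed
      ultimately show ?thesis using that c by (simp add: powr_mult)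
    qed
    ultimately show ?thesis unfolding ball_weight_def by (simp add: ennreal_mult)
  qed
  have "c ^ DIM('a) * (c powr (- s) * c powr (2 * (l - 1))) = 1"
    using c unfolding s by (simp add: powr_realpow[symmetric] powr_add[symmetric])
  then have 1: "ennreal (c ^ DIM('a)) * (ennreal (c powr (- s)) * ennreal (c powr (2 * (l - 1)))) = 1"
    using c by (simp add: ennreal_mult[symmetric])
  have "riesz_potential s (ball_weight l (c\<^sup>2 * w)) (c *\<^sub>R x) =
    ennreal (\<bar>c\<bar> ^ DIM('a)) * (\<integral>\<^sup>+z. riesz_kernel s (c *\<^sub>R x) (0 + c *\<^sub>R z) * ball_weight l (c\<^sup>2 * w) (0 + c *\<^sub>R z) \<partial>lborel)"
    unfolding riesz_potential_def by (rule nn_integral_euclidean_affine) (use c in auto)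
  also have "\<dots> = ennreal (c ^ DIM('a)) * (\<integral>\<^sup>+z. (ennreal (c powr (- s)) * ennreal (c powr (2 * (l - 1)))) * (riesz_kernel s x z * ball_weight l w z) \<partial>lborel)"
    using c unfolding add_0_left k e by (simp only: mult_ac abs_of_pos)
  also have "\<dots> = ennreal (c ^ DIM('a)) * ((ennreal (c powr (- s)) * ennreal (c powr (2 * (l - 1)))) * (\<integral>\<^sup>+z. (riesz_kernel s x z * ball_weight l w z) \<partial>lborel))"
    by (subst nn_integral_cmult) measurable
  also have "\<dots> = riesz_potential s (ball_weight l w) x"
    unfolding mult.assoc[symmetric] 1[unfolded mult.assoc[symmetric]] riesz_potential_def by simp
  finally show ?thesis .
qed

text \<open>The candidate for the potential of \<^const>\<open>ball_weight\<close> at distance \<open>sqrt v\<close> from the origin.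
  Its Abel transform in \<open>v\<close> is a multiple of \<open>(min w T) powr (s / 2)\<close>, like the mutual
  energy of the weights for \<open>w\<close> and \<open>T\<close>.\<close>

definition ball_potential :: "real \<Rightarrow> real \<Rightarrow> real \<Rightarrow> real \<Rightarrow> ennreal" where
  "ball_potential n l w v = (\<integral>\<^sup>+u\<in>{0<..<min w v}. ennreal (half_sphere_area n * Beta (n / 2) l *
     ((n - 2 + 2 * l) / 2) * v powr (1 - n / 2) * (u powr ((n - 2 + 2 * l) / 2 - 1) * (v - u) powr (- l))) \<partial>lborel)"

lemma borel_measurable_ball_potential [measurable (raw)]:
  assumes [measurable]: "f \<in> borel_measurable M" "g \<in> borel_measurable M"
  shows "(\<lambda>p. ball_potential n l (f p) (g p)) \<in> borel_measurable M"
proof -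
  have "ball_potential n l (f p) (g p) = (\<integral>\<^sup>+u. ennreal (half_sphere_area n * Beta (n / 2) l *
     ((n - 2 + 2 * l) / 2) * g p powr (1 - n / 2) * (u powr ((n - 2 + 2 * l) / 2 - 1) * (g p - u) powr (- l))) *
     (if 0 < u \<and> u < f p \<and> u < g p then 1 else 0) \<partial>lborel)" for p
    unfolding ball_potential_def by (intro nn_integral_cong) (auto simp: indicator_def)
  then show ?thesis by (simp only:) measurable
qed

text \<open>The same homogeneity for the candidate: the exponents 1, 1 - n/2, s/2 - 1 and -
  \<lambda> add up to 0.\<close>

lemma ball_potential_scale:
  assumes c: "c > 0"
  shows "ball_potential n l (c * w) (c * v) = ball_potential n l w v"
proof (cases "v > 0")
  case True
  define k where "k = half_sphere_area n * Beta (n / 2) l * ((n - 2 + 2 * l) / 2)"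
  let ?f = "\<lambda>w v u. ennreal (k * v powr (1 - n / 2) * (u powr ((n - 2 + 2 * l) / 2 - 1) * (v - u) powr (- l))) * indicator {0<..<min w v} u"
  have "ball_potential n l (c * w) (c * v) = ennreal \<bar>c\<bar> * (\<integral>\<^sup>+u. ?f (c * w) (c * v) (0 + c * u) \<partial>lborel)"
    unfolding ball_potential_def k_def[symmetric] by (rule nn_integral_real_affine) (use c in auto)
  also have "\<dots> = (\<integral>\<^sup>+u. ennreal \<bar>c\<bar> * ?f (c * w) (c * v) (0 + c * u) \<partial>lborel)"
    by (rule nn_integral_cmult[symmetric]) measurable
  also have "\<dots> = (\<integral>\<^sup>+u. ?f w v u \<partial>lborel)"
  proof (rule nn_integral_cong, goal_cases)
    case (1 u)
    have ind: "0 + c * u \<in> {0<..<min (c * w) (c * v)} \<longleftrightarrow> u \<in> {0<..<min w v}"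
      using c by (auto simp: zero_less_mult_iff)
    show ?case
    proof (cases "u \<in> {0<..<min w v}")
      case u: True
      have "c * ((c * v) powr (1 - n / 2) * ((c * u) powr ((n - 2 + 2 * l) / 2 - 1) * (c * v - c * u) powr (- l))) =
        (c powr 1 * c powr (1 - n / 2) * c powr ((n - 2 + 2 * l) / 2 - 1) * c powr (- l)) *
        (v powr (1 - n / 2) * (u powr ((n - 2 + 2 * l) / 2 - 1) * (v - u) powr (- l)))"
        using c u True by (simp add: powr_mult right_diff_distrib[symmetric])
      also have "c powr 1 * c powr (1 - n / 2) * c powr ((n - 2 + 2 * l) / 2 - 1) * c powr (- l) = 1"
        using c by (simp add: powr_add[symmetric] field_simps)
      finally have eq: "\<bar>c\<bar> * (k * (c * v) powr (1 - n / 2) * ((0 + c * u) powr ((n - 2 + 2 * l) / 2 - 1) * (c * v - (0 + c * u)) powr (- l))) =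
        k * v powr (1 - n / 2) * (u powr ((n - 2 + 2 * l) / 2 - 1) * (v - u) powr (- l))"
        using c by (simp add: mult.left_commute mult.assoc)
      have i: "indicator {0<..<min (c * w) (c * v)} (0 + c * u) = (1 :: ennreal)" "indicator {0<..<min w v} u = (1 :: ennreal)"
        using ind u by (simp_all only: indicator_def if_True of_bool_def)
      show ?thesis unfolding i eq[symmetric] mult_1_right by (subst ennreal_mult') auto
    next
      case False
      then have "indicator {0<..<min (c * w) (c * v)} (0 + c * u) = (0 :: ennreal)"
        using ind by (simp only: indicator_def if_False of_bool_def)
      moreover have "indicator {0<..<min w v} u = (0 :: ennreal)"
        using False by (simp only: indicator_def if_False of_bool_def)
      ultimately show ?thesis by (simp only: mult_zero_right)
    qed
  qed
  finally show ?thesis unfolding ball_potential_def k_def .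
next
  case False
  then have "c * v \<le> 0" using c by (simp add: mult_nonneg_nonpos)
  then show ?thesis using False by (simp add: ball_potential_def)
qed

text \<open>With p = s/2 one has n/2 + \<lambda> = p + 1 and p + (1 - \<lambda>) = n/2, so the Gamma
  factors depending on n cancel. The identity makes the constant in \<open>ball_potential\<close>
  agree with the interior potential, and later normalizes the swept charge.\<close>

lemma Beta_dimension_identity:
  assumes l: "0 < l" "l < 1" and s: "n - 2 + 2 * l > 0" and "n > (0::real)"
  shows "Beta (n / 2) l * ((n - 2 + 2 * l) / 2) * Beta ((n - 2 + 2 * l) / 2) (1 - l) = Beta l (1 - l)"
proof -
  define p where "p = (n - 2 + 2 * l) / 2"
  have p: "p > 0" using s by (simp add: p_def)
  have "n / 2 + l = p + 1" by (simp add: p_def field_simps)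
  moreover have "Gamma (p + 1) = p * Gamma p"
    using p by (intro Gamma_plus1) (auto dest: nonpos_Ints_nonpos)
  ultimately have 1: "Gamma (n / 2 + l) = p * Gamma p" by simp
  have 2: "p + (1 - l) = n / 2" by (simp add: p_def field_simps)
  have pos: "Gamma p > 0" "Gamma (n / 2) > 0" using p assms by (auto intro: Gamma_real_pos)
  show ?thesis
    unfolding p_def[symmetric] Beta_def 1 2
    using p less_imp_neq[OF pos(1), symmetric] less_imp_neq[OF pos(2), symmetric] by simp
qed

text \<open>For v \<le> w the cut-off at w is inactive and a complete Beta integral remains. The
  interior constant is thereby available as an integral over u, the form in which the outermost
  layer is needed.\<close>

lemma ball_potential_inside:
  assumes l: "0 < l" "l < 1" and s: "n - 2 + 2 * l > 0" and v: "0 < v" "v \<le> w" and n: "n > 0"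
  shows "ball_potential n l w v = ennreal (half_sphere_area n * Beta l (1 - l))"
proof -
  let ?p = "(n - 2 + 2 * l) / 2"
  let ?K = "half_sphere_area n * Beta (n / 2) l * ?p * v powr (1 - n / 2)"
  have K: "?K \<ge> 0" using l s n by (simp add: Beta_def Gamma_real_pos)
  have "ball_potential n l w v = (\<integral>\<^sup>+u. ennreal ?K * (ennreal ((u - 0) powr (?p - 1) * (v - u) powr ((1 - l) - 1)) * indicator {0<..<v} u) \<partial>lborel)"
  proof -
    define k where "k = ?K"
    have "1 - l - 1 = - l" "min w v = v" using v by simp_all
    then show ?thesis
      unfolding ball_potential_def k_def[symmetric] using K[folded k_def]
      by (simp add: ennreal_mult' mult.assoc)
  qed
  also have "\<dots> = ennreal ?K * ennreal ((v - 0) powr (?p + (1 - l) - 1) * Beta ?p (1 - l))"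
    by (subst nn_integral_cmult, measurable, subst nn_integral_Beta_Ioo) (use l s v in auto)
  also have "\<dots> = ennreal (?K * ((v - 0) powr (?p + (1 - l) - 1) * Beta ?p (1 - l)))"
    using K by (rule ennreal_mult'[symmetric])
  also have "?K * ((v - 0) powr (?p + (1 - l) - 1) * Beta ?p (1 - l)) =
     half_sphere_area n * (Beta (n / 2) l * ?p * Beta ?p (1 - l)) * (v powr (1 - n / 2) * v powr (?p + (1 - l) - 1))"
    by simp
  also have "v powr (1 - n / 2) * v powr (?p + (1 - l) - 1) = 1"
    using v by (simp add: powr_add[symmetric] field_simps)
  finally show ?thesis unfolding Beta_dimension_identity[OF l s n] by simp
qed


section \<open>Sweeping a point charge onto the disk\<close>

lemma nn_integral_powr_Ioo:
  assumes "p > 0" "m > (0::real)"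
  shows "(\<integral>\<^sup>+u\<in>{0<..<m}. ennreal (u powr (p - 1)) \<partial>lborel) = ennreal (m powr p / p)"
proof -
  have "(\<integral>\<^sup>+u\<in>{0<..<m}. ennreal (u powr (p - 1)) \<partial>lborel) =
    (\<integral>\<^sup>+u\<in>{0<..<m}. ennreal ((u - 0) powr (p - 1) * (m - u) powr (1 - 1)) \<partial>lborel)"
    by (intro nn_integral_cong) (auto simp: indicator_def)
  also have "\<dots> = ennreal ((m - 0) powr (p + 1 - 1) * Beta p 1)"
    using assms by (intro nn_integral_Beta_Ioo) auto
  also have "Beta p 1 = 1 / p"
  proof -
    have "Gamma (p + 1) = p * Gamma p"
      using assms by (intro Gamma_plus1) (auto dest: nonpos_Ints_nonpos)
    moreover have "Gamma p \<noteq> 0" using Gamma_real_pos[OF assms(1)] by linarith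
    ultimately show ?thesis by (simp add: Beta_def)
  qed
  finally show ?thesis by simp
qed

text \<open>The candidate is found by reading this backwards: min(T, w)^(s/2) is s/2 times the
  integral of u^(s/2-1) over 0 < u < min(T, w), and the integral of (v-u)^(-\<lambda>)
  (T-v)^(\<lambda>-1) over u < v < T is a constant, so inserting the latter exhibits an Abel
  transform at T. The factor v^(1-n/2) of the candidate cancels the Jacobian of the squared
  radius.\<close>

lemma abel_transform_ball_potential:
  assumes l: "0 < l" "l < 1" and s: "n - 2 + 2 * l > 0" and n: "n > 0" and pos: "w > 0" "T > 0"
  shows "(\<integral>\<^sup>+v\<in>{0<..<T}. ennreal ((T - v) powr (l - 1)) *
      (ennreal (half_sphere_area n * v powr (n / 2 - 1)) * ball_potential n l w v) \<partial>lborel) =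
    ennreal (half_sphere_area n * Beta l (1 - l)) *
    ennreal (half_sphere_area n * Beta (n / 2) l * (min T w) powr ((n - 2 + 2 * l) / 2))"
proof -
  define c where "c = half_sphere_area n"
  define p where "p = (n - 2 + 2 * l) / 2"
  define k where "k = c * Beta (n / 2) l * p"
  have c: "c > 0" using n by (simp add: c_def Gamma_real_pos)
  have p: "p > 0" using s by (simp add: p_def)
  have B: "Beta (n / 2) l > 0" "Beta l (1 - l) > 0" using l n by (auto simp: Beta_def Gamma_real_pos)
  have k: "k > 0" using c p B by (simp add: k_def)
  have "(\<integral>\<^sup>+v\<in>{0<..<T}. ennreal ((T - v) powr (l - 1)) *
      (ennreal (c * v powr (n / 2 - 1)) * ball_potential n l w v) \<partial>lborel) =
    (\<integral>\<^sup>+v. (\<integral>\<^sup>+u. ennreal (c * k) * (ennreal (u powr (p - 1)) * indicator {0<..<min T w} u) *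
        (ennreal ((v - u) powr ((1 - l) - 1) * (T - v) powr (l - 1)) * indicator {u<..<T} v) \<partial>lborel) \<partial>lborel)"
  proof (rule nn_integral_cong, goal_cases)
    case (1 v)
    let ?I = "\<lambda>u. ennreal (k * v powr (1 - n / 2) * (u powr (p - 1) * (v - u) powr (- l))) * indicator {0<..<min w v} u"
    have "ennreal ((T - v) powr (l - 1)) * (ennreal (c * v powr (n / 2 - 1)) * ball_potential n l w v) * indicator {0<..<T} v
      = (ennreal ((T - v) powr (l - 1)) * ennreal (c * v powr (n / 2 - 1)) * indicator {0<..<T} v) * (\<integral>\<^sup>+u. ?I u \<partial>lborel)"
      unfolding ball_potential_def k_def p_def c_def by (simp only: mult_ac)
    also have "\<dots> = (\<integral>\<^sup>+u. (ennreal ((T - v) powr (l - 1)) * ennreal (c * v powr (n / 2 - 1)) * indicator {0<..<T} v) * ?I u \<partial>lborel)"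
      by (rule nn_integral_cmult[symmetric]) measurable
    also have "\<dots> = (\<integral>\<^sup>+u. ennreal (c * k) * (ennreal (u powr (p - 1)) * indicator {0<..<min T w} u) *
        (ennreal ((v - u) powr ((1 - l) - 1) * (T - v) powr (l - 1)) * indicator {u<..<T} v) \<partial>lborel)"
    proof (rule nn_integral_cong, goal_cases)
      case (1 u)
      show ?case
      proof (cases "0 < u \<and> u < v \<and> v < T \<and> u < w")
        case True
        then have "v powr (n / 2 - 1) * v powr (1 - n / 2) = 1" by (simp add: powr_add[symmetric])
        then have "((T - v) powr (l - 1) * (c * v powr (n / 2 - 1))) * (k * v powr (1 - n / 2) * (u powr (p - 1) * (v - u) powr (- l)))
          = (c * k) * u powr (p - 1) * ((v - u) powr ((1 - l) - 1) * (T - v) powr (l - 1))"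
          by (simp add: algebra_simps)
        then have "ennreal ((T - v) powr (l - 1)) * ennreal (c * v powr (n / 2 - 1)) * ennreal (k * v powr (1 - n / 2) * (u powr (p - 1) * (v - u) powr (- l)))
          = ennreal (c * k) * ennreal (u powr (p - 1)) * ennreal ((v - u) powr ((1 - l) - 1) * (T - v) powr (l - 1))"
          using c k by (simp add: ennreal_mult[symmetric])
        with True show ?thesis by simp
      next
        case False
        then have "indicator {0<..<T} v * indicator {0<..<min w v} u = (0 :: ennreal)"
          "indicator {0<..<min T w} u * indicator {u<..<T} v = (0 :: ennreal)"
          by (auto simp: indicator_def)
        then show ?thesis by (auto simp: mult_eq_0_iff)
      qed
    qed
    finally show ?case .
  qed
  also have "\<dots> = (\<integral>\<^sup>+u. (\<integral>\<^sup>+v. ennreal (c * k) * (ennreal (u powr (p - 1)) * indicator {0<..<min T w} u) *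
        (ennreal ((v - u) powr ((1 - l) - 1) * (T - v) powr (l - 1)) * indicator {u<..<T} v) \<partial>lborel) \<partial>lborel)"
    by (rule lborel_pair.Fubini') (simp add: indicator_def)
  also have "\<dots> = (\<integral>\<^sup>+u. (ennreal (c * k) * ennreal (Beta l (1 - l))) * (ennreal (u powr (p - 1)) * indicator {0<..<min T w} u) \<partial>lborel)"
  proof (rule nn_integral_cong, goal_cases)
    case (1 u)
    have "(\<integral>\<^sup>+v. ennreal (c * k) * (ennreal (u powr (p - 1)) * indicator {0<..<min T w} u) *
        (ennreal ((v - u) powr ((1 - l) - 1) * (T - v) powr (l - 1)) * indicator {u<..<T} v) \<partial>lborel) =
      ennreal (c * k) * (ennreal (u powr (p - 1)) * indicator {0<..<min T w} u) *
      (\<integral>\<^sup>+v\<in>{u<..<T}. ennreal ((v - u) powr ((1 - l) - 1) * (T - v) powr (l - 1)) \<partial>lborel)"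
      by (rule nn_integral_cmult) measurable
    also have "\<dots> = (ennreal (c * k) * ennreal (Beta l (1 - l))) * (ennreal (u powr (p - 1)) * indicator {0<..<min T w} u)"
    proof (cases "u < T")
      case True
      then have "(\<integral>\<^sup>+v\<in>{u<..<T}. ennreal ((v - u) powr ((1 - l) - 1) * (T - v) powr (l - 1)) \<partial>lborel) = ennreal (Beta l (1 - l))"
        using l by (subst nn_integral_Beta_Ioo) (auto simp: Beta_commute)
      then show ?thesis by (simp only: mult_ac)
    qed simp
    finally show ?case .
  qed
  also have "\<dots> = (ennreal (c * k) * ennreal (Beta l (1 - l))) * ennreal (min T w powr p / p)"
    by (subst nn_integral_cmult, measurable, subst nn_integral_powr_Ioo) (use p pos in auto)
  also have "\<dots> = ennreal (c * k * Beta l (1 - l) * (min T w powr p / p))"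
    using c k B p by (simp add: ennreal_mult del: times_divide_eq_right)
  also have "c * k * Beta l (1 - l) * (min T w powr p / p) = (c * Beta l (1 - l)) * (c * Beta (n / 2) l * min T w powr p)"
    using p by (simp add: k_def)
  also have "ennreal \<dots> = ennreal (c * Beta l (1 - l)) * ennreal (c * Beta (n / 2) l * min T w powr p)"
    using c B by (simp add: ennreal_mult)
  finally show ?thesis unfolding c_def p_def .
qed

text \<open>Written in the squared radius, the mutual energy with E_T is the Abel transform at T of
  the potential times v^(n/2-1). The candidate has the same transform for every T > 0, so uniqueness
  for Abel's equation applies; an integral equation leaves a null set of radii undecided.\<close>

lemma riesz_potential_ball_weight_AE:
  fixes e :: "real ^ 'm"
  assumes l: "0 < l" "l < 1" and s: "s = real CARD('m) - 2 + 2 * l" "s > 0" and w: "w > 0" and e: "norm e = 1"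
  shows "AE v in lborel. v > 0 \<longrightarrow>
    riesz_potential s (ball_weight l w) (sqrt v *\<^sub>R e) = ball_potential (real CARD('m)) l w v"
proof -
  define n where "n = real CARD('m)"
  have n: "n > 0" "real DIM(real ^ 'm) = n" by (simp_all add: n_def)
  define c where "c = half_sphere_area n"
  have c: "c > 0" using n by (simp add: c_def Gamma_real_pos)
  have sn: "s = n - 2 + 2 * l" "n - 2 + 2 * l > 0" using s by (simp_all add: n_def)
  define U where "U v = riesz_potential s (ball_weight l w) (sqrt v *\<^sub>R e)" for v
  have [measurable]: "U \<in> borel_measurable borel" unfolding U_def[abs_def] by measurable
  let ?f = "\<lambda>v. ennreal (c * v powr (n / 2 - 1)) * U v"
  let ?g = "\<lambda>v. ennreal (c * v powr (n / 2 - 1)) * ball_potential n l w v"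
  have f: "(\<integral>\<^sup>+v\<in>{0<..<T}. ennreal ((T - v) powr (l - 1)) * ?f v \<partial>lborel) =
    ennreal (c * Beta l (1 - l)) * ennreal (c * Beta (n / 2) l * (min T w) powr ((n - 2 + 2 * l) / 2))"
    if T: "T > 0" for T
  proof -
    let ?\<phi> = "\<lambda>v. (if v < T then ennreal ((T - v) powr (l - 1)) else 0) * U v"
    have "(\<integral>\<^sup>+v\<in>{0<..<T}. ennreal ((T - v) powr (l - 1)) * ?f v \<partial>lborel) =
      (\<integral>\<^sup>+v\<in>{0<..}. ennreal (c * v powr (n / 2 - 1)) * ?\<phi> v \<partial>lborel)"
      by (intro nn_integral_cong) (auto simp: indicator_def mult_ac)
    also have "\<dots> = (\<integral>\<^sup>+x. ?\<phi> ((norm x)\<^sup>2) \<partial>(lborel :: (real ^ 'm) measure))"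
      unfolding c_def n(2)[symmetric] by (rule nn_integral_radial[symmetric]) measurable
    also have "\<dots> = (\<integral>\<^sup>+x. ball_weight l T x * riesz_potential s (ball_weight l w) x \<partial>(lborel :: (real ^ 'm) measure))"
    proof (rule nn_integral_cong, goal_cases)
      case (1 x)
      have "U ((norm x)\<^sup>2) = riesz_potential s (ball_weight l w) x"
        unfolding U_def by (rule riesz_potential_ball_weight_isometric) (simp add: e)
      then show ?case
        by (simp add: ball_weight_def)
    qed
    also have "\<dots> = ennreal (c * Beta l (1 - l)) * ennreal (c * Beta (n / 2) l * (min T w) powr (s / 2))"
      unfolding c_def n(2)[symmetric] by (rule ball_weight_mutual_energy[OF l _ T w]) (simp add: s(1))
    finally show ?thesis by (simp only: sn(1))
  qed
  have "AE v in lborel. v > 0 \<longrightarrow> ?f v = ?g v"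
  proof (rule abel_integral_unique[OF l])
    fix T :: real assume T: "T > 0"
    show "(\<integral>\<^sup>+v\<in>{0<..<T}. ennreal ((T - v) powr (l - 1)) * ?f v \<partial>lborel) =
      (\<integral>\<^sup>+v\<in>{0<..<T}. ennreal ((T - v) powr (l - 1)) * ?g v \<partial>lborel)"
      unfolding f[OF T] unfolding c_def by (rule abel_transform_ball_potential[OF l sn(2) n(1) w T, symmetric])
    show "(\<integral>\<^sup>+v\<in>{0<..<T}. ennreal ((T - v) powr (l - 1)) * ?f v \<partial>lborel) < \<infinity>"
      unfolding f[OF T] by (simp add: ennreal_mult_less_top)
  qed measurable
  then show ?thesis
  proof eventually_elim
    case (elim v)
    show ?case
    proof
      assume "v > 0"
      with elim have "ennreal (c * v powr (n / 2 - 1)) * U v = ennreal (c * v powr (n / 2 - 1)) * ball_potential n l w v" by simp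
      then show "riesz_potential s (ball_weight l w) (sqrt v *\<^sub>R e) = ball_potential (real CARD('m)) l w v"
        using c \<open>v > 0\<close> by (subst (asm) ennreal_mult_cancel_left) (auto simp: U_def n_def)
    qed
  qed
qed

text \<open>By homogeneity an almost-everywhere statement in \<open>x\<close> for a fixed ball becomes one in the radius
  of the ball for a fixed \<open>x\<close>.\<close>

lemma nn_integral_riesz_potential_ball_weight:
  fixes x :: "real ^ 'm" and g :: "real \<Rightarrow> ennreal"
  assumes l: "0 < l" "l < 1" and s: "s = real CARD('m) - 2 + 2 * l" "s > 0" and x: "x \<noteq> 0"
    and [measurable]: "g \<in> borel_measurable borel"
  shows "(\<integral>\<^sup>+w\<in>{0<..}. g w * riesz_potential s (ball_weight l w) x \<partial>lborel) =
    (\<integral>\<^sup>+w\<in>{0<..}. g w * ball_potential (real CARD('m)) l w ((norm x)\<^sup>2) \<partial>lborel)"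
proof -
  define r where "r = norm x"
  define e where "e = x /\<^sub>R r"
  have r: "r > 0" using x by (simp add: r_def)
  have e: "norm e = 1" "x = r *\<^sub>R e" using r by (simp_all add: e_def r_def)
  \<comment> \<open>Dilation by r / sqrt v takes the unit ball to the ball of E_w with w = r^2 / v,
    and the point of squared norm v in the direction of x to x itself. The substitution therefore
    turns the null set of radii into a null set of layers.\<close>
  let ?k = "\<lambda>v. r\<^sup>2 / v"
  have img: "?k ` {0<..} = {0<..}"
    by (rule image_eq_if_right_inverse[where k = ?k]) (use r in auto)
  have sub: "(\<integral>\<^sup>+w\<in>{0<..}. F w \<partial>lborel) = (\<integral>\<^sup>+v\<in>{0<..}. ennreal \<bar>- r\<^sup>2 / v\<^sup>2\<bar> * F (?k v) \<partial>lborel)"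
    if [measurable]: "F \<in> borel_measurable borel" for F :: "real \<Rightarrow> ennreal"
  proof -
    have "(\<integral>\<^sup>+w\<in>?k ` {0<..}. F w \<partial>lborel) = (\<integral>\<^sup>+v\<in>{0<..}. ennreal \<bar>- r\<^sup>2 / v\<^sup>2\<bar> * F (?k v) \<partial>lborel)"
    proof (rule nn_integral_substitution_inj)
      show "inj_on ?k {0<..}" using r by (auto simp: inj_on_def)
      show "(?k has_real_derivative - r\<^sup>2 / v\<^sup>2) (at v)" if "v \<in> {0<..}" for v
        using that by (auto intro!: derivative_eq_intros simp: power2_eq_square)
    qed (auto simp: img)
    then show ?thesis by (simp only: img)
  qed
  have mU [measurable]: "(\<lambda>w. riesz_potential s (ball_weight l w) x) \<in> borel_measurable borel"
    unfolding riesz_potential_def by measurable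
  have "(\<integral>\<^sup>+w\<in>{0<..}. g w * riesz_potential s (ball_weight l w) x \<partial>lborel) =
    (\<integral>\<^sup>+v\<in>{0<..}. ennreal \<bar>- r\<^sup>2 / v\<^sup>2\<bar> * (g (?k v) * riesz_potential s (ball_weight l (?k v)) x) \<partial>lborel)"
    by (rule sub) measurable
  also have "\<dots> = (\<integral>\<^sup>+v\<in>{0<..}. ennreal \<bar>- r\<^sup>2 / v\<^sup>2\<bar> * (g (?k v) * ball_potential (real CARD('m)) l (?k v) (r\<^sup>2)) \<partial>lborel)"
  proof (intro nn_integral_cong_AE, use riesz_potential_ball_weight_AE[OF l s zero_less_one e(1)] in eventually_elim)
    fix v :: real
    assume AE: "v > 0 \<longrightarrow> riesz_potential s (ball_weight l 1) (sqrt v *\<^sub>R e) = ball_potential (real CARD('m)) l 1 v"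
    show "ennreal \<bar>- r\<^sup>2 / v\<^sup>2\<bar> * (g (?k v) * riesz_potential s (ball_weight l (?k v)) x) * indicator {0<..} v =
      ennreal \<bar>- r\<^sup>2 / v\<^sup>2\<bar> * (g (?k v) * ball_potential (real CARD('m)) l (?k v) (r\<^sup>2)) * indicator {0<..} v"
    proof (cases "v > 0")
      case True
      have "riesz_potential s (ball_weight l ((r / sqrt v)\<^sup>2 * 1)) ((r / sqrt v) *\<^sub>R (sqrt v *\<^sub>R e)) =
        riesz_potential s (ball_weight l 1) (sqrt v *\<^sub>R e)"
        by (rule riesz_potential_ball_weight_scale) (use s r True in auto)
      moreover have "(r / sqrt v)\<^sup>2 * 1 = ?k v" using True by (simp add: power_divide)
      moreover have "(r / sqrt v) *\<^sub>R (sqrt v *\<^sub>R e) = x" using True by (simp add: e(2))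
      moreover have "ball_potential (real CARD('m)) l (?k v * 1) (?k v * v) = ball_potential (real CARD('m)) l 1 v"
        by (rule ball_potential_scale) (use r True in simp)
      ultimately show ?thesis using AE True by simp
    qed simp
  qed
  also have "\<dots> = (\<integral>\<^sup>+w\<in>{0<..}. g w * ball_potential (real CARD('m)) l w (r\<^sup>2) \<partial>lborel)"
    by (rule sub[symmetric]) measurable
  finally show ?thesis by (simp only: r_def)
qed

text \<open>The weight \<open>G\<close>: the layers \<open>E\<^sub>w\<close> with \<open>w \<ge> u\<close> carry the total weight \<open>G(u)\<close>.\<close>

definition balayage_mass :: "real \<Rightarrow> real \<Rightarrow> real \<Rightarrow> real \<Rightarrow> real" where
  "balayage_mass n l H u = Gamma (n / 2) / (pi powr (n / 2) * Beta l (1 - l)) * H powr (1 - l) * (u + H) powr (- n / 2)"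

text \<open>The coefficient in the integral is - G'(w), with \<open>H\<close> in the role of h^2;
  the isolated term puts the remaining weight G(1) on the outermost layer w = 1.\<close>

definition disk_balayage :: "real \<Rightarrow> real \<Rightarrow> 'a::euclidean_space \<Rightarrow> ennreal" where
  "disk_balayage l H y = ennreal (balayage_mass (real DIM('a)) l H 1) * ball_weight l 1 y +
     (\<integral>\<^sup>+w\<in>{0<..<1}. ennreal (real DIM('a) / 2 * balayage_mass (real DIM('a)) l H w / (w + H)) * ball_weight l w y \<partial>lborel)"

lemma borel_measurable_balayage_mass [measurable]: "balayage_mass n l H \<in> borel_measurable borel"
  unfolding balayage_mass_def[abs_def] by measurable

lemma borel_measurable_disk_balayage [measurable]: "disk_balayage l H \<in> borel_measurable borel"
  unfolding disk_balayage_def[abs_def] by measurable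

lemma balayage_mass_nonneg: "0 < n \<Longrightarrow> 0 < l \<Longrightarrow> l < 1 \<Longrightarrow> 0 \<le> balayage_mass n l H u"
  by (simp add: balayage_mass_def Gamma_real_pos Beta_def)

lemma balayage_mass_layers:
  assumes l: "0 < l" "l < 1" and n: "n > 0" and H: "H > 0" and u: "0 \<le> u" "u \<le> 1"
  shows "ennreal (balayage_mass n l H 1) +
    (\<integral>\<^sup>+w\<in>{u<..<1}. ennreal (n / 2 * balayage_mass n l H w / (w + H)) \<partial>lborel) = ennreal (balayage_mass n l H u)"
proof -
  define c where "c = Gamma (n / 2) / (pi powr (n / 2) * Beta l (1 - l)) * H powr (1 - l)"
  have bm: "balayage_mass n l H = (\<lambda>w. c * (w + H) powr (- n / 2))"
    by (rule ext) (simp add: balayage_mass_def c_def)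
  note nn = balayage_mass_nonneg[OF n l, of H]
  have "(\<integral>\<^sup>+w\<in>{u<..<1}. ennreal (n / 2 * balayage_mass n l H w / (w + H)) \<partial>lborel) =
    (\<integral>\<^sup>+w. ennreal (n / 2 * balayage_mass n l H w / (w + H)) * indicator {u..1} w \<partial>lborel)"
    by (intro nn_integral_cong_AE, use AE_lborel_singleton[of u] AE_lborel_singleton[of 1] in eventually_elim)
       (auto simp: indicator_def)
  also have "\<dots> = ennreal (- balayage_mass n l H 1 - (- balayage_mass n l H u))"
  proof (rule nn_integral_FTC_Icc[where F = "\<lambda>w. - balayage_mass n l H w"])
    fix w assume w: "w \<in> {u..1}"
    then have wH: "w + H > 0" using u H by simp
    have "((\<lambda>w. - (c * (w + H) powr (- n / 2))) has_real_derivative - (c * (- n / 2 * (w + H) powr (- n / 2 - 1)))) (at w)"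
      using wH by (auto intro!: derivative_eq_intros)
    moreover have "- (c * (- n / 2 * (w + H) powr (- n / 2 - 1))) = n / 2 * balayage_mass n l H w / (w + H)"
      using wH by (simp add: bm powr_diff)
    ultimately show "((\<lambda>w. - balayage_mass n l H w) has_real_derivative n / 2 * balayage_mass n l H w / (w + H)) (at w)"
      by (simp only: bm)
    show "0 \<le> n / 2 * balayage_mass n l H w / (w + H)" using nn wH n by simp
  qed (use u in auto)
  also have "ennreal (balayage_mass n l H 1) + \<dots> = ennreal (balayage_mass n l H u)"
  proof -
    have "(1 + H) powr (- n / 2) \<le> (u + H) powr (- n / 2)"
      using u H n by (intro powr_mono2') auto
    then have "balayage_mass n l H 1 \<le> balayage_mass n l H u"
      using n l unfolding bm by (intro mult_left_mono) (auto simp: c_def Gamma_real_pos Beta_def)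
    then show ?thesis using nn by (subst ennreal_plus[symmetric]) auto
  qed
  finally show ?thesis .
qed

text \<open>For nonzero x put v = |x|^2. Each layer's potential is an integral over 0 < u < min(w,
  v), so after an exchange the layers with w > u enter only through their total weight G(u). What
  remains is the integral of u^(s/2-1) (v-u)^(-\<lambda>) (u+H)^(-n/2) over (0, v), evaluated by
  \<open>nn_integral_Beta_moebius\<close>; the factor H^(1-\<lambda>) in G cancels the power of H
  which that produces.\<close>

lemma riesz_potential_disk_balayage:
  fixes x :: "real ^ 'm"
  assumes l: "0 < l" "l < 1" and s: "s = real CARD('m) - 2 + 2 * l" "s > 0" and H: "H > 0" and x: "norm x \<le> 1"
  shows "riesz_potential s (disk_balayage l H) x = ennreal (((norm x)\<^sup>2 + H) powr (- s / 2))"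
proof -
  define n where "n = real CARD('m)"
  have n: "n > 0" "real DIM(real ^ 'm) = n" by (simp_all add: n_def)
  have sn: "s = n - 2 + 2 * l" "n - 2 + 2 * l > 0" using s by (simp_all add: n_def)
  let ?K = "half_sphere_area n * Beta l (1 - l)"
  have Kpos: "?K > 0" using l n by (simp add: Gamma_real_pos Beta_def)
  have G0: "Gamma (n / 2) \<noteq> 0" "Beta l (1 - l) \<noteq> 0" using Kpos by auto
  let ?A = "ennreal (balayage_mass n l H 1)" and ?g = "\<lambda>w. ennreal (n / 2 * balayage_mass n l H w / (w + H))"
  have mU [measurable]: "(\<lambda>w. riesz_potential s (ball_weight l w) x) \<in> borel_measurable borel"
    unfolding riesz_potential_def by measurable
  have "riesz_potential s (disk_balayage l H) x = (\<integral>\<^sup>+y. ?A * (riesz_kernel s x y * ball_weight l 1 y) +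
      (\<integral>\<^sup>+w. ?g w * indicator {0<..<1} w * (riesz_kernel s x y * ball_weight l w y) \<partial>lborel) \<partial>lborel)"
    unfolding riesz_potential_def
  proof (rule nn_integral_cong, goal_cases)
    case (1 y)
    have "riesz_kernel s x y * (\<integral>\<^sup>+w\<in>{0<..<1}. ?g w * ball_weight l w y \<partial>lborel) =
      (\<integral>\<^sup>+w. riesz_kernel s x y * (?g w * ball_weight l w y * indicator {0<..<1} w) \<partial>lborel)"
      by (rule nn_integral_cmult[symmetric]) measurable
    then show ?case
      unfolding disk_balayage_def n(2) distrib_left by (simp only: mult_ac)
  qed
  also have "\<dots> = (\<integral>\<^sup>+y. ?A * (riesz_kernel s x y * ball_weight l 1 y) \<partial>lborel) +
      (\<integral>\<^sup>+y. (\<integral>\<^sup>+w. ?g w * indicator {0<..<1} w * (riesz_kernel s x y * ball_weight l w y) \<partial>lborel) \<partial>lborel)"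
    by (rule nn_integral_add) measurable
  also have "(\<integral>\<^sup>+y. (\<integral>\<^sup>+w. ?g w * indicator {0<..<1} w * (riesz_kernel s x y * ball_weight l w y) \<partial>lborel) \<partial>lborel) =
    (\<integral>\<^sup>+w. (\<integral>\<^sup>+y. ?g w * indicator {0<..<1} w * (riesz_kernel s x y * ball_weight l w y) \<partial>lborel) \<partial>lborel)"
    by (rule lborel_pair.Fubini') measurable
  also have "\<dots> = (\<integral>\<^sup>+w. ?g w * indicator {0<..<1} w * riesz_potential s (ball_weight l w) x \<partial>lborel)"
    unfolding riesz_potential_def by (intro nn_integral_cong nn_integral_cmult) measurable
  also have "(\<integral>\<^sup>+y. ?A * (riesz_kernel s x y * ball_weight l 1 y) \<partial>lborel) = ?A * riesz_potential s (ball_weight l 1) x"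
    unfolding riesz_potential_def by (rule nn_integral_cmult) measurable
  also have "riesz_potential s (ball_weight l 1) x = ennreal ?K"
    using x by (subst riesz_potential_ball_weight_inside[OF l]) (auto simp: s n_def power_le_one)
  finally have U: "riesz_potential s (disk_balayage l H) x =
    ?A * ennreal ?K + (\<integral>\<^sup>+w. ?g w * indicator {0<..<1} w * riesz_potential s (ball_weight l w) x \<partial>lborel)" .
  show ?thesis
  proof (cases "x = 0")
    \<comment> \<open>The origin lies in every ball, so each layer contributes its interior
      constant; \<open>ball_potential\<close> vanishes at v = 0 and cannot represent it.\<close>
    case True
    have "(\<integral>\<^sup>+w. ?g w * indicator {0<..<1} w * riesz_potential s (ball_weight l w) x \<partial>lborel) =
      (\<integral>\<^sup>+w. ?g w * indicator {0<..<1} w * ennreal ?K \<partial>lborel)"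
    proof (rule nn_integral_cong, goal_cases)
      case (1 w)
      show ?case
      proof (cases "w > 0")
        case pos: True
        then have "riesz_potential s (ball_weight l w) x = ennreal ?K"
          using True by (subst riesz_potential_ball_weight_inside[OF l]) (auto simp: s n_def)
        then show ?thesis by simp
      qed simp
    qed
    also have "\<dots> = (\<integral>\<^sup>+w. ?g w * indicator {0<..<1} w \<partial>lborel) * ennreal ?K"
      by (rule nn_integral_multc) measurable
    finally have "riesz_potential s (disk_balayage l H) x =
      (?A + (\<integral>\<^sup>+w. ?g w * indicator {0<..<1} w \<partial>lborel)) * ennreal ?K"
      unfolding U by (simp only: distrib_right)
    also have "\<dots> = ennreal (balayage_mass n l H 0) * ennreal ?K"
      by (subst balayage_mass_layers[OF l n(1) H]) auto
    also have "\<dots> = ennreal (balayage_mass n l H 0 * ?K)"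
      using balayage_mass_nonneg[OF n(1) l] by (rule ennreal_mult'[symmetric])
    also have "balayage_mass n l H 0 * ?K = H powr (1 - l) * H powr (- n / 2)"
      using G0 by (simp add: balayage_mass_def)
    also have "\<dots> = H powr (- s / 2)"
      using H by (simp add: powr_add[symmetric] sn field_simps)
    finally show ?thesis using True by simp
  next
    case False
    define v where "v = (norm x)\<^sup>2"
    have v: "0 < v" "v \<le> 1" using False x by (auto simp: v_def power_le_one)
    define p where "p = (n - 2 + 2 * l) / 2"
    define k where "k = half_sphere_area n * Beta (n / 2) l * p * v powr (1 - n / 2)"
    have p: "p > 0" using sn by (simp add: p_def)
    have k: "k \<ge> 0" using p n l by (simp add: k_def Gamma_real_pos Beta_def)
    let ?\<psi> = "\<lambda>u. ennreal (k * (u powr (p - 1) * (v - u) powr (- l)))"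
    have V: "ball_potential n l w v = (\<integral>\<^sup>+u\<in>{0<..<min w v}. ?\<psi> u \<partial>lborel)" for w
      unfolding ball_potential_def k_def p_def ..
    have "(\<integral>\<^sup>+w. ?g w * indicator {0<..<1} w * riesz_potential s (ball_weight l w) x \<partial>lborel) =
      (\<integral>\<^sup>+w\<in>{0<..}. (?g w * indicator {0<..<1} w) * riesz_potential s (ball_weight l w) x \<partial>lborel)"
      by (intro nn_integral_cong) (auto simp: indicator_def)
    also have "\<dots> = (\<integral>\<^sup>+w\<in>{0<..}. (?g w * indicator {0<..<1} w) * ball_potential n l w v \<partial>lborel)"
      unfolding n_def v_def by (rule nn_integral_riesz_potential_ball_weight[OF l s False]) measurable
    also have "\<dots> = (\<integral>\<^sup>+w. (\<integral>\<^sup>+u. ?\<psi> u * indicator {0<..<v} u * (?g w * indicator {u<..<1} w) \<partial>lborel) \<partial>lborel)"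
    proof (rule nn_integral_cong, goal_cases)
      case (1 w)
      have "?g w * indicator {0<..<1} w * ball_potential n l w v * indicator {0<..} w =
        (\<integral>\<^sup>+u. (?g w * indicator {0<..<1} w * indicator {0<..} w) * (?\<psi> u * indicator {0<..<min w v} u) \<partial>lborel)"
        unfolding V by (subst nn_integral_cmult) (auto simp: mult_ac)
      also have "\<dots> = (\<integral>\<^sup>+u. ?\<psi> u * indicator {0<..<v} u * (?g w * indicator {u<..<1} w) \<partial>lborel)"
        by (intro nn_integral_cong) (auto simp: indicator_def mult_ac)
      finally show ?case .
    qed
    also have "\<dots> = (\<integral>\<^sup>+u. (\<integral>\<^sup>+w. ?\<psi> u * indicator {0<..<v} u * (?g w * indicator {u<..<1} w) \<partial>lborel) \<partial>lborel)"
      by (rule lborel_pair.Fubini') (simp add: indicator_def)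
    also have "\<dots> = (\<integral>\<^sup>+u. ?\<psi> u * indicator {0<..<v} u * (\<integral>\<^sup>+w\<in>{u<..<1}. ?g w \<partial>lborel) \<partial>lborel)"
      by (intro nn_integral_cong nn_integral_cmult) measurable
    finally have 2: "(\<integral>\<^sup>+w. ?g w * indicator {0<..<1} w * riesz_potential s (ball_weight l w) x \<partial>lborel) =
      (\<integral>\<^sup>+u. ?\<psi> u * indicator {0<..<v} u * (\<integral>\<^sup>+w\<in>{u<..<1}. ?g w \<partial>lborel) \<partial>lborel)" .
    \<comment> \<open>The constant potential of the outermost layer is written as an integral over u
      too, so that its weight G(1) joins the other layers under one integral sign.\<close>
    have "ennreal ?K = ball_potential n l 1 v" by (rule ball_potential_inside[OF l sn(2) v n(1), symmetric])
    also have "\<dots> = (\<integral>\<^sup>+u. ?\<psi> u * indicator {0<..<v} u \<partial>lborel)" unfolding V using v by (simp add: min_absorb2)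
    finally have 1: "?A * ennreal ?K = (\<integral>\<^sup>+u. ?\<psi> u * indicator {0<..<v} u * ?A \<partial>lborel)"
      by (subst nn_integral_multc) (auto simp: mult.commute)
    have [measurable]: "(\<lambda>u. \<integral>\<^sup>+w\<in>{u<..<1}. ?g w \<partial>lborel) \<in> borel_measurable borel"
      unfolding indicator_def greaterThanLessThan_iff by measurable
    have "riesz_potential s (disk_balayage l H) x =
      (\<integral>\<^sup>+u. ?\<psi> u * indicator {0<..<v} u * ?A + ?\<psi> u * indicator {0<..<v} u * (\<integral>\<^sup>+w\<in>{u<..<1}. ?g w \<partial>lborel) \<partial>lborel)"
      unfolding U 1 2 by (rule nn_integral_add[symmetric]) measurable
    also have "\<dots> = (\<integral>\<^sup>+u. ?\<psi> u * indicator {0<..<v} u * ennreal (balayage_mass n l H u) \<partial>lborel)"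
    proof (rule nn_integral_cong, goal_cases)
      case (1 u)
      show ?case
      proof (cases "u \<in> {0<..<v}")
        case True
        then have "0 \<le> u" "u \<le> 1" using v by auto
        then show ?thesis unfolding distrib_left[symmetric] by (subst balayage_mass_layers[OF l n(1) H]) auto
      qed simp
    qed
    also have "\<dots> = (\<integral>\<^sup>+u. ennreal (k / ?K * H powr (1 - l)) *
      (ennreal (u powr (p - 1) * (v - u) powr ((1 - l) - 1) * (u + H) powr (- p - (1 - l))) * indicator {0<..<v} u) \<partial>lborel)"
    proof (rule nn_integral_cong, goal_cases)
      case (1 u)
      \<comment> \<open>The exponent n/2 of G equals s/2 + (1 - \<lambda>), the sum of the
        parameters of the Beta integral; this is the condition of
        \<open>nn_integral_Beta_moebius\<close>.\<close>
      have e: "- p - (1 - l) = - n / 2" "1 - l - 1 = - l" by (simp_all add: p_def field_simps)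
      have "(k * (u powr (p - 1) * (v - u) powr (- l))) * balayage_mass n l H u =
        (k / ?K * H powr (1 - l)) * (u powr (p - 1) * (v - u) powr (- l) * (u + H) powr (- n / 2))"
        using G0 by (simp add: balayage_mass_def)
      then have "?\<psi> u * ennreal (balayage_mass n l H u) = ennreal (k / ?K * H powr (1 - l)) *
        ennreal (u powr (p - 1) * (v - u) powr (- l) * (u + H) powr (- n / 2))"
      proof -
        assume eq: "(k * (u powr (p - 1) * (v - u) powr (- l))) * balayage_mass n l H u =
          (k / ?K * H powr (1 - l)) * (u powr (p - 1) * (v - u) powr (- l) * (u + H) powr (- n / 2))"
        have kk: "0 \<le> k / ?K * H powr (1 - l)"
          using k Kpos by (intro mult_nonneg_nonneg divide_nonneg_pos) auto
        have "?\<psi> u * ennreal (balayage_mass n l H u) = ennreal ((k * (u powr (p - 1) * (v - u) powr (- l))) * balayage_mass n l H u)"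
          using k by (intro ennreal_mult'[symmetric]) auto
        then show ?thesis unfolding eq ennreal_mult'[OF kk] .
      qed
      then show ?case
        unfolding e by (cases "u \<in> {0<..<v}") simp_all
    qed
    also have "\<dots> = ennreal (k / ?K * H powr (1 - l)) *
      ennreal (Beta p (1 - l) * v powr (p + (1 - l) - 1) * H powr (- (1 - l)) * (v + H) powr (- p))"
      by (subst nn_integral_cmult, measurable, subst nn_integral_Beta_moebius) (use p l v H in auto)
    also have "\<dots> = ennreal (k / ?K * H powr (1 - l) * (Beta p (1 - l) * v powr (p + (1 - l) - 1) * H powr (- (1 - l)) * (v + H) powr (- p)))"
      using k Kpos by (intro ennreal_mult'[symmetric] mult_nonneg_nonneg[OF divide_nonneg_pos]) auto
    also have "k / ?K * H powr (1 - l) * (Beta p (1 - l) * v powr (p + (1 - l) - 1) * H powr (- (1 - l)) * (v + H) powr (- p)) =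
      (v powr (1 - n / 2) * v powr (p + (1 - l) - 1)) * (H powr (1 - l) * H powr (- (1 - l))) *
      ((half_sphere_area n * (Beta (n / 2) l * p * Beta p (1 - l))) / ?K) * (v + H) powr (- p)"
      unfolding k_def by (simp add: mult_ac)
    also have "\<dots> = (v + H) powr (- p)"
    proof -
      have "v powr (1 - n / 2) * v powr (p + (1 - l) - 1) = 1" "H powr (1 - l) * H powr (- (1 - l)) = 1"
        using v H by (simp_all add: powr_add[symmetric] p_def field_simps)
      moreover have "(half_sphere_area n * (Beta (n / 2) l * p * Beta p (1 - l))) / ?K = 1"
        unfolding p_def Beta_dimension_identity[OF l sn(2) n(1)] using G0 by simp
      ultimately show ?thesis by (simp only: mult_1)
    qed
    also have "- p = - s / 2" by (simp add: p_def sn field_simps)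
    finally show ?thesis unfolding v_def .
  qed
qed


section \<open>Positive definiteness of the Riesz kernel\<close>

lemma nn_integral_Gamma:
  assumes "p > 0" "c > (0::real)"
  shows "(\<integral>\<^sup>+v\<in>{0<..}. ennreal (v powr (p - 1) * exp (- (c * v))) \<partial>lborel) = ennreal (Gamma p * c powr (- p))"
proof -
  let ?F = "\<lambda>t. ennreal (indicator {0..} t * t powr (p - 1) / exp t)"
  have "ennreal (Gamma p) = (\<integral>\<^sup>+t. ?F t \<partial>lborel)" by (rule Gamma_conv_nn_integral_real[OF assms(1)])
  also have "\<dots> = ennreal \<bar>c\<bar> * (\<integral>\<^sup>+v. ?F (0 + c * v) \<partial>lborel)"
    by (rule nn_integral_real_affine) (use assms in auto)
  also have "(\<integral>\<^sup>+v. ?F (0 + c * v) \<partial>lborel) =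
      (\<integral>\<^sup>+v. ennreal (c powr (p - 1)) * (ennreal (v powr (p - 1) * exp (- (c * v))) * indicator {0<..} v) \<partial>lborel)"
  proof (intro nn_integral_cong_AE, use AE_lborel_singleton[of 0] in eventually_elim)
    fix v :: real assume "v \<noteq> 0"
    show "?F (0 + c * v) = ennreal (c powr (p - 1)) * (ennreal (v powr (p - 1) * exp (- (c * v))) * indicator {0<..} v)"
    proof (cases "v > 0")
      case True
      then show ?thesis using assms
        by (simp add: powr_mult exp_minus divide_inverse ennreal_mult[symmetric] mult.assoc)
    next
      case False
      then have "c * v < 0" using \<open>v \<noteq> 0\<close> assms by (simp add: mult_pos_neg)
      then show ?thesis using False by simp
    qed
  qed
  also have "\<dots> = ennreal (c powr (p - 1)) * (\<integral>\<^sup>+v\<in>{0<..}. ennreal (v powr (p - 1) * exp (- (c * v))) \<partial>lborel)"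
    by (rule nn_integral_cmult) measurable
  also have "ennreal \<bar>c\<bar> * \<dots> = ennreal (c powr p) * (\<integral>\<^sup>+v\<in>{0<..}. ennreal (v powr (p - 1) * exp (- (c * v))) \<partial>lborel)"
    using assms by (simp add: mult.assoc[symmetric] ennreal_mult[symmetric] powr_mult_base)
  finally have eq: "ennreal (Gamma p) = \<dots>" .
  have "(\<integral>\<^sup>+v\<in>{0<..}. ennreal (v powr (p - 1) * exp (- (c * v))) \<partial>lborel) =
    ennreal (c powr (- p)) * (ennreal (c powr p) * (\<integral>\<^sup>+v\<in>{0<..}. ennreal (v powr (p - 1) * exp (- (c * v))) \<partial>lborel))"
    using assms by (simp add: mult.assoc[symmetric] ennreal_mult[symmetric] powr_add[symmetric])
  also have "\<dots> = ennreal (Gamma p * c powr (- p))"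
    unfolding eq[symmetric] using assms by (simp add: ennreal_mult Gamma_real_pos mult.commute less_imp_le)
  finally show ?thesis .
qed

lemma nn_integral_gaussian:
  assumes "c > 0"
  shows "(\<integral>\<^sup>+z. ennreal (exp (- (c * (norm z)\<^sup>2))) \<partial>(lborel :: 'a::euclidean_space measure)) =
    ennreal ((pi / c) powr (real DIM('a) / 2))"
proof -
  let ?n = "real DIM('a)" and ?c = "half_sphere_area (real DIM('a))"
  have G: "Gamma (?n / 2) > 0" by (simp add: Gamma_real_pos)
  have "(\<integral>\<^sup>+z. ennreal (exp (- (c * (norm z)\<^sup>2))) \<partial>(lborel :: 'a measure)) =
    (\<integral>\<^sup>+v\<in>{0<..}. ennreal (?c * v powr (?n / 2 - 1)) * ennreal (exp (- (c * v))) \<partial>lborel)"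
    by (rule nn_integral_radial) measurable
  also have "\<dots> = (\<integral>\<^sup>+v. ennreal ?c * (ennreal (v powr (?n / 2 - 1) * exp (- (c * v))) * indicator {0<..} v) \<partial>lborel)"
    using G by (intro nn_integral_cong) (auto simp: indicator_def ennreal_mult[symmetric] mult.assoc)
  also have "\<dots> = ennreal ?c * ennreal (Gamma (?n / 2) * c powr (- (?n / 2)))"
    using assms by (subst nn_integral_cmult, measurable, subst nn_integral_Gamma) auto
  also have "\<dots> = ennreal (?c * (Gamma (?n / 2) * c powr (- (?n / 2))))"
    using G by (subst ennreal_mult) auto
  also have "?c * (Gamma (?n / 2) * c powr (- (?n / 2))) = (pi / c) powr (?n / 2)"
    using less_imp_neq[OF G] assms by (simp add: powr_divide powr_minus divide_simps)
  finally show ?thesis .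
qed

text \<open>The Riesz kernel is a superposition of Gaussians, each of which is a convolution square; this
  exhibits it as an inner product of the features below and hence as positive definite.\<close>

definition gauss_feature :: "real \<Rightarrow> real \<times> 'a::euclidean_space \<Rightarrow> 'a \<Rightarrow> ennreal" where
  "gauss_feature s w x =
     ennreal (sqrt (fst w powr (s / 2 - 1) / Gamma (s / 2) * (4 * fst w / pi) powr (real DIM('a) / 2)) *
       exp (- (2 * fst w * (norm (x - snd w))\<^sup>2))) * indicator {0<..} (fst w)"

lemma borel_measurable_gauss_feature [measurable (raw)]:
  fixes f :: "'b \<Rightarrow> real \<times> 'a::euclidean_space"
  assumes [measurable]: "f \<in> measurable M (lborel \<Otimes>\<^sub>M lborel)" "g \<in> borel_measurable M"
  shows "(\<lambda>p. gauss_feature s (f p) (g p)) \<in> borel_measurable M"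
proof -
  have [measurable]: "(\<lambda>p. fst (f p)) \<in> borel_measurable M" "(\<lambda>p. snd (f p)) \<in> borel_measurable M"
    using measurable_compose[OF assms(1) measurable_fst] measurable_compose[OF assms(1) measurable_snd] by simp_all
  show ?thesis unfolding gauss_feature_def by measurable
qed

text \<open>On the diagonal the superposition of Gaussians has to reproduce the value \<infinity> of
  the kernel. A finite value r is refuted by the part over (0, m) with m^p / p = r + 1.\<close>

lemma nn_integral_powr_infinite:
  assumes p: "p > (0::real)"
  shows "(\<integral>\<^sup>+u\<in>{0<..}. ennreal (u powr (p - 1)) \<partial>lborel) = \<infinity>"
proof (rule ccontr)
  assume "(\<integral>\<^sup>+u\<in>{0<..}. ennreal (u powr (p - 1)) \<partial>lborel) \<noteq> \<infinity>"
  then obtain r where r: "r \<ge> 0" "(\<integral>\<^sup>+u\<in>{0<..}. ennreal (u powr (p - 1)) \<partial>lborel) = ennreal r"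
    by (auto elim: ennreal_cases)
  define m where "m = (p * (r + 1)) powr (1 / p)"
  have m: "m > 0" "m powr p / p = r + 1"
    using p r by (auto simp: m_def powr_powr)
  have "ennreal (r + 1) = (\<integral>\<^sup>+u\<in>{0<..<m}. ennreal (u powr (p - 1)) \<partial>lborel)"
    using nn_integral_powr_Ioo[OF p m(1)] m(2) by simp
  also have "\<dots> \<le> ennreal r"
    unfolding r(2)[symmetric] by (intro nn_integral_mono) (auto simp: indicator_def)
  finally show False using r by simp
qed

text \<open>The integral of t^(s/2-1) exp(- t |x-y|^2) over t > 0 is Gamma(s/2) |x-y|^(-s), and each
  of these Gaussians is an integral over z of products of Gaussians centred at z. This works for
  every s > 0 in every dimension, so it applies in R^d itself and not only in the hyperplane of the
  disk.\<close>

lemma riesz_kernel_eq_features: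
  fixes x y :: "'a::euclidean_space"
  assumes s: "s > 0"
  shows "riesz_kernel s x y = (\<integral>\<^sup>+w. gauss_feature s w x * gauss_feature s w y \<partial>(lborel \<Otimes>\<^sub>M lborel))"
proof -
  let ?n = "real DIM('a)"
  let ?om = "\<lambda>t. t powr (s / 2 - 1) / Gamma (s / 2) * (4 * t / pi) powr (?n / 2)"
  have G: "Gamma (s / 2) > 0" using s by (simp add: Gamma_real_pos)
  have "(\<integral>\<^sup>+w. gauss_feature s w x * gauss_feature s w y \<partial>(lborel \<Otimes>\<^sub>M lborel)) =
    (\<integral>\<^sup>+t. (\<integral>\<^sup>+z. gauss_feature s (t, z) x * gauss_feature s (t, z) y \<partial>lborel) \<partial>lborel)"
    by (rule lborel.nn_integral_fst[symmetric]) measurable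
  also have "\<dots> = (\<integral>\<^sup>+t. ennreal (1 / Gamma (s / 2)) * (ennreal (t powr (s / 2 - 1) * exp (- ((norm (x - y))\<^sup>2 * t))) * indicator {0<..} t) \<partial>lborel)"
  proof (rule nn_integral_cong, goal_cases)
    case (1 t)
    show ?case
    proof (cases "t > 0")
      case True
      define om where "om = ?om t"
      have om: "om \<ge> 0" using G by (simp add: om_def)
      have gf: "gauss_feature s (t, z) x = ennreal (sqrt om * exp (- (2 * t * (norm (x - z))\<^sup>2)))" for x z :: 'a
        using True by (simp add: gauss_feature_def om_def)
      \<comment> \<open>The parallelogram law at the midpoint of x and y separates a Gaussian in x -
        y from one in z - m. The latter integrates to a power of pi / (4 t), which the power of 4 t
        / pi under the root in \<open>gauss_feature\<close> compensates.\<close>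
      define m where "m = (1 / 2) *\<^sub>R (x + y)"
      have par: "2 * t * (norm (x - z))\<^sup>2 + 2 * t * (norm (y - z))\<^sup>2 = (norm (x - y))\<^sup>2 * t + 4 * t * (norm (z - m))\<^sup>2" for z
        unfolding power2_norm_eq_inner m_def
        by (simp add: inner_diff_left inner_diff_right inner_add_left inner_add_right inner_commute algebra_simps)
      have "(\<integral>\<^sup>+z. gauss_feature s (t, z) x * gauss_feature s (t, z) y \<partial>lborel) =
        (\<integral>\<^sup>+z. ennreal (om * exp (- ((norm (x - y))\<^sup>2 * t))) * ennreal (exp (- (4 * t * (norm (z - m))\<^sup>2))) \<partial>lborel)"
      proof (rule nn_integral_cong, goal_cases)
        case (1 z)
        have "(sqrt (om) * exp (- (2 * t * (norm (x - z))\<^sup>2))) * (sqrt (om) * exp (- (2 * t * (norm (y - z))\<^sup>2))) =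
          (sqrt (om) * sqrt (om)) * exp (- (2 * t * (norm (x - z))\<^sup>2 + 2 * t * (norm (y - z))\<^sup>2))"
          by (simp add: exp_add[symmetric] mult_ac)
        also have "\<dots> = om * exp (- ((norm (x - y))\<^sup>2 * t)) * exp (- (4 * t * (norm (z - m))\<^sup>2))"
        proof -
          have "sqrt (om) * sqrt (om) = om" using om by (rule real_sqrt_mult_self[THEN trans, OF abs_of_nonneg])
          then show ?thesis unfolding par by (simp only: minus_add_distrib exp_add mult.assoc)
        qed
        finally show ?case
          unfolding gf using om by (simp add: ennreal_mult[symmetric])
      qed
      also have "\<dots> = ennreal (om * exp (- ((norm (x - y))\<^sup>2 * t))) * (\<integral>\<^sup>+z. ennreal (exp (- (4 * t * (norm (z - m))\<^sup>2))) \<partial>lborel)"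
        by (rule nn_integral_cmult) measurable
      also have "(\<integral>\<^sup>+z. ennreal (exp (- (4 * t * (norm (z - m))\<^sup>2))) \<partial>lborel) = (\<integral>\<^sup>+z. ennreal (exp (- (4 * t * (norm z)\<^sup>2))) \<partial>(lborel :: 'a measure))"
        using nn_integral_euclidean_affine[of "\<lambda>z. ennreal (exp (- (4 * t * (norm (z - m))\<^sup>2)))" 1 m] by simp
      also have "\<dots> = ennreal ((pi / (4 * t)) powr (?n / 2))"
        using True by (intro nn_integral_gaussian) simp
      also have "ennreal (om * exp (- ((norm (x - y))\<^sup>2 * t))) * \<dots> =
        ennreal (om * exp (- ((norm (x - y))\<^sup>2 * t)) * (pi / (4 * t)) powr (?n / 2))"
        using om by (subst ennreal_mult) auto
      also have "om * exp (- ((norm (x - y))\<^sup>2 * t)) * (pi / (4 * t)) powr (?n / 2) =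
        1 / Gamma (s / 2) * (t powr (s / 2 - 1) * exp (- ((norm (x - y))\<^sup>2 * t))) * ((4 * t / pi) powr (?n / 2) * (pi / (4 * t)) powr (?n / 2))"
        by (simp add: om_def)
      also have "(4 * t / pi) powr (?n / 2) * (pi / (4 * t)) powr (?n / 2) = 1"
        using True by (simp add: powr_mult[symmetric])
      finally show ?thesis using True G by (simp add: ennreal_mult[symmetric] less_imp_le)
    qed (simp add: gauss_feature_def)
  qed
  also have "\<dots> = ennreal (1 / Gamma (s / 2)) * (\<integral>\<^sup>+t\<in>{0<..}. ennreal (t powr (s / 2 - 1) * exp (- ((norm (x - y))\<^sup>2 * t))) \<partial>lborel)"
    by (rule nn_integral_cmult) measurable
  also have "\<dots> = riesz_kernel s x y"
  proof (cases "x = y")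
    case True
    have "ennreal (1 / Gamma (s / 2)) \<noteq> 0" using G by (simp only: ennreal_eq_0_iff not_le zero_less_divide_1_iff)
    then show ?thesis using True s nn_integral_powr_infinite[of "s / 2"]
      by (simp add: riesz_kernel_def ennreal_mult_top del: ennreal_eq_0_iff)
  next
    case False
    then have "(norm (x - y))\<^sup>2 > 0" by simp
    then have "(\<integral>\<^sup>+t\<in>{0<..}. ennreal (t powr (s / 2 - 1) * exp (- ((norm (x - y))\<^sup>2 * t))) \<partial>lborel) =
      ennreal (Gamma (s / 2) * (norm (x - y))\<^sup>2 powr (- (s / 2)))"
      using s by (intro nn_integral_Gamma) auto
    also have "(norm (x - y))\<^sup>2 powr (- (s / 2)) = norm (x - y) powr (- s)"
    proof -
      have "(norm (x - y))\<^sup>2 = norm (x - y) powr 2" using False by simp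
      then show ?thesis by (simp only: powr_powr) simp
    qed
    finally show ?thesis using False G by (simp add: riesz_kernel_def ennreal_mult[symmetric])
  qed
  finally show ?thesis by simp
qed

section \<open>Mutual energy as an inner product of Gaussian transforms\<close>

definition mutual_energy :: "real \<Rightarrow> 'a::euclidean_space measure \<Rightarrow> 'a measure \<Rightarrow> ennreal" where
  "mutual_energy s \<mu> \<nu> = (\<integral>\<^sup>+x. (\<integral>\<^sup>+y. riesz_kernel s x y \<partial>\<nu>) \<partial>\<mu>)"

definition gauss_transform :: "real \<Rightarrow> 'a::euclidean_space measure \<Rightarrow> real \<times> 'a \<Rightarrow> ennreal" where
  "gauss_transform s \<mu> w = (\<integral>\<^sup>+x. gauss_feature s w x \<partial>\<mu>)"

lemma borel_measurable_gauss_transform: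
  fixes \<mu> :: "'a::euclidean_space measure"
  assumes "sigma_finite_measure \<mu>" and [measurable_cong]: "sets \<mu> = sets borel"
  shows "gauss_transform s \<mu> \<in> borel_measurable (lborel \<Otimes>\<^sub>M lborel)"
proof -
  interpret sigma_finite_measure \<mu> by fact
  show ?thesis unfolding gauss_transform_def[abs_def] by measurable
qed

lemma mutual_energy_eq_transforms:
  fixes \<mu> \<nu> :: "'a::euclidean_space measure"
  assumes s: "s > 0" and \<mu>: "sigma_finite_measure \<mu>" "sets \<mu> = sets borel"
    and \<nu>: "sigma_finite_measure \<nu>" "sets \<nu> = sets borel"
  shows "mutual_energy s \<mu> \<nu> = (\<integral>\<^sup>+w. gauss_transform s \<mu> w * gauss_transform s \<nu> w \<partial>(lborel \<Otimes>\<^sub>M lborel))"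
proof -
  let ?W = "lborel \<Otimes>\<^sub>M lborel :: (real \<times> 'a) measure"
  note [measurable_cong] = \<mu>(2) \<nu>(2)
  interpret M: sigma_finite_measure \<mu> by (rule \<mu>(1))
  interpret N: sigma_finite_measure \<nu> by (rule \<nu>(1))
  interpret W: sigma_finite_measure ?W by (simp add: lborel_prod sigma_finite_lborel)
  interpret WN: pair_sigma_finite ?W \<nu> ..
  interpret WM: pair_sigma_finite ?W \<mu> ..
  have T [measurable]: "gauss_transform s \<nu> \<in> borel_measurable ?W"
    by (rule borel_measurable_gauss_transform[OF \<nu>])
  have 1: "(\<integral>\<^sup>+y. riesz_kernel s x y \<partial>\<nu>) = (\<integral>\<^sup>+w. gauss_feature s w x * gauss_transform s \<nu> w \<partial>?W)" for x
  proof -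
    have "(\<integral>\<^sup>+y. riesz_kernel s x y \<partial>\<nu>) = (\<integral>\<^sup>+y. (\<integral>\<^sup>+w. gauss_feature s w x * gauss_feature s w y \<partial>?W) \<partial>\<nu>)"
      by (simp only: riesz_kernel_eq_features[OF s])
    also have "\<dots> = (\<integral>\<^sup>+w. (\<integral>\<^sup>+y. gauss_feature s w x * gauss_feature s w y \<partial>\<nu>) \<partial>?W)"
      by (rule WN.Fubini') measurable
    also have "\<dots> = (\<integral>\<^sup>+w. gauss_feature s w x * gauss_transform s \<nu> w \<partial>?W)"
      unfolding gauss_transform_def by (intro nn_integral_cong nn_integral_cmult) (auto simp: space_pair_measure)
    finally show ?thesis .
  qed
  have "mutual_energy s \<mu> \<nu> = (\<integral>\<^sup>+x. (\<integral>\<^sup>+w. gauss_feature s w x * gauss_transform s \<nu> w \<partial>?W) \<partial>\<mu>)"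
    unfolding mutual_energy_def 1 ..
  also have "\<dots> = (\<integral>\<^sup>+w. (\<integral>\<^sup>+x. gauss_feature s w x * gauss_transform s \<nu> w \<partial>\<mu>) \<partial>?W)"
    by (rule WM.Fubini') measurable
  also have "\<dots> = (\<integral>\<^sup>+w. gauss_transform s \<mu> w * gauss_transform s \<nu> w \<partial>?W)"
    unfolding gauss_transform_def[of s \<mu>] by (intro nn_integral_cong nn_integral_multc) (auto simp: space_pair_measure)
  finally show ?thesis .
qed

lemma ennreal_two_mult_le: "2 * (a * b) \<le> a * a + b * (b :: ennreal)"
proof (cases "a = \<infinity> \<or> b = \<infinity>")
  case True
  then show ?thesis by (auto simp: ennreal_top_mult)
next
  case False
  then obtain x y where xy: "a = ennreal x" "b = ennreal y" "x \<ge> 0" "y \<ge> 0"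
    using that by (cases a rule: ennreal_cases; cases b rule: ennreal_cases) simp_all
  have two: "(2 :: ennreal) = ennreal 2" by simp
  have "2 * (x * y) \<le> x * x + y * y"
    using sum_squares_bound[of x y] by (simp add: power2_eq_square mult.assoc)
  then show ?thesis unfolding xy(1,2) using xy(3,4)
    by (simp only: two ennreal_mult[symmetric] ennreal_plus[symmetric] mult_nonneg_nonneg zero_le_numeral ennreal_leI)
qed

lemma ennreal_two_mult_eqD:
  assumes "2 * (a * b) = a * a + b * (b :: ennreal)" "a * a \<noteq> \<infinity>" "b * b \<noteq> \<infinity>"
  shows "a = b"
proof -
  have "a \<noteq> \<infinity>" "b \<noteq> \<infinity>" using assms by (auto simp: ennreal_top_mult)
  then obtain x y where xy: "a = ennreal x" "b = ennreal y" "x \<ge> 0" "y \<ge> 0"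
    using that by (cases a rule: ennreal_cases; cases b rule: ennreal_cases) simp_all
  have two: "(2 :: ennreal) = ennreal 2" by simp
  have "ennreal (2 * (x * y)) = ennreal (x * x + y * y)"
    using assms(1) unfolding xy(1,2) using xy(3,4)
    by (simp only: two ennreal_mult[symmetric] ennreal_plus[symmetric] mult_nonneg_nonneg zero_le_numeral ennreal_leI)
  then have "2 * (x * y) = x * x + y * y"
    using xy(3,4) by (subst (asm) ennreal_inj) auto
  then have "(x - y) * (x - y) = 0" by (simp add: algebra_simps)
  then show ?thesis using xy by simp
qed

text \<open>Nonnegativity of the energy of \<mu> - \<nu> with the cross term moved to the left: in
  terms of the transforms it is 2 a b \<le> a^2 + b^2 under the integral.\<close>

lemma mutual_energy_le:
  fixes \<mu> \<nu> :: "'a::euclidean_space measure"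
  assumes s: "s > 0" and \<mu>: "sigma_finite_measure \<mu>" "sets \<mu> = sets borel"
    and \<nu>: "sigma_finite_measure \<nu>" "sets \<nu> = sets borel"
  shows "2 * mutual_energy s \<mu> \<nu> \<le> mutual_energy s \<mu> \<mu> + mutual_energy s \<nu> \<nu>"
proof -
  let ?W = "lborel \<Otimes>\<^sub>M lborel :: (real \<times> 'a) measure"
  note [measurable] = borel_measurable_gauss_transform[OF \<mu>] borel_measurable_gauss_transform[OF \<nu>]
  have "2 * mutual_energy s \<mu> \<nu> = (\<integral>\<^sup>+w. 2 * (gauss_transform s \<mu> w * gauss_transform s \<nu> w) \<partial>?W)"
    unfolding mutual_energy_eq_transforms[OF s \<mu> \<nu>] by (rule nn_integral_cmult[symmetric]) measurable
  also have "\<dots> \<le> (\<integral>\<^sup>+w. gauss_transform s \<mu> w * gauss_transform s \<mu> w + gauss_transform s \<nu> w * gauss_transform s \<nu> w \<partial>?W)"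
    by (intro nn_integral_mono ennreal_two_mult_le)
  also have "\<dots> = mutual_energy s \<mu> \<mu> + mutual_energy s \<nu> \<nu>"
    unfolding mutual_energy_eq_transforms[OF s \<mu> \<mu>] mutual_energy_eq_transforms[OF s \<nu> \<nu>]
    by (rule nn_integral_add) measurable
  finally show ?thesis .
qed

text \<open>Equality in \<open>mutual_energy_le\<close> makes the integral of a^2 + b^2 - 2 a b
  vanish, whence a = b almost everywhere. Finite energies justify the subtraction in
  \<open>ennreal\<close>.\<close>

lemma mutual_energy_eqD:
  fixes \<mu> \<nu> :: "'a::euclidean_space measure"
  assumes s: "s > 0" and \<mu>: "sigma_finite_measure \<mu>" "sets \<mu> = sets borel"
    and \<nu>: "sigma_finite_measure \<nu>" "sets \<nu> = sets borel"
    and eq: "2 * mutual_energy s \<mu> \<nu> = mutual_energy s \<mu> \<mu> + mutual_energy s \<nu> \<nu>"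
    and fin: "mutual_energy s \<mu> \<mu> \<noteq> \<infinity>" "mutual_energy s \<nu> \<nu> \<noteq> \<infinity>"
  shows "AE w in lborel \<Otimes>\<^sub>M lborel. gauss_transform s \<mu> w = gauss_transform s \<nu> w"
proof -
  let ?W = "lborel \<Otimes>\<^sub>M lborel :: (real \<times> 'a) measure"
  let ?a = "gauss_transform s \<mu>" and ?b = "gauss_transform s \<nu>"
  note [measurable] = borel_measurable_gauss_transform[OF \<mu>] borel_measurable_gauss_transform[OF \<nu>]
  have i1: "2 * mutual_energy s \<mu> \<nu> = (\<integral>\<^sup>+w. 2 * (?a w * ?b w) \<partial>?W)"
    unfolding mutual_energy_eq_transforms[OF s \<mu> \<nu>] by (rule nn_integral_cmult[symmetric]) measurable
  have i2: "mutual_energy s \<mu> \<mu> + mutual_energy s \<nu> \<nu> = (\<integral>\<^sup>+w. ?a w * ?a w + ?b w * ?b w \<partial>?W)"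
    unfolding mutual_energy_eq_transforms[OF s \<mu> \<mu>] mutual_energy_eq_transforms[OF s \<nu> \<nu>]
    by (rule nn_integral_add[symmetric]) measurable
  have "(\<integral>\<^sup>+w. (?a w * ?a w + ?b w * ?b w) - 2 * (?a w * ?b w) \<partial>?W) =
    (\<integral>\<^sup>+w. ?a w * ?a w + ?b w * ?b w \<partial>?W) - (\<integral>\<^sup>+w. 2 * (?a w * ?b w) \<partial>?W)"
  proof (rule nn_integral_diff)
    show "(\<integral>\<^sup>+w. 2 * (?a w * ?b w) \<partial>?W) \<noteq> \<infinity>"
      unfolding i1[symmetric] eq using fin by simp
  qed (measurable, rule AE_I2, rule ennreal_two_mult_le)
  also have "\<dots> = 0" unfolding i1[symmetric] i2[symmetric] eq using fin by simp
  finally have "AE w in ?W. (?a w * ?a w + ?b w * ?b w) - 2 * (?a w * ?b w) = 0"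
    by (subst (asm) nn_integral_0_iff_AE) measurable
  moreover have "AE w in ?W. ?a w * ?a w \<noteq> \<infinity>"
    by (rule nn_integral_noteq_infinite, measurable) (rule fin(1)[unfolded mutual_energy_eq_transforms[OF s \<mu> \<mu>]])
  moreover have "AE w in ?W. ?b w * ?b w \<noteq> \<infinity>"
    by (rule nn_integral_noteq_infinite, measurable) (rule fin(2)[unfolded mutual_energy_eq_transforms[OF s \<nu> \<nu>]])
  ultimately show ?thesis
  proof eventually_elim
    case (elim w)
    then have "?a w * ?a w + ?b w * ?b w \<le> 2 * (?a w * ?b w)"
      by (simp only: diff_eq_0_iff_ennreal)
    then show ?case
      by (intro ennreal_two_mult_eqD[OF antisym[OF ennreal_two_mult_le] elim(2,3)])
  qed
qed


section \<open>The variational criterion\<close>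

text \<open>A conull set of reals is unbounded. This supplies parameters t tending to infinity at
  which two Gaussian transforms agree for almost every z.\<close>

lemma AE_lborel_imp_greater:
  assumes "AE t in lborel. P (t :: real)"
  shows "\<exists>t>K. P t"
proof (rule ccontr)
  assume "\<not> (\<exists>t>K. P t)"
  with assms have "AE t in lborel. t \<notin> {K<..<K + 1}" by (auto elim!: eventually_mono)
  then have "{K<..<K + 1} \<in> null_sets lborel" by (subst AE_iff_null_sets) auto
  then show False by (simp add: null_sets_def)
qed

text \<open>Integrated against f(z) at fixed t, the Gaussian transform of a measure is a multiple of
  the integral of a mollification of f against that measure. As t tends to infinity the
  mollifications converge boundedly to a constant multiple of f, so the integrals of f
  agree.\<close>

lemma nn_integral_eq_of_gauss_transform_eq:
  fixes \<mu> \<nu> :: "'a::euclidean_space measure" and f :: "'a \<Rightarrow> real"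
  assumes s: "s > 0" and \<mu>: "prob_space \<mu>" "sets \<mu> = sets borel" and \<nu>: "prob_space \<nu>" "sets \<nu> = sets borel"
    and AE: "AE w in lborel \<Otimes>\<^sub>M lborel. gauss_transform s \<mu> w = gauss_transform s \<nu> w"
    and f: "continuous_on UNIV f" "\<And>x. 0 \<le> f x" "\<And>x. f x \<le> 1"
  shows "(\<integral>\<^sup>+x. ennreal (f x) \<partial>\<mu>) = (\<integral>\<^sup>+x. ennreal (f x) \<partial>\<nu>)"
proof -
  define E where "E = (\<integral>\<^sup>+y. ennreal (exp (- (norm y)\<^sup>2)) \<partial>(lborel :: 'a measure))"
  have "E = ennreal ((pi / 1) powr (real DIM('a) / 2))"
    unfolding E_def using nn_integral_gaussian[of 1, where 'a = 'a] by simp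
  then have E: "E \<noteq> 0" "E < \<infinity>" "E \<noteq> \<infinity>" by auto
  have [measurable]: "f \<in> borel_measurable borel" by (rule borel_measurable_continuous_onI[OF f(1)])
  have "AE t in lborel. AE z in lborel. gauss_transform s \<mu> (t, z) = gauss_transform s \<nu> (t, z)"
    by (rule lborel_pair.AE_pair[OF AE])
  from AE_lborel_imp_greater[OF this]
  have "\<exists>t>real k. AE z in lborel. gauss_transform s \<mu> (t, z) = gauss_transform s \<nu> (t, z)" for k .
  then obtain t where t: "\<And>k. t k > real k"
    and AEt: "\<And>k. AE z in lborel. gauss_transform s \<mu> (t k, z) = gauss_transform s \<nu> (t k, z)"
    by metis
  have tpos: "t k > 0" for k using t[of k] by (rule le_less_trans[OF of_nat_0_le_iff])
  \<comment> \<open>Since 2 t c^2 = 1, the substitution z = x + c y turns exp(- 2 t |x - z|^2) into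
    exp(- |y|^2), a single Gaussian that dominates for all k.\<close>
  define c where "c k = 1 / sqrt (2 * t k)" for k
  have cpos: "c k > 0" for k using tpos[of k] by (simp add: c_def)
  define A where "A k x = (\<integral>\<^sup>+y. ennreal (f (x + c k *\<^sub>R y)) * ennreal (exp (- (norm y)\<^sup>2)) \<partial>lborel)" for k x
  have [measurable]: "A k \<in> borel_measurable borel" for k unfolding A_def[abs_def] by measurable
  define q where "q k = sqrt (t k powr (s / 2 - 1) / Gamma (s / 2) * (4 * t k / pi) powr (real DIM('a) / 2))" for k
  have qpos: "q k > 0" for k using tpos[of k] s by (simp add: q_def Gamma_real_pos)
  have A_eq: "ennreal (q k * c k ^ DIM('a)) * A k x = (\<integral>\<^sup>+z. ennreal (f z) * gauss_feature s (t k, z) x \<partial>lborel)" for k x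
  proof -
    have gf: "gauss_feature s (t k, x + c k *\<^sub>R y) x = ennreal (q k) * ennreal (exp (- (norm y)\<^sup>2))" for y
    proof -
      have "2 * t k * (norm (x - (x + c k *\<^sub>R y)))\<^sup>2 = (2 * t k * (c k)\<^sup>2) * (norm y)\<^sup>2"
        by (simp add: power_mult_distrib)
      also have "2 * t k * (c k)\<^sup>2 = 1" using tpos[of k] by (simp add: c_def power_divide)
      finally have e: "2 * t k * (norm (x - (x + c k *\<^sub>R y)))\<^sup>2 = (norm y)\<^sup>2" by simp
      have "gauss_feature s (t k, x + c k *\<^sub>R y) x = ennreal (q k * exp (- (2 * t k * (norm (x - (x + c k *\<^sub>R y)))\<^sup>2))) * indicator {0<..} (t k)"
        by (simp only: gauss_feature_def q_def fst_conv snd_conv)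
      then show ?thesis unfolding e using tpos[of k] less_imp_le[OF qpos[of k]] by (simp add: ennreal_mult)
    qed
    have "(\<integral>\<^sup>+z. ennreal (f z) * gauss_feature s (t k, z) x \<partial>lborel) =
      ennreal (\<bar>c k\<bar> ^ DIM('a)) * (\<integral>\<^sup>+y. ennreal (f (x + c k *\<^sub>R y)) * gauss_feature s (t k, x + c k *\<^sub>R y) x \<partial>lborel)"
      by (rule nn_integral_euclidean_affine) (use cpos[of k] in \<open>auto simp: less_imp_neq[symmetric]\<close>)
    also have "(\<integral>\<^sup>+y. ennreal (f (x + c k *\<^sub>R y)) * gauss_feature s (t k, x + c k *\<^sub>R y) x \<partial>lborel) =
      (\<integral>\<^sup>+y. ennreal (q k) * (ennreal (f (x + c k *\<^sub>R y)) * ennreal (exp (- (norm y)\<^sup>2))) \<partial>lborel)"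
      unfolding gf by (simp only: mult_ac)
    also have "\<dots> = ennreal (q k) * A k x"
      unfolding A_def by (rule nn_integral_cmult) measurable
    also have "ennreal (\<bar>c k\<bar> ^ DIM('a)) * \<dots> = ennreal (q k * c k ^ DIM('a)) * A k x"
      using cpos[of k] qpos[of k] by (simp add: ennreal_mult mult_ac)
    finally show ?thesis by simp
  qed
  have int_A: "ennreal (q k * c k ^ DIM('a)) * (\<integral>\<^sup>+x. A k x \<partial>\<rho>) = (\<integral>\<^sup>+z. ennreal (f z) * gauss_transform s \<rho> (t k, z) \<partial>lborel)"
    if \<rho>: "prob_space \<rho>" and [measurable_cong]: "sets \<rho> = sets borel" for k and \<rho> :: "'a measure"
  proof -
    interpret R: prob_space \<rho> by fact
    interpret RL: pair_sigma_finite "lborel :: 'a measure" \<rho> ..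
    have "ennreal (q k * c k ^ DIM('a)) * (\<integral>\<^sup>+x. A k x \<partial>\<rho>) = (\<integral>\<^sup>+x. (\<integral>\<^sup>+z. ennreal (f z) * gauss_feature s (t k, z) x \<partial>lborel) \<partial>\<rho>)"
      unfolding A_eq[symmetric] by (rule nn_integral_cmult[symmetric]) measurable
    also have "\<dots> = (\<integral>\<^sup>+z. (\<integral>\<^sup>+x. ennreal (f z) * gauss_feature s (t k, z) x \<partial>\<rho>) \<partial>lborel)"
      by (rule RL.Fubini') measurable
    also have "\<dots> = (\<integral>\<^sup>+z. ennreal (f z) * gauss_transform s \<rho> (t k, z) \<partial>lborel)"
      unfolding gauss_transform_def by (intro nn_integral_cong nn_integral_cmult) measurable
    finally show ?thesis .
  qed
  have A_same: "(\<integral>\<^sup>+x. A k x \<partial>\<mu>) = (\<integral>\<^sup>+x. A k x \<partial>\<nu>)" for k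
  proof -
    have "ennreal (q k * c k ^ DIM('a)) * (\<integral>\<^sup>+x. A k x \<partial>\<mu>) = ennreal (q k * c k ^ DIM('a)) * (\<integral>\<^sup>+x. A k x \<partial>\<nu>)"
      unfolding int_A[OF \<mu>] int_A[OF \<nu>]
      by (intro nn_integral_cong_AE, use AEt[of k] in eventually_elim) simp
    moreover have "q k * c k ^ DIM('a) > 0" using cpos[of k] qpos[of k] by simp
    then have "ennreal (q k * c k ^ DIM('a)) \<noteq> 0" by (simp only: ennreal_eq_0_iff not_le)
    ultimately show ?thesis by (subst (asm) ennreal_mult_cancel_left) (auto simp del: ennreal_eq_0_iff)
  qed
  have clim: "c \<longlonglongrightarrow> 0"
  proof (rule tendsto_sandwich[of "\<lambda>_. 0" _ _ "\<lambda>k. 1 / sqrt (real k)"])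
    have "c k \<le> 1 / sqrt (real k)" if "k > 0" for k
      unfolding c_def using t[of k] tpos[of k] that by (intro divide_left_mono) auto
    then show "eventually (\<lambda>k. c k \<le> 1 / sqrt (real k)) sequentially"
      by (rule eventually_mono[OF eventually_gt_at_top[of 0]])
    show "(\<lambda>k. 1 / sqrt (real k)) \<longlonglongrightarrow> 0" by real_asymp
  qed (use cpos in \<open>auto intro!: always_eventually less_imp_le\<close>)
  have A_lim: "(\<lambda>k. A k x) \<longlonglongrightarrow> ennreal (f x) * E" for x
  proof -
    have "(\<lambda>k. \<integral>\<^sup>+y. ennreal (f (x + c k *\<^sub>R y)) * ennreal (exp (- (norm y)\<^sup>2)) \<partial>lborel) \<longlonglongrightarrow>
      (\<integral>\<^sup>+y. ennreal (f x) * ennreal (exp (- (norm y)\<^sup>2)) \<partial>(lborel :: 'a measure))"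
    proof (rule nn_integral_dominated_convergence[where w = "\<lambda>y. ennreal (exp (- (norm y)\<^sup>2))"])
      show "AE y in lborel. ennreal (f (x + c k *\<^sub>R y)) * ennreal (exp (- (norm y)\<^sup>2)) \<le> ennreal (exp (- (norm y)\<^sup>2))" for k
      proof (rule AE_I2)
        fix y :: 'a
        have "ennreal (f (x + c k *\<^sub>R y)) * ennreal (exp (- (norm y)\<^sup>2)) \<le> 1 * ennreal (exp (- (norm y)\<^sup>2))"
          using f(3) by (intro mult_right_mono) auto
        then show "ennreal (f (x + c k *\<^sub>R y)) * ennreal (exp (- (norm y)\<^sup>2)) \<le> ennreal (exp (- (norm y)\<^sup>2))" by simp
      qed
      show "(\<integral>\<^sup>+y. ennreal (exp (- (norm y)\<^sup>2)) \<partial>(lborel :: 'a measure)) < \<infinity>" using E unfolding E_def by simp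
      show "AE y in lborel. (\<lambda>k. ennreal (f (x + c k *\<^sub>R y)) * ennreal (exp (- (norm y)\<^sup>2))) \<longlonglongrightarrow> ennreal (f x) * ennreal (exp (- (norm y)\<^sup>2))"
      proof (rule AE_I2)
        fix y :: 'a
        have "(\<lambda>k. x + c k *\<^sub>R y) \<longlonglongrightarrow> x + 0 *\<^sub>R y" by (intro tendsto_intros clim)
        then have "(\<lambda>k. f (x + c k *\<^sub>R y)) \<longlonglongrightarrow> f x"
          using f(1) continuous_on_tendsto_compose[of UNIV f "\<lambda>k. x + c k *\<^sub>R y" x sequentially] by simp
        then have "(\<lambda>k. ennreal (f (x + c k *\<^sub>R y) * exp (- (norm y)\<^sup>2))) \<longlonglongrightarrow> ennreal (f x * exp (- (norm y)\<^sup>2))"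
          by (intro tendsto_ennrealI tendsto_intros)
        then show "(\<lambda>k. ennreal (f (x + c k *\<^sub>R y)) * ennreal (exp (- (norm y)\<^sup>2))) \<longlonglongrightarrow> ennreal (f x) * ennreal (exp (- (norm y)\<^sup>2))"
          using f(2) by (simp add: ennreal_mult)
      qed
    qed measurable
    then show ?thesis unfolding A_def E_def by (subst (asm) nn_integral_cmult) auto
  qed
  have A_le: "A k x \<le> E" for k x
    unfolding A_def E_def
  proof (rule nn_integral_mono)
    fix y :: 'a
    have "ennreal (f (x + c k *\<^sub>R y)) * ennreal (exp (- (norm y)\<^sup>2)) \<le> 1 * ennreal (exp (- (norm y)\<^sup>2))"
      using f(3) by (intro mult_right_mono) auto
    then show "ennreal (f (x + c k *\<^sub>R y)) * ennreal (exp (- (norm y)\<^sup>2)) \<le> ennreal (exp (- (norm y)\<^sup>2))" by simp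
  qed
  have lim: "(\<lambda>k. \<integral>\<^sup>+x. A k x \<partial>\<rho>) \<longlonglongrightarrow> (\<integral>\<^sup>+x. ennreal (f x) * E \<partial>\<rho>)"
    if \<rho>: "prob_space \<rho>" and [measurable_cong]: "sets \<rho> = sets borel" for \<rho> :: "'a measure"
  proof -
    interpret R: prob_space \<rho> by fact
    show ?thesis
    proof (rule nn_integral_dominated_convergence[where w = "\<lambda>_. E"])
      show "(\<integral>\<^sup>+x. E \<partial>\<rho>) < \<infinity>" using E by (simp add: R.emeasure_space_1)
    qed (use A_le A_lim in \<open>auto\<close>)
  qed
  have "(\<integral>\<^sup>+x. ennreal (f x) * E \<partial>\<mu>) = (\<integral>\<^sup>+x. ennreal (f x) * E \<partial>\<nu>)"
    using LIMSEQ_unique[OF lim[OF \<mu>]] lim[OF \<nu>] unfolding A_same by blast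
  moreover have "(\<integral>\<^sup>+x. ennreal (f x) * E \<partial>\<rho>) = E * (\<integral>\<^sup>+x. ennreal (f x) \<partial>\<rho>)"
    if [measurable_cong]: "sets \<rho> = sets borel" for \<rho> :: "'a measure"
    by (subst nn_integral_multc) (auto simp: mult.commute)
  ultimately show ?thesis
    using E by (simp add: \<mu>(2) \<nu>(2) ennreal_mult_cancel_left)
qed

text \<open>The indicator of a nonempty closed set F is the limit of the continuous functions max(0,
  1 - m dist(x, F)), so closed sets have equal measure; they form an intersection-stable generator
  of the Borel sets.\<close>

lemma measure_eq_of_gauss_transform_eq:
  fixes \<mu> \<nu> :: "'a::euclidean_space measure"
  assumes s: "s > 0" and \<mu>: "prob_space \<mu>" "sets \<mu> = sets borel" and \<nu>: "prob_space \<nu>" "sets \<nu> = sets borel"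
    and AE: "AE w in lborel \<Otimes>\<^sub>M lborel. gauss_transform s \<mu> w = gauss_transform s \<nu> w"
  shows "\<mu> = \<nu>"
proof -
  interpret M: prob_space \<mu> by (rule \<mu>(1))
  interpret N: prob_space \<nu> by (rule \<nu>(1))
  have sp: "space \<mu> = UNIV" "space \<nu> = UNIV"
    using sets_eq_imp_space_eq[OF \<mu>(2)] sets_eq_imp_space_eq[OF \<nu>(2)] by auto
  have closed_eq: "emeasure \<mu> F = emeasure \<nu> F" if F: "closed F" for F
  proof (cases "F = {}")
    case False
    define f where "f m x = max 0 (1 - real m * infdist x F)" for m x
    have fc: "continuous_on UNIV (f m)" for m
      unfolding f_def by (intro continuous_intros)
    have [measurable]: "f m \<in> borel_measurable borel" for m
      by (rule borel_measurable_continuous_onI[OF fc])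
    have flim: "(\<lambda>m. ennreal (f m x)) \<longlonglongrightarrow> indicator F x" for x
    proof (cases "x \<in> F")
      case True
      then show ?thesis by (simp add: f_def infdist_zero)
    next
      case out: False
      then have pos: "infdist x F > 0"
        using in_closed_iff_infdist_zero[OF F False, of x] infdist_nonneg[of x F] by linarith
      obtain N where N: "1 / infdist x F < real N" using reals_Archimedean2 by blast
      have "f m x = 0" if "m \<ge> N" for m
      proof -
        have "1 / infdist x F < real m" using N that by simp
        then have "1 < real m * infdist x F" using pos by (simp add: divide_less_eq)
        then show ?thesis by (simp add: f_def)
      qed
      then have "eventually (\<lambda>m. ennreal (f m x) = 0) sequentially"
        unfolding eventually_sequentially by (intro exI[of _ N]) simp
      then show ?thesis using out by (simp add: tendsto_eventually)
    qed
    have lim: "(\<lambda>m. \<integral>\<^sup>+x. ennreal (f m x) \<partial>\<rho>) \<longlonglongrightarrow> emeasure \<rho> F"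
      if \<rho>: "prob_space \<rho>" and [measurable_cong]: "sets \<rho> = sets borel" for \<rho> :: "'a measure"
    proof -
      interpret R: prob_space \<rho> by fact
      have [measurable]: "F \<in> sets borel" using F by (rule borel_closed)
      have "(\<lambda>m. \<integral>\<^sup>+x. ennreal (f m x) \<partial>\<rho>) \<longlonglongrightarrow> (\<integral>\<^sup>+x. indicator F x \<partial>\<rho>)"
      proof (rule nn_integral_dominated_convergence[where w = "\<lambda>_. 1"])
        show "AE x in \<rho>. ennreal (f m x) \<le> 1" for m
          by (rule AE_I2) (simp add: f_def infdist_nonneg ennreal_le_1)
      qed (use flim in \<open>auto simp: R.emeasure_space_1\<close>)
      then show ?thesis by (simp add: that(2))
    qed
    have "(\<integral>\<^sup>+x. ennreal (f m x) \<partial>\<mu>) = (\<integral>\<^sup>+x. ennreal (f m x) \<partial>\<nu>)" for m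
      by (rule nn_integral_eq_of_gauss_transform_eq[OF s \<mu> \<nu> AE fc]) (auto simp: f_def infdist_nonneg)
    then show ?thesis
      using LIMSEQ_unique[OF lim[OF \<mu>]] lim[OF \<nu>] by simp
  qed simp
  show ?thesis
  proof (rule measure_eqI_generator_eq[where E = "Collect closed" and \<Omega> = UNIV and A = "\<lambda>_. UNIV"])
    show "Int_stable (Collect closed :: 'a set set)" by (auto simp: Int_stable_def)
    show "sets \<mu> = sigma_sets UNIV (Collect closed)" "sets \<nu> = sigma_sets UNIV (Collect closed)"
      unfolding \<mu>(2) \<nu>(2) borel_eq_closed by (simp_all add: sets_measure_of)
    show "emeasure \<mu> UNIV \<noteq> \<infinity>" using M.emeasure_space_1 by (simp add: sp)
  qed (auto simp: closed_eq)
qed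

text \<open>If the weighted potential of \<open>\<mu>\<^sub>0\<close> is constant on \<open>D\<close>, expanding the square gives
  \<open>I\<^sub>Q(\<mu>) - I\<^sub>Q(\<mu>\<^sub>0) = I(\<mu> - \<mu>\<^sub>0)\<close>; all terms are moved to the side where they are positive.\<close>

lemma is_extremal_measure_iff:
  fixes \<mu>\<^sub>0 :: "'a::euclidean_space measure"
  assumes s: "s > 0" and D: "D \<in> sets borel" and Q0 [measurable]: "Q\<^sub>0 \<in> borel_measurable borel"
    and Q: "\<And>x. x \<in> D \<Longrightarrow> Q x = Q\<^sub>0 x"
    and \<mu>\<^sub>0: "\<mu>\<^sub>0 \<in> unit_measures_on D" and c: "c \<noteq> \<infinity>"
    and const: "\<And>x. x \<in> D \<Longrightarrow> (\<integral>\<^sup>+y. riesz_kernel s x y \<partial>\<mu>\<^sub>0) + Q\<^sub>0 x = c"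
  shows "is_extremal_measure s Q D \<mu> \<longleftrightarrow> \<mu> = \<mu>\<^sub>0"
proof -
  have P0: "prob_space \<mu>\<^sub>0" "sets \<mu>\<^sub>0 = sets borel" "sigma_finite_measure \<mu>\<^sub>0"
    using \<mu>\<^sub>0 by (auto simp: unit_measures_on_def prob_space_def finite_measure_def)
  interpret M0: sigma_finite_measure \<mu>\<^sub>0 by (rule P0(3))
  have energy: "riesz_energy s \<mu> = mutual_energy s \<mu> \<mu>" for \<mu> :: "'a measure"
    by (simp add: riesz_energy_def mutual_energy_def)
  have key: "mutual_energy s \<mu> \<mu>\<^sub>0 + (\<integral>\<^sup>+x. Q x \<partial>\<mu>) = c" if "\<mu> \<in> unit_measures_on D" for \<mu>
  proof -
    have \<mu>: "sets \<mu> = sets borel" "prob_space \<mu>" "emeasure \<mu> (- D) = 0"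
      using that by (auto simp: unit_measures_on_def)
    interpret M: prob_space \<mu> by (rule \<mu>(2))
    note [measurable_cong] = \<mu>(1) P0(2)
    \<comment> \<open>Only the values of \<open>Q\<close> on \<open>D\<close> are prescribed; since
      \<open>\<mu>\<close> lives on \<open>D\<close>, the Borel function \<open>Q\<^sub>0\<close>
      with the same values there may be integrated instead.\<close>
    have "AE x in \<mu>. x \<in> D"
    proof (rule AE_I)
      show "- D \<in> sets \<mu>" using D by (simp add: \<mu>(1))
    qed (use \<mu>(3) in auto)
    then have "(\<integral>\<^sup>+x. Q x \<partial>\<mu>) = (\<integral>\<^sup>+x. Q\<^sub>0 x \<partial>\<mu>)"
      by (intro nn_integral_cong_AE) (auto elim!: eventually_mono simp: Q)
    then have "mutual_energy s \<mu> \<mu>\<^sub>0 + (\<integral>\<^sup>+x. Q x \<partial>\<mu>) = (\<integral>\<^sup>+x. (\<integral>\<^sup>+y. riesz_kernel s x y \<partial>\<mu>\<^sub>0) + Q\<^sub>0 x \<partial>\<mu>)"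
      unfolding mutual_energy_def by (subst nn_integral_add) measurable
    also have "\<dots> = (\<integral>\<^sup>+x. c \<partial>\<mu>)"
      using \<open>AE x in \<mu>. x \<in> D\<close> by (intro nn_integral_cong_AE) (auto elim!: eventually_mono simp: const)
    also have "\<dots> = c" by (simp add: M.emeasure_space_1)
    finally show ?thesis .
  qed
  define W where "W \<mu> = weighted_energy s Q \<mu>" for \<mu>
  have fin: "mutual_energy s \<mu> \<mu>\<^sub>0 \<noteq> \<infinity>" if "\<mu> \<in> unit_measures_on D" for \<mu>
    using key[OF that] c by auto
  \<comment> \<open>Twice the mutual energy is added rather than subtracted, so that
    \<open>key\<close> can be inserted without knowing whether the energy of \<open>\<mu>\<close> is
    finite.\<close>
  have W_eq: "W \<mu> + 2 * mutual_energy s \<mu> \<mu>\<^sub>0 = mutual_energy s \<mu> \<mu> + 2 * c" if "\<mu> \<in> unit_measures_on D" for \<mu>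
  proof -
    have "W \<mu> + 2 * mutual_energy s \<mu> \<mu>\<^sub>0 = mutual_energy s \<mu> \<mu> + 2 * (mutual_energy s \<mu> \<mu>\<^sub>0 + (\<integral>\<^sup>+x. Q x \<partial>\<mu>))"
      by (simp add: W_def weighted_energy_def energy distrib_left ac_simps)
    then show ?thesis by (simp only: key[OF that])
  qed
  have W0: "W \<mu>\<^sub>0 + mutual_energy s \<mu>\<^sub>0 \<mu>\<^sub>0 = 2 * c"
  proof -
    have "mutual_energy s \<mu>\<^sub>0 \<mu>\<^sub>0 + (W \<mu>\<^sub>0 + mutual_energy s \<mu>\<^sub>0 \<mu>\<^sub>0) = mutual_energy s \<mu>\<^sub>0 \<mu>\<^sub>0 + 2 * c"
      using W_eq[OF \<mu>\<^sub>0] by (simp add: mult_2 ac_simps)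
    then show ?thesis using fin[OF \<mu>\<^sub>0] by (simp add: ennreal_add_left_cancel)
  qed
  have W0_fin: "W \<mu>\<^sub>0 \<noteq> \<infinity>"
  proof
    assume "W \<mu>\<^sub>0 = \<infinity>"
    then have "2 * c = \<infinity>" using W0 by simp
    then show False using c by (simp add: ennreal_mult_eq_top_iff)
  qed
  have W_split: "W \<mu> + 2 * mutual_energy s \<mu> \<mu>\<^sub>0 = W \<mu>\<^sub>0 + (mutual_energy s \<mu> \<mu> + mutual_energy s \<mu>\<^sub>0 \<mu>\<^sub>0)"
    if "\<mu> \<in> unit_measures_on D" for \<mu>
    unfolding W_eq[OF that] W0[symmetric] by (simp add: ac_simps)
  have sf: "sigma_finite_measure \<mu>" "sets \<mu> = sets borel" if "\<mu> \<in> unit_measures_on D" for \<mu>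
    using that by (auto simp: unit_measures_on_def prob_space_def finite_measure_def)
  have min: "W \<mu>\<^sub>0 \<le> W \<mu>" if \<mu>: "\<mu> \<in> unit_measures_on D" for \<mu>
  proof -
    have "2 * mutual_energy s \<mu> \<mu>\<^sub>0 + W \<mu>\<^sub>0 \<le> (mutual_energy s \<mu> \<mu> + mutual_energy s \<mu>\<^sub>0 \<mu>\<^sub>0) + W \<mu>\<^sub>0"
      by (intro add_right_mono mutual_energy_le[OF s sf[OF \<mu>] sf[OF \<mu>\<^sub>0]])
    also have "\<dots> = 2 * mutual_energy s \<mu> \<mu>\<^sub>0 + W \<mu>" using W_split[OF \<mu>] by (simp add: ac_simps)
    finally show ?thesis
      using fin[OF \<mu>] by (subst (asm) ennreal_add_left_cancel_le) (auto simp: ennreal_mult_eq_top_iff)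
  qed
  have Vmin: "min_weighted_energy s Q D = W \<mu>\<^sub>0"
    unfolding min_weighted_energy_def W_def[symmetric]
    by (intro antisym INF_lower \<mu>\<^sub>0 INF_greatest min)
  show ?thesis
  proof
    assume "is_extremal_measure s Q D \<mu>"
    then have \<mu>: "\<mu> \<in> unit_measures_on D" and eq: "W \<mu> = W \<mu>\<^sub>0"
      by (auto simp: is_extremal_measure_def Vmin W_def)
    have "2 * mutual_energy s \<mu> \<mu>\<^sub>0 = mutual_energy s \<mu> \<mu> + mutual_energy s \<mu>\<^sub>0 \<mu>\<^sub>0"
      using W_split[OF \<mu>] W0_fin unfolding eq by (simp add: ennreal_add_left_cancel)
    moreover have "mutual_energy s \<mu> \<mu> \<noteq> \<infinity>"
    proof -
      have "mutual_energy s \<mu> \<mu> \<le> W \<mu>" by (simp add: W_def weighted_energy_def energy)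
      then show ?thesis using W0_fin unfolding eq by (auto simp: top_unique)
    qed
    ultimately have "AE w in lborel \<Otimes>\<^sub>M lborel. gauss_transform s \<mu> w = gauss_transform s \<mu>\<^sub>0 w"
      using fin[OF \<mu>\<^sub>0] by (intro mutual_energy_eqD[OF s sf[OF \<mu>] sf[OF \<mu>\<^sub>0]])
    then show "\<mu> = \<mu>\<^sub>0"
      using \<mu> \<mu>\<^sub>0 by (intro measure_eq_of_gauss_transform_eq[OF s]) (auto simp: unit_measures_on_def)
  next
    assume "\<mu> = \<mu>\<^sub>0"
    then show "is_extremal_measure s Q D \<mu>"
      using \<mu>\<^sub>0 by (simp add: is_extremal_measure_def Vmin W_def)
  qed
qed


section \<open>The density of the swept measure\<close>

lemma inc_Beta_integrable:
  assumes "a > 0" "b > 0" "z \<le> (1::real)"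
  shows "(\<lambda>t. t powr (a - 1) * (1 - t) powr (b - 1)) integrable_on {0..z}"
  by (rule integrable_on_subinterval[OF has_integral_integrable[OF has_integral_Beta_real[OF assms(1,2)]]])
     (use assms in auto)

lemma inc_Beta_nonneg: "a > 0 \<Longrightarrow> b > 0 \<Longrightarrow> z \<le> 1 \<Longrightarrow> 0 \<le> inc_Beta z a b"
  unfolding inc_Beta_def by (intro integral_nonneg inc_Beta_integrable) auto

lemma inc_Beta_nonpos: "z \<le> 0 \<Longrightarrow> inc_Beta z a b = 0"
  by (cases "z = 0") (simp_all add: inc_Beta_def)

lemma continuous_on_inc_Beta:
  assumes "a > 0" "b > (0::real)"
  shows "continuous_on {0..1} (\<lambda>z. inc_Beta z a b)"
  unfolding inc_Beta_def
  by (rule indefinite_integral_continuous_1) (rule inc_Beta_integrable[OF assms order_refl])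

lemma borel_measurable_inc_Beta:
  assumes ab: "a > 0" "b > (0::real)" and [measurable]: "g \<in> borel_measurable M" and le: "\<And>x. g x \<le> 1"
  shows "(\<lambda>x. inc_Beta (g x) a b) \<in> borel_measurable M"
proof -
  have [measurable]: "(\<lambda>z. indicator {0..1} z *\<^sub>R inc_Beta z a b) \<in> borel_measurable borel"
    by (rule borel_measurable_continuous_on_indicator[OF _ continuous_on_inc_Beta[OF ab]]) auto
  have "(\<lambda>x. inc_Beta (g x) a b) = (\<lambda>x. indicator {0..1} (g x) *\<^sub>R inc_Beta (g x) a b)"
    using le inc_Beta_nonpos by (fastforce simp: indicator_def)
  also have "\<dots> \<in> borel_measurable M" by measurable
  finally show ?thesis .
qed

lemma nn_integral_inc_Beta:
  assumes ab: "a > 0" "b > 0" and z: "z \<le> (1::real)"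
  shows "(\<integral>\<^sup>+t\<in>{0<..<z}. ennreal (t powr (a - 1) * (1 - t) powr (b - 1)) \<partial>lborel) = ennreal (inc_Beta z a b)"
proof (rule nn_integral_has_integral_lebesgue')
  show "((\<lambda>t. t powr (a - 1) * (1 - t) powr (b - 1)) has_integral inc_Beta z a b) {0<..<z}"
    using integrable_integral[OF inc_Beta_integrable[OF assms]]
    by (simp add: has_integral_Icc_iff_Ioo inc_Beta_def)
qed auto

text \<open>Comes from integrating the derivative of t^a (1-t)^b. The layers produce the second
  parameter b + 1 while F is stated with b; the boundary term goes into the elementary summand of
  F.\<close>

lemma inc_Beta_plus1_right:
  assumes ab: "a > 0" "b > 0" and z: "0 \<le> z" "z < (1::real)"
  shows "(a + b) * inc_Beta z a (b + 1) = b * inc_Beta z a b + z powr a * (1 - z) powr b"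
proof -
  let ?f1 = "\<lambda>t::real. t powr (a - 1) * (1 - t) powr (b + 1 - 1)" and ?f2 = "\<lambda>t::real. t powr (a - 1) * (1 - t) powr (b - 1)"
  have "((\<lambda>t. (a + b) * ?f1 t - b * ?f2 t) has_integral (a + b) * inc_Beta z a (b + 1) - b * inc_Beta z a b) {0..z}"
    unfolding inc_Beta_def using ab z
    by (intro has_integral_diff has_integral_mult_right integrable_integral inc_Beta_integrable) auto
  moreover have "((\<lambda>t. (a + b) * ?f1 t - b * ?f2 t) has_integral z powr a * (1 - z) powr b - 0 powr a * (1 - 0) powr b) {0..z}"
  proof (rule fundamental_theorem_of_calculus_interior)
    show "continuous_on {0..z} (\<lambda>t. t powr a * (1 - t) powr b)"
      using ab z by (intro continuous_intros continuous_on_powr') auto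
    fix t assume t: "t \<in> {0<..<z}"
    then have pos: "t > 0" "1 - t > 0" using z by auto
    have "((\<lambda>t. t powr a * (1 - t) powr b) has_real_derivative
      a * t powr (a - 1) * (1 - t) powr b - t powr a * (b * (1 - t) powr (b - 1))) (at t)"
      using pos by (auto intro!: derivative_eq_intros)
    also have "a * t powr (a - 1) * (1 - t) powr b - t powr a * (b * (1 - t) powr (b - 1)) = (a + b) * ?f1 t - b * ?f2 t"
    proof -
      have "t powr a = t * t powr (a - 1)" "(1 - t) powr b = (1 - t) * (1 - t) powr (b - 1)"
        using pos by (simp_all add: powr_mult_base)
      moreover have "b + 1 - 1 = b" by simp
      ultimately show ?thesis by (simp only:) (simp add: algebra_simps)
    qed
    finally show "((\<lambda>t. t powr a * (1 - t) powr b) has_vector_derivative (a + b) * ?f1 t - b * ?f2 t) (at t)"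
      by (simp add: has_real_derivative_iff_has_vector_derivative)
  qed (use z in auto)
  ultimately have "(a + b) * inc_Beta z a (b + 1) - b * inc_Beta z a b = z powr a * (1 - z) powr b - 0 powr a * (1 - 0) powr b"
    by (rule has_integral_unique)
  then show ?thesis by simp
qed

text \<open>The substitution t = (w-v)/(w+H) carries (v, 1) to (0, z) with z = (1-v)/(1+H), and w +
  H becomes (v+H)/(1-t). This is the origin of the argument of the incomplete Beta function in F.
  The parameters are kept general because the mass computation uses another instance.\<close>

lemma nn_integral_layers:
  assumes l: "0 < l" and n: "(n - 2 * l) / 2 + 1 > (0::real)" and H: "H > 0" and v: "0 \<le> v" "v < 1"
  shows "(\<integral>\<^sup>+w\<in>{v<..<1}. ennreal ((w - v) powr (l - 1) * (w + H) powr (- n / 2 - 1)) \<partial>lborel) =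
    ennreal ((v + H) powr (- ((n - 2 * l) / 2) - 1) * inc_Beta ((1 - v) / (1 + H)) l ((n - 2 * l) / 2 + 1))"
proof -
  define a where "a = v + H"
  define z where "z = (1 - v) / (1 + H)"
  define b where "b = (n - 2 * l) / 2"
  have a: "a > 0" and b: "b + 1 > 0" using v H n by (simp_all add: a_def b_def)
  have z: "0 < z" "z < 1" using v H by (auto simp: z_def divide_simps)
  let ?g = "\<lambda>t. v + a * (t / (1 - t))"
  have zz: "1 - z = a / (1 + H)" using H by (simp add: z_def a_def field_simps)
  have wH: "?g t + H = a / (1 - t)" if "t < 1" for t
    using that by (simp add: a_def field_simps)
  have img: "?g ` {0<..<z} = {v<..<1}"
  proof (rule image_eq_if_right_inverse[where k = "\<lambda>w. (w - v) / (w + H)"])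
    fix t assume t: "t \<in> {0<..<z}"
    then have t1: "0 < t" "t < 1" using z by auto
    have "1 - z < 1 - t" using t by simp
    then have "a / (1 - t) < a / (1 - z)" using a z t1 by (intro divide_strict_left_mono) auto
    also have "\<dots> = 1 + H" using a H by (simp add: zz)
    finally have "?g t < 1" using wH[of t] t1 by simp
    then show "?g t \<in> {v<..<1}" using a t1 by simp
  next
    fix w assume w: "w \<in> {v<..<1}"
    then have wp: "w + H > 0" "w - v > 0" using v H by auto
    have om: "1 - (w - v) / (w + H) = a / (w + H)" using wp by (simp add: a_def field_simps)
    have "a / (1 + H) < a / (w + H)" using a wp w by (intro divide_strict_left_mono) auto
    then have "(w - v) / (w + H) < z" using om zz by simp
    moreover have "?g ((w - v) / (w + H)) = w" unfolding om using a wp by simp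
    ultimately show "(w - v) / (w + H) \<in> {0<..<z} \<and> ?g ((w - v) / (w + H)) = w" using wp by simp
  qed
  have "(\<integral>\<^sup>+w\<in>?g ` {0<..<z}. ennreal ((w - v) powr (l - 1) * (w + H) powr (- n / 2 - 1)) \<partial>lborel) =
    (\<integral>\<^sup>+t\<in>{0<..<z}. ennreal \<bar>a / (1 - t)\<^sup>2\<bar> * ennreal ((?g t - v) powr (l - 1) * (?g t + H) powr (- n / 2 - 1)) \<partial>lborel)"
  proof (rule nn_integral_substitution_inj)
    show "?g ` {0<..<z} \<in> sets borel" unfolding img by simp
    show "inj_on ?g {0<..<z}"
      using a z by (auto simp: inj_on_def divide_simps) (simp add: algebra_simps)
    show "(?g has_real_derivative a / (1 - t)\<^sup>2) (at t)" if "t \<in> {0<..<z}" for t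
    proof -
      have "((\<lambda>t. t / (1 - t)) has_real_derivative 1 / (1 - t)\<^sup>2) (at t)"
        using that z by (auto intro!: derivative_eq_intros simp: power2_eq_square)
      from DERIV_add[OF DERIV_const[of v] DERIV_cmult[OF this, of a]] show ?thesis by simp
    qed
  qed auto
  also have "\<dots> = (\<integral>\<^sup>+t. ennreal (a powr (- b - 1)) * (ennreal (t powr (l - 1) * (1 - t) powr ((b + 1) - 1)) * indicator {0<..<z} t) \<partial>lborel)"
  proof (rule nn_integral_cong, goal_cases)
    case (1 t)
    show ?case
    proof (cases "t \<in> {0<..<z}")
      case True
      define y where "y = 1 - t"
      have pos: "t > 0" "y > 0" using True z by (auto simp: y_def)
      have n2: "- n / 2 - 1 = - b - l - 1" by (simp add: b_def field_simps)
      have "\<bar>a / y\<^sup>2\<bar> * ((a * (t / y)) powr (l - 1) * (a / y) powr (- b - l - 1)) =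
        (a powr 1 * a powr (l - 1) * a powr (- b - l - 1)) * t powr (l - 1) * (y powr (- 2) * y powr (- (l - 1)) * y powr (- (- b - l - 1)))"
      proof -
        have "\<bar>a / y\<^sup>2\<bar> = a powr 1 * y powr (- 2)"
          using a pos by (simp add: powr_minus divide_inverse)
        moreover have "(a * (t / y)) powr (l - 1) = a powr (l - 1) * t powr (l - 1) * y powr (- (l - 1))"
          using a pos by (simp only: powr_minus_divide[of y "l - 1"]) (simp add: powr_mult powr_divide)
        moreover have "(a / y) powr (- b - l - 1) = a powr (- b - l - 1) * y powr (- (- b - l - 1))"
          using a pos by (simp only: powr_minus_divide[of y "- b - l - 1"]) (simp add: powr_divide)
        ultimately show ?thesis by (simp only: mult_ac)
      qed
      also have "a powr 1 * a powr (l - 1) * a powr (- b - l - 1) = a powr (- b - 1)"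
          by (simp only: powr_add[symmetric]) simp
      also have "y powr (- 2) * y powr (- (l - 1)) * y powr (- (- b - l - 1)) = y powr ((b + 1) - 1)"
        by (simp add: powr_add[symmetric])
      finally have "\<bar>a / (1 - t)\<^sup>2\<bar> * ((?g t - v) powr (l - 1) * (?g t + H) powr (- n / 2 - 1)) =
         a powr (- b - 1) * (t powr (l - 1) * (1 - t) powr ((b + 1) - 1))"
        unfolding n2 using wH[of t] pos by (simp add: y_def mult.assoc)
      then have "ennreal \<bar>a / (1 - t)\<^sup>2\<bar> * ennreal ((?g t - v) powr (l - 1) * (?g t + H) powr (- n / 2 - 1)) =
         ennreal (a powr (- b - 1)) * ennreal (t powr (l - 1) * (1 - t) powr ((b + 1) - 1))"
        by (simp only: ennreal_mult[symmetric] abs_ge_zero mult_nonneg_nonneg powr_ge_zero)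
      then show ?thesis by (simp only: mult.assoc)
    qed simp
  qed
  also have "\<dots> = ennreal (a powr (- b - 1)) * ennreal (inc_Beta z l (b + 1))"
    by (subst nn_integral_cmult, measurable, subst nn_integral_inc_Beta) (use l b z in auto)
  also have "\<dots> = ennreal (a powr (- b - 1) * inc_Beta z l (b + 1))"
    by (rule ennreal_mult'[symmetric]) simp
  finally show ?thesis unfolding img unfolding a_def b_def z_def .
qed

text \<open>This is - F(r) / q in the variables v = r^2, H = h^2, n = d - 1, with sin(\<lambda> pi)
  / pi replaced by 1 / Beta(\<lambda>, 1 - \<lambda>) through the reflection formula.\<close>

definition balayage_density :: "real \<Rightarrow> real \<Rightarrow> real \<Rightarrow> real \<Rightarrow> real" where
  "balayage_density n l H v = Gamma (n / 2) / (pi powr (n / 2) * Beta l (1 - l)) * H powr (1 - l) *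
     ((n - 2 * l) / 2 * (1 / (H + v) powr ((n - 2 * l) / 2 + 1)) * inc_Beta ((1 - v) / (1 + H)) l ((n - 2 * l) / 2)
      + (1 - v) powr (l - 1) / ((1 + H) powr (n / 2 - 1) * (H + v)))"

lemma balayage_density_nonneg:
  assumes "0 < l" "l < 1" "n \<ge> 2" "H > 0" "0 \<le> v"
  shows "0 \<le> balayage_density n l H v"
  using assms unfolding balayage_density_def
  by (intro mult_nonneg_nonneg add_nonneg_nonneg divide_nonneg_nonneg inc_Beta_nonneg)
     (auto simp: Gamma_real_pos Beta_def divide_simps)

lemma disk_balayage_eq_layers:
  fixes y :: "'a::euclidean_space"
  assumes "(norm y)\<^sup>2 < 1"
  shows "disk_balayage l H y = ennreal (balayage_mass (real DIM('a)) l H 1) * ennreal ((1 - (norm y)\<^sup>2) powr (l - 1)) +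
    (\<integral>\<^sup>+w\<in>{(norm y)\<^sup>2<..<1}. ennreal (real DIM('a) / 2 * balayage_mass (real DIM('a)) l H w / (w + H)) * ennreal ((w - (norm y)\<^sup>2) powr (l - 1)) \<partial>lborel)"
proof -
  have "(\<integral>\<^sup>+w\<in>{0<..<1}. ennreal (real DIM('a) / 2 * balayage_mass (real DIM('a)) l H w / (w + H)) * ball_weight l w y \<partial>lborel) =
    (\<integral>\<^sup>+w\<in>{(norm y)\<^sup>2<..<1}. ennreal (real DIM('a) / 2 * balayage_mass (real DIM('a)) l H w / (w + H)) * ennreal ((w - (norm y)\<^sup>2) powr (l - 1)) \<partial>lborel)"
  proof (rule nn_integral_cong, goal_cases)
    case (1 w)
    have "0 \<le> (norm y)\<^sup>2" by simp
    then have "w > 0" if "(norm y)\<^sup>2 < w" using that by (rule le_less_trans)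
    then show ?case
      by (cases "(norm y)\<^sup>2 < w"; cases "w < 1") (simp_all add: ball_weight_def)
  qed
  then show ?thesis using assms by (simp add: disk_balayage_def ball_weight_def)
qed

lemma disk_balayage_outside:
  fixes y :: "'a::euclidean_space"
  assumes "1 \<le> (norm y)\<^sup>2"
  shows "disk_balayage l H y = 0"
proof -
  have "(\<integral>\<^sup>+w\<in>{0<..<1}. ennreal (real DIM('a) / 2 * balayage_mass (real DIM('a)) l H w / (w + H)) * ball_weight l w y \<partial>lborel) =
    (\<integral>\<^sup>+w. 0 \<partial>(lborel :: real measure))"
    using assms by (intro nn_integral_cong) (auto simp: ball_weight_def indicator_def)
  then show ?thesis using assms by (simp add: disk_balayage_def ball_weight_def)
qed

text \<open>Integrating over the layers yields an incomplete Beta function with second parameter b +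
  1. Lowering it to b produces an elementary term, which adds up with the outermost layer to the
  second summand of the density.\<close>

lemma disk_balayage_eq_density:
  fixes y :: "'a::euclidean_space"
  assumes l: "0 < l" "l < 1" and n: "DIM('a) \<ge> 2" and H: "H > 0" and y: "(norm y)\<^sup>2 < 1"
  shows "disk_balayage l H y = ennreal (balayage_density (real DIM('a)) l H ((norm y)\<^sup>2))"
proof -
  define n where "n = real DIM('a)"
  have n2: "n \<ge> 2" using n by (simp add: n_def)
  define v where "v = (norm y)\<^sup>2"
  have v: "0 \<le> v" "v < 1" using y by (auto simp: v_def)
  define b where "b = (n - 2 * l) / 2"
  have b: "b > 0" using l n2 by (simp add: b_def)
  define c where "c = Gamma (n / 2) / (pi powr (n / 2) * Beta l (1 - l)) * H powr (1 - l)"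
  have c: "c \<ge> 0" using n2 l by (simp add: c_def Gamma_real_pos Beta_def)
  have bm: "balayage_mass n l H w = c * (w + H) powr (- n / 2)" for w
    by (simp add: balayage_mass_def c_def)
  define z where "z = (1 - v) / (1 + H)"
  have z: "0 \<le> z" "z < 1" using v H by (auto simp: z_def divide_simps)
  have aH: "v + H > 0" "1 + H > 0" "1 - v > 0" using v H by auto
  have "(\<integral>\<^sup>+w\<in>{v<..<1}. ennreal (n / 2 * balayage_mass n l H w / (w + H)) * ennreal ((w - v) powr (l - 1)) \<partial>lborel) =
    (\<integral>\<^sup>+w. ennreal (c * (n / 2)) * (ennreal ((w - v) powr (l - 1) * (w + H) powr (- n / 2 - 1)) * indicator {v<..<1} w) \<partial>lborel)"
  proof (rule nn_integral_cong, goal_cases)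
    case (1 w)
    show ?case
    proof (cases "w \<in> {v<..<1}")
      case True
      then have wH: "w + H > 0" using v H by auto
      then have "(w + H) powr (- n / 2 - 1) = (w + H) powr (- n / 2) / (w + H)" by (simp add: powr_diff)
      then have "n / 2 * balayage_mass n l H w / (w + H) * (w - v) powr (l - 1) =
        (c * (n / 2)) * ((w - v) powr (l - 1) * (w + H) powr (- n / 2 - 1))"
        by (simp add: bm)
      moreover have "0 \<le> n / 2 * balayage_mass n l H w / (w + H)" using wH c n2 by (simp add: bm)
      moreover have "0 \<le> c * (n / 2)" using c n2 by simp
      ultimately have "ennreal (n / 2 * balayage_mass n l H w / (w + H)) * ennreal ((w - v) powr (l - 1)) =
        ennreal (c * (n / 2)) * ennreal ((w - v) powr (l - 1) * (w + H) powr (- n / 2 - 1))"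
        by (simp only: ennreal_mult'[symmetric])
      then show ?thesis by (simp only: mult.assoc)
    qed simp
  qed
  also have "\<dots> = ennreal (c * (n / 2)) * ennreal ((v + H) powr (- b - 1) * inc_Beta z l (b + 1))"
  proof -
    have "(n - 2 * l) / 2 + 1 > 0" using b unfolding b_def by linarith
    from nn_integral_layers[OF l(1) this H v] show ?thesis
      unfolding b_def z_def by (subst nn_integral_cmult) measurable
  qed
  also have "\<dots> = ennreal (c * (v + H) powr (- b - 1) * (n / 2 * inc_Beta z l (b + 1)))"
    using c n2 by (simp add: ennreal_mult'[symmetric] mult_ac)
  also have "n / 2 * inc_Beta z l (b + 1) = b * inc_Beta z l b + z powr l * (1 - z) powr b"
    using inc_Beta_plus1_right[OF l(1) b z] by (simp add: b_def field_simps)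
  finally have 1: "(\<integral>\<^sup>+w\<in>{v<..<1}. ennreal (n / 2 * balayage_mass n l H w / (w + H)) * ennreal ((w - v) powr (l - 1)) \<partial>lborel) =
    ennreal (c * (v + H) powr (- b - 1) * (b * inc_Beta z l b + z powr l * (1 - z) powr b))" .
  have nn: "0 \<le> c * (v + H) powr (- b - 1) * (b * inc_Beta z l b + z powr l * (1 - z) powr b)"
    using c b l z inc_Beta_nonneg[of l b z] by (intro mult_nonneg_nonneg add_nonneg_nonneg) auto
  have "disk_balayage l H y = ennreal (c * (1 + H) powr (- n / 2)) * ennreal ((1 - v) powr (l - 1)) +
     ennreal (c * (v + H) powr (- b - 1) * (b * inc_Beta z l b + z powr l * (1 - z) powr b))"
    using disk_balayage_eq_layers[OF y, of l H] unfolding v_def[symmetric] n_def[symmetric] 1 unfolding bm .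
  also have "\<dots> = ennreal (c * (1 + H) powr (- n / 2) * (1 - v) powr (l - 1) +
     c * (v + H) powr (- b - 1) * (b * inc_Beta z l b + z powr l * (1 - z) powr b))"
    using c nn by (simp add: ennreal_mult'[symmetric] ennreal_plus[symmetric] del: ennreal_plus)
  also have "c * (1 + H) powr (- n / 2) * (1 - v) powr (l - 1) +
     c * (v + H) powr (- b - 1) * (b * inc_Beta z l b + z powr l * (1 - z) powr b) = balayage_density n l H v"
  proof -
    define A where "A = v + H"
    define B where "B = 1 + H"
    define V where "V = 1 - v"
    have pos: "A > 0" "B > 0" "V > 0" using aH by (auto simp: A_def B_def V_def)
    have zz: "z = V / B" "1 - z = A / B" using pos by (auto simp: z_def A_def B_def V_def field_simps)
    have n_b: "- n / 2 = - b - l" "n / 2 - 1 = b + l - 1" by (simp_all add: b_def field_simps)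
    have e1: "A powr (- b - 1) = 1 / A powr (b + 1)"
      by (simp only: powr_minus[of A "b + 1", symmetric] divide_inverse mult_1_left) simp
    have e2: "A powr (- b - 1) * (z powr l * (1 - z) powr b) = V powr (l - 1) * V / A * B powr (- b - l)"
    proof -
      have f: "(V / B) powr l = V powr l * B powr (- l)" "(A / B) powr b = A powr b * B powr (- b)"
        using pos by (simp_all add: powr_divide powr_minus_divide)
      have "A powr (- b - 1) * A powr b = 1 / A"
        using pos by (simp add: powr_add[symmetric] powr_minus divide_inverse)
      moreover have "V powr l = V powr (l - 1) * V" using pos by (simp add: powr_diff)
      moreover have "B powr (- l) * B powr (- b) = B powr (- b - l)" by (simp add: powr_add[symmetric] add.commute)
      moreover have "A powr (- b - 1) * (z powr l * (1 - z) powr b) =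
        (A powr (- b - 1) * A powr b) * V powr l * (B powr (- l) * B powr (- b))"
        unfolding zz(2) unfolding zz(1) f by (simp only: mult_ac)
      ultimately show ?thesis by simp
    qed
    have e3: "B powr (- b - l) = 1 / (B powr (b + l - 1) * B)"
      using pos by (simp add: powr_diff powr_minus powr_add divide_simps)
    \<comment> \<open>With V = 1 - v, A = v + H and B = 1 + H one has V + A = B; this is what merges
      the boundary term with the outermost layer.\<close>
    have e4: "V powr (l - 1) * V / A * B powr (- b - l) + B powr (- b - l) * V powr (l - 1) = V powr (l - 1) / (B powr (b + l - 1) * A)"
    proof -
      have "V / A + 1 = B / A" using pos by (simp add: A_def B_def V_def field_simps)
      moreover have "V powr (l - 1) * V / A * B powr (- b - l) + B powr (- b - l) * V powr (l - 1) = B powr (- b - l) * V powr (l - 1) * (V / A + 1)"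
        by (simp add: algebra_simps)
      ultimately have "V powr (l - 1) * V / A * B powr (- b - l) + B powr (- b - l) * V powr (l - 1) = B powr (- b - l) * V powr (l - 1) * (B / A)"
        by (simp only:)
      then show ?thesis unfolding e3 using pos by simp
    qed
    have "c * B powr (- n / 2) * V powr (l - 1) + c * A powr (- b - 1) * (b * inc_Beta z l b + z powr l * (1 - z) powr b) =
      c * (b * A powr (- b - 1) * inc_Beta z l b + (A powr (- b - 1) * (z powr l * (1 - z) powr b) + B powr (- b - l) * V powr (l - 1)))"
      unfolding n_b by (simp add: algebra_simps)
    also have "\<dots> = c * (b * (1 / A powr (b + 1)) * inc_Beta z l b + V powr (l - 1) / (B powr (b + l - 1) * A))"
      unfolding e2 e4 unfolding e1 ..
    also have "\<dots> = balayage_density n l H v"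
      unfolding balayage_density_def c_def[symmetric] b_def[symmetric] z_def[symmetric] n_b(2) A_def B_def V_def
      by (simp only: add.commute[of v H])
    finally show ?thesis unfolding A_def B_def V_def .
  qed
  finally show ?thesis unfolding v_def n_def .
qed

text \<open>Rescaling \<open>[v, 1]\<close> to \<open>[0, 1]\<close> moves all layers outwards, where the layer density is smaller.\<close>

lemma disk_balayage_le:
  fixes y :: "'a::euclidean_space"
  assumes l: "0 < l" "l < 1" and H: "H > 0" and y: "(norm y)\<^sup>2 < 1"
  shows "disk_balayage l H y \<le> ennreal ((1 - (norm y)\<^sup>2) powr (l - 1)) * disk_balayage l H (0 :: 'a)"
proof -
  define n where "n = real DIM('a)"
  have n: "n > 0" by (simp add: n_def)
  define v where "v = (norm y)\<^sup>2"
  have v: "0 \<le> v" "1 - v > 0" using y by (auto simp: v_def)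
  let ?g = "\<lambda>w. ennreal (n / 2 * balayage_mass n l H w / (w + H))"
  have g_mono: "?g w' \<le> ?g w" if "0 < w" "w \<le> w'" for w w'
  proof -
    have "(w' + H) powr (- n / 2) \<le> (w + H) powr (- n / 2)" using that H n by (intro powr_mono2') auto
    then have "balayage_mass n l H w' \<le> balayage_mass n l H w"
      unfolding balayage_mass_def using n l by (intro mult_left_mono) (auto simp: Gamma_real_pos Beta_def)
    moreover have "0 \<le> balayage_mass n l H w" using n l by (rule balayage_mass_nonneg)
    ultimately show ?thesis using that H n by (intro ennreal_leI frac_le mult_left_mono) auto
  qed
  let ?F = "\<lambda>w. ?g w * ennreal ((w - v) powr (l - 1)) * indicator {v<..<1} w"
  have "(\<integral>\<^sup>+w. ?F w \<partial>lborel) = ennreal \<bar>1 - v\<bar> * (\<integral>\<^sup>+t. ?F (v + (1 - v) * t) \<partial>lborel)"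
    by (rule nn_integral_real_affine) (use v in auto)
  also have "\<dots> = (\<integral>\<^sup>+t. ennreal \<bar>1 - v\<bar> * ?F (v + (1 - v) * t) \<partial>lborel)"
    by (rule nn_integral_cmult[symmetric]) measurable
  also have "\<dots> \<le> (\<integral>\<^sup>+t. ennreal ((1 - v) powr (l - 1)) * (?g t * ennreal ((t - 0) powr (l - 1)) * indicator {0<..<1} t) \<partial>lborel)"
  proof (rule nn_integral_mono)
    fix t :: real
    show "ennreal \<bar>1 - v\<bar> * ?F (v + (1 - v) * t) \<le> ennreal ((1 - v) powr (l - 1)) * (?g t * ennreal ((t - 0) powr (l - 1)) * indicator {0<..<1} t)"
    proof (cases "t \<in> {0<..<1}")
      case True
      have "t \<le> v + (1 - v) * t"
        using True v mult_nonneg_nonneg[of v "1 - t"] by (simp add: algebra_simps)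
      then have g: "?g (v + (1 - v) * t) \<le> ?g t" using True by (intro g_mono) auto
      have "v + (1 - v) * t < v + (1 - v) * 1" using True v by (intro add_strict_left_mono mult_strict_left_mono) auto
      then have "ennreal \<bar>1 - v\<bar> * ?F (v + (1 - v) * t) = ennreal (1 - v) * (?g (v + (1 - v) * t) * ennreal (((1 - v) * t) powr (l - 1)))"
        using True v by simp
      \<comment> \<open>The Jacobian 1 - v is at most 1 and is dropped; the power of 1 - v coming
        from the layer itself is kept.\<close>
      also have "\<dots> \<le> 1 * (?g t * ennreal (((1 - v) * t) powr (l - 1)))"
        using v by (intro mult_mono g) auto
      also have "\<dots> = ennreal ((1 - v) powr (l - 1)) * (?g t * ennreal ((t - 0) powr (l - 1)) * indicator {0<..<1} t)"
        using True v by (simp add: powr_mult ennreal_mult mult_ac)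
      finally show ?thesis .
    next
      case False
      have "v + (1 - v) * t \<notin> {v<..<1}"
      proof
        assume "v + (1 - v) * t \<in> {v<..<1}"
        then have "v + (1 - v) * t < 1" "(1 - v) * t > 0" by simp_all
        then have "(1 - v) * t < (1 - v) * 1" by (simp only: mult_1_right less_diff_eq add.commute)
        have "t > 0" using \<open>(1 - v) * t > 0\<close> v(2) by (rule zero_less_mult_pos)
        moreover have "t < 1" using \<open>(1 - v) * t < (1 - v) * 1\<close> unfolding mult_less_cancel_left_pos[OF v(2)] .
        ultimately show False using False by simp
      qed
      then have "indicator {v<..<1} (v + (1 - v) * t) = (0 :: ennreal)" by (simp only: indicator_def of_bool_def if_False)
      then show ?thesis by (simp only: mult_zero_right zero_le)
    qed
  qed
  also have "\<dots> = ennreal ((1 - v) powr (l - 1)) * (\<integral>\<^sup>+t. ?g t * ennreal ((t - 0) powr (l - 1)) * indicator {0<..<1} t \<partial>lborel)"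
    by (rule nn_integral_cmult) measurable
  finally have le: "(\<integral>\<^sup>+w. ?F w \<partial>lborel) \<le> \<dots>" .
  have "disk_balayage l H y = ennreal (balayage_mass n l H 1) * ennreal ((1 - v) powr (l - 1)) + (\<integral>\<^sup>+w. ?F w \<partial>lborel)"
    unfolding n_def v_def by (rule disk_balayage_eq_layers[OF y])
  also have "\<dots> \<le> ennreal (balayage_mass n l H 1) * ennreal ((1 - v) powr (l - 1)) +
     ennreal ((1 - v) powr (l - 1)) * (\<integral>\<^sup>+t. ?g t * ennreal ((t - 0) powr (l - 1)) * indicator {0<..<1} t \<partial>lborel)"
    by (intro add_left_mono le)
  also have "\<dots> = ennreal ((1 - v) powr (l - 1)) * disk_balayage l H (0 :: 'a)"
    using disk_balayage_eq_layers[of "0 :: 'a" l H] by (simp add: n_def distrib_left mult.commute)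
  finally show ?thesis unfolding v_def .
qed


section \<open>Mass of the swept measure\<close>

lemma Beta_shift_left:
  assumes "a > 0" "b > (0::real)"
  shows "Beta (a + real k) b = Beta a b * (pochhammer a k / pochhammer (a + b) k)"
proof -
  have a: "a \<notin> \<int>\<^sub>\<le>\<^sub>0" "a + b \<notin> \<int>\<^sub>\<le>\<^sub>0" using assms by (auto dest: nonpos_Ints_nonpos)
  have pos: "Gamma a > 0" "Gamma (a + b) > 0" "Gamma (a + b + real k) > 0" using assms by (auto intro!: Gamma_real_pos)
  have "a + real k + b = a + b + real k" by simp
  then show ?thesis
    unfolding Beta_def pochhammer_Gamma[OF a(1)] pochhammer_Gamma[OF a(2)]
    using less_imp_neq[OF pos(1)] less_imp_neq[OF pos(2)] less_imp_neq[OF pos(3)] by (simp add: field_simps)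
qed

text \<open>Euler's integral, by expanding 1/(1 - x u) into a geometric series and integrating
  termwise. Bounding this factor by 1/(1 - x) shows that the integral is finite, which supplies the
  summability of the series.\<close>

lemma nn_integral_hyp2F1:
  assumes l: "l > 0" and m: "m > 0" and x: "0 \<le> x" "x < (1::real)"
  shows "(\<integral>\<^sup>+u\<in>{0<..<1}. ennreal (u powr (l - 1) * (1 - u) powr (m - 1) / (1 - x * u)) \<partial>lborel) =
    ennreal (Beta l m * hyp2F1 1 l (l + m) x)"
proof -
  have B: "Beta l m > 0" using l m by (simp add: Beta_def Gamma_real_pos)
  define b where "b k = pochhammer 1 k * pochhammer l k / pochhammer (l + m) k * (x ^ k / fact k)" for k
  have b_eq: "b k = x ^ k * (pochhammer l k / pochhammer (l + m) k)" for k
    by (simp add: b_def pochhammer_fact[symmetric])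
  have b_nn: "b k \<ge> 0" for k
    unfolding b_eq using l m x by (intro mult_nonneg_nonneg divide_nonneg_nonneg zero_le_power) (auto intro!: pochhammer_nonneg)
  let ?A = "\<lambda>u. u powr (l - 1) * (1 - u) powr (m - 1)"
  have xu: "0 \<le> x * u" "x * u \<le> x" "x * u < 1" if "0 < u" "u < 1" for u
    using that x mult_left_mono[of u 1 x] by auto
  have "(\<integral>\<^sup>+u\<in>{0<..<1}. ennreal (?A u / (1 - x * u)) \<partial>lborel) =
    (\<integral>\<^sup>+u. (\<Sum>k. ennreal (x ^ k) * (ennreal (u powr (l + real k - 1) * (1 - u) powr (m - 1)) * indicator {0<..<1} u)) \<partial>lborel)"
  proof (rule nn_integral_cong, goal_cases)
    case (1 u)
    show ?case
    proof (cases "u \<in> {0<..<1}")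
      case True
      then have u: "0 < u" "u < 1" by auto
      have "(\<lambda>k. ?A u * (x * u) ^ k) sums (?A u * (1 / (1 - x * u)))"
        using xu[OF u] by (intro sums_mult geometric_sums) auto
      then have "(\<Sum>k. ennreal (?A u * (x * u) ^ k)) = ennreal (?A u * (1 / (1 - x * u)))"
        using xu[OF u] by (intro suminf_ennreal_eq) auto
      moreover have "ennreal (?A u * (x * u) ^ k) = ennreal (x ^ k) * ennreal (u powr (l + real k - 1) * (1 - u) powr (m - 1))" for k
      proof -
        have "u powr (l + real k - 1) = u powr (l - 1) * u ^ k"
          using u by (simp add: powr_realpow[symmetric] powr_add[symmetric] algebra_simps)
        then show ?thesis using x u by (simp add: ennreal_mult[symmetric] power_mult_distrib mult_ac)
      qed
      ultimately show ?thesis using True by simp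
    qed simp
  qed
  also have "\<dots> = (\<Sum>k. (\<integral>\<^sup>+u. ennreal (x ^ k) * (ennreal (u powr (l + real k - 1) * (1 - u) powr (m - 1)) * indicator {0<..<1} u) \<partial>lborel))"
    by (rule nn_integral_suminf) measurable
  also have "\<dots> = (\<Sum>k. ennreal (Beta l m * b k))"
  proof (rule suminf_cong)
    fix k
    have "(\<integral>\<^sup>+u. ennreal (x ^ k) * (ennreal (u powr (l + real k - 1) * (1 - u) powr (m - 1)) * indicator {0<..<1} u) \<partial>lborel) =
      ennreal (x ^ k) * ennreal (Beta (l + real k) m)"
      using l m by (subst nn_integral_cmult, measurable, subst nn_integral_Beta) auto
    also have "\<dots> = ennreal (x ^ k * Beta (l + real k) m)"
      using x by (simp add: ennreal_mult')
    finally show "(\<integral>\<^sup>+u. ennreal (x ^ k) * (ennreal (u powr (l + real k - 1) * (1 - u) powr (m - 1)) * indicator {0<..<1} u) \<partial>lborel) = ennreal (Beta l m * b k)"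
      by (simp add: Beta_shift_left[OF l m] b_eq mult_ac)
  qed
  finally have eq: "(\<integral>\<^sup>+u\<in>{0<..<1}. ennreal (?A u / (1 - x * u)) \<partial>lborel) = (\<Sum>k. ennreal (Beta l m * b k))" .
  have "(\<integral>\<^sup>+u\<in>{0<..<1}. ennreal (?A u / (1 - x * u)) \<partial>lborel) \<le> (\<integral>\<^sup>+u. ennreal (1 / (1 - x)) * (ennreal (?A u) * indicator {0<..<1} u) \<partial>lborel)"
  proof (rule nn_integral_mono)
    fix u :: real
    show "ennreal (?A u / (1 - x * u)) * indicator {0<..<1} u \<le> ennreal (1 / (1 - x)) * (ennreal (?A u) * indicator {0<..<1} u)"
    proof (cases "u \<in> {0<..<1}")
      case True
      then have "?A u / (1 - x * u) \<le> ?A u / (1 - x)" using xu[of u] x by (intro divide_left_mono) auto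
      also have "\<dots> = 1 / (1 - x) * ?A u" by simp
      finally show ?thesis using True x by (simp add: ennreal_mult[symmetric] ennreal_leI)
    qed simp
  qed
  also have "\<dots> = ennreal (1 / (1 - x)) * ennreal (Beta l m)"
    using l m by (subst nn_integral_cmult, measurable, subst nn_integral_Beta) auto
  also have "\<dots> < top" by (simp add: ennreal_mult_less_top)
  finally have fin: "(\<Sum>k. ennreal (Beta l m * b k)) \<noteq> top" unfolding eq by simp
  have nn: "0 \<le> Beta l m * b k" for k using B b_nn by simp
  have summ: "summable (\<lambda>k. Beta l m * b k)" by (rule summable_suminf_not_top[OF nn fin])
  have "(\<Sum>k. ennreal (Beta l m * b k)) = ennreal (\<Sum>k. Beta l m * b k)" by (rule suminf_ennreal2[OF nn summ])
  also have "(\<Sum>k. Beta l m * b k) = Beta l m * (\<Sum>k. b k)"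
    using summ B by (intro suminf_mult) (simp add: summable_cmult_iff)
  finally show ?thesis unfolding eq hyp2F1_def b_def .
qed

text \<open>A negative value would force Euler's integral to be 0, because \<open>ennreal\<close>
  cuts it off, although that integral dominates the positive Beta integral.\<close>

lemma hyp2F1_nonneg:
  assumes "l > 0" "m > 0" "0 \<le> x" "x < (1::real)"
  shows "0 \<le> hyp2F1 1 l (l + m) x"
proof (rule ccontr)
  assume "\<not> 0 \<le> hyp2F1 1 l (l + m) x"
  moreover have "Beta l m > 0" using assms by (simp add: Beta_def Gamma_real_pos)
  ultimately have "Beta l m * hyp2F1 1 l (l + m) x \<le> 0" by (simp add: mult_nonneg_nonpos)
  then have "(\<integral>\<^sup>+u\<in>{0<..<1}. ennreal (u powr (l - 1) * (1 - u) powr (m - 1) / (1 - x * u)) \<partial>lborel) = 0"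
    unfolding nn_integral_hyp2F1[OF assms] by (simp add: ennreal_neg)
  moreover have "(\<integral>\<^sup>+u\<in>{0<..<1}. ennreal (u powr (l - 1) * (1 - u) powr (m - 1)) \<partial>lborel) \<le>
    (\<integral>\<^sup>+u\<in>{0<..<1}. ennreal (u powr (l - 1) * (1 - u) powr (m - 1) / (1 - x * u)) \<partial>lborel)"
  proof (rule nn_integral_mono)
    fix u :: real
    show "ennreal (u powr (l - 1) * (1 - u) powr (m - 1)) * indicator {0<..<1} u \<le>
      ennreal (u powr (l - 1) * (1 - u) powr (m - 1) / (1 - x * u)) * indicator {0<..<1} u"
    proof (cases "u \<in> {0<..<1}")
      case True
      then have "0 \<le> x * u" "x * u < 1" using assms mult_left_mono[of u 1 x] by auto
      then have "u powr (l - 1) * (1 - u) powr (m - 1) / 1 \<le> u powr (l - 1) * (1 - u) powr (m - 1) / (1 - x * u)"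
        by (intro divide_left_mono) auto
      then show ?thesis using True by (simp add: ennreal_leI)
    qed simp
  qed
  ultimately have "ennreal (Beta l m) \<le> 0" using assms by (simp add: nn_integral_Beta)
  then show False using \<open>Beta l m > 0\<close> by simp
qed

text \<open>The substitution v = t^2 produces the integral that occurs in c_{d,\<lambda>}.\<close>

lemma nn_integral_balayage_inc_Beta_part:
  assumes n: "n \<ge> 2" and b: "b > 0" and l: "l > 0" and H: "H > (0::real)"
  shows "(\<integral>\<^sup>+v\<in>{0<..<1}. ennreal (v powr (real n / 2 - 1) * (1 / (H + v) powr (b + 1) * inc_Beta ((1 - v) / (1 + H)) l b)) \<partial>lborel) =
    ennreal (2 * integral {0..1} (\<lambda>t. t ^ (n - 1) / (H + t\<^sup>2) powr (b + 1) * inc_Beta ((1 - t\<^sup>2) / (1 + H)) l b))"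
proof -
  let ?B = "\<lambda>v. inc_Beta ((1 - v) / (1 + H)) l b"
  let ?h = "\<lambda>t. t ^ (n - 1) / (H + t\<^sup>2) powr (b + 1) * ?B (t\<^sup>2)"
  have img: "(\<lambda>t. t\<^sup>2) ` {0<..<1} = {0::real<..<1}"
    by (rule image_eq_if_right_inverse[where k = sqrt]) (auto simp: power_less_one_iff)
  \<comment> \<open>\<open>borel_measurable_inc_Beta\<close> asks for arguments that are at most 1
    everywhere; truncating v at 0 ensures this and changes nothing on (0, 1).\<close>
  have [measurable]: "(\<lambda>v. ?B (max 0 v)) \<in> borel_measurable borel"
    by (rule borel_measurable_inc_Beta[OF l b]) (use H in \<open>auto simp: divide_le_eq\<close>)
  let ?f = "\<lambda>v. ennreal (v powr (real n / 2 - 1) * (1 / (H + v) powr (b + 1) * ?B (max 0 v)))"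
  have Bnn: "?B v \<ge> 0" if "0 \<le> v" for v using that H by (intro inc_Beta_nonneg l b) (simp add: divide_le_eq)
  have "(\<integral>\<^sup>+v\<in>{0<..<1}. ennreal (v powr (real n / 2 - 1) * (1 / (H + v) powr (b + 1) * ?B v)) \<partial>lborel) =
    (\<integral>\<^sup>+v\<in>(\<lambda>t. t\<^sup>2) ` {0<..<1}. ?f v \<partial>lborel)"
    unfolding img by (intro nn_integral_cong) (auto simp: indicator_def max_def)
  also have "\<dots> = (\<integral>\<^sup>+t\<in>{0<..<1}. ennreal \<bar>2 * t\<bar> * ?f (t\<^sup>2) \<partial>lborel)"
  proof (rule nn_integral_substitution_inj)
    show "inj_on (\<lambda>t::real. t\<^sup>2) {0<..<1}" by (auto simp: inj_on_def)
  qed (auto simp: img intro!: derivative_eq_intros)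
  also have "\<dots> = (\<integral>\<^sup>+t\<in>{0<..<1}. ennreal (2 * ?h t) \<partial>lborel)"
  proof (rule nn_integral_cong, goal_cases)
    case (1 t)
    show ?case
    proof (cases "t \<in> {0<..<1}")
      case True
      have "t\<^sup>2 powr (real n / 2 - 1) = t powr (real n - 2)"
      proof -
        have "t\<^sup>2 powr (real n / 2 - 1) = (t powr 2) powr (real n / 2 - 1)" using True by simp
        also have "\<dots> = t powr (real n - 2)" unfolding powr_powr by (simp add: algebra_simps)
        finally show ?thesis .
      qed
      moreover have "t * t powr (real n - 2) = t ^ (n - 1)"
      proof -
        have "t * t powr (real n - 2) = t powr (real (n - 1))"
          using True n powr_mult_base[of t "real n - 2"] by (simp add: of_nat_diff)
        then show ?thesis using True by (simp only: powr_realpow greaterThanLessThan_iff)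
      qed
      ultimately have "\<bar>2 * t\<bar> * (t\<^sup>2 powr (real n / 2 - 1) * (1 / (H + t\<^sup>2) powr (b + 1) * ?B (max 0 (t\<^sup>2)))) = 2 * ?h t"
        using True by (simp add: mult.assoc[symmetric])
      moreover have "ennreal \<bar>2 * t\<bar> * ?f (t\<^sup>2) = ennreal (\<bar>2 * t\<bar> * (t\<^sup>2 powr (real n / 2 - 1) * (1 / (H + t\<^sup>2) powr (b + 1) * ?B (max 0 (t\<^sup>2)))))"
        by (rule ennreal_mult'[symmetric]) simp
      ultimately show ?thesis by (simp only:)
    qed simp
  qed
  also have "\<dots> = ennreal (2 * integral {0..1} ?h)"
  proof (rule nn_integral_has_integral_lebesgue')
    show "0 \<le> 2 * ?h t" if "t \<in> {0<..<1}" for t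
      using that Bnn[of "t\<^sup>2"] by (intro mult_nonneg_nonneg divide_nonneg_nonneg) auto
    have "continuous_on {0..1} ?h"
    proof (intro continuous_intros continuous_on_compose2[OF continuous_on_inc_Beta[OF l b]])
      show "(\<lambda>t. (1 - t\<^sup>2) / (1 + H)) ` {0..1} \<subseteq> {0..1}"
      proof (rule image_subsetI)
        fix t :: real assume "t \<in> {0..1}"
        then have "0 \<le> t\<^sup>2" "t\<^sup>2 \<le> 1" by (auto simp: power_le_one)
        then have "0 \<le> 1 - t\<^sup>2" "1 - t\<^sup>2 \<le> 1 + H" using H by linarith+
        then show "(1 - t\<^sup>2) / (1 + H) \<in> {0..1}" using H by simp
      qed
      show "\<forall>t\<in>{0..1}. H + t\<^sup>2 \<noteq> 0" using H by (auto simp: add_pos_nonneg intro!: less_imp_neq[symmetric])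
      then show "\<forall>t\<in>{0..1}. (H + t\<^sup>2) powr (b + 1) \<noteq> 0" by auto
    qed (use H in auto)
    then have "?h integrable_on {0..1}" by (rule integrable_continuous_real)
    then have "((\<lambda>t. 2 * ?h t) has_integral 2 * integral {0..1} ?h) {0..1}"
      by (intro has_integral_mult_right integrable_integral)
    then show "((\<lambda>t. 2 * ?h t) has_integral 2 * integral {0..1} ?h) {0<..<1}"
      by (simp add: has_integral_Icc_iff_Ioo)
  qed
  finally show ?thesis .
qed

text \<open>Reflecting v = 1 - u gives H + v = (1 + H) (1 - u / (1 + H)), so Euler's integral
  appears at x = 1 / (1 + H). This is the hypergeometric term of c_{d,\<lambda>}.\<close>

lemma nn_integral_balayage_hyp2F1_part:
  assumes n: "n > 0" and l: "l > 0" and H: "H > (0::real)"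
  shows "(\<integral>\<^sup>+v\<in>{0<..<1}. ennreal (v powr (n / 2 - 1) * ((1 - v) powr (l - 1) / ((1 + H) powr (n / 2 - 1) * (H + v)))) \<partial>lborel) =
    ennreal (Beta l (n / 2) * (1 / (1 + H) powr (n / 2)) * hyp2F1 1 l (l + n / 2) (1 / (1 + H)))"
proof -
  let ?x = "1 / (1 + H)"
  let ?F = "\<lambda>v. ennreal (v powr (n / 2 - 1) * ((1 - v) powr (l - 1) / ((1 + H) powr (n / 2 - 1) * (H + v)))) * indicator {0<..<1} v"
  have "(\<integral>\<^sup>+v. ?F v \<partial>lborel) = ennreal \<bar>- 1\<bar> * (\<integral>\<^sup>+u. ?F (1 + (- 1) * u) \<partial>lborel)"
    by (rule nn_integral_real_affine) auto
  also have "\<dots> = (\<integral>\<^sup>+u. ennreal (1 / (1 + H) powr (n / 2)) * (ennreal (u powr (l - 1) * (1 - u) powr (n / 2 - 1) / (1 - ?x * u)) * indicator {0<..<1} u) \<partial>lborel)"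
    unfolding abs_minus_cancel abs_one ennreal_1 mult_1
  proof (rule nn_integral_cong, goal_cases)
    case (1 u)
    show ?case
    proof (cases "u \<in> {0<..<1}")
      case True
      define B where "B = 1 + H"
      have B: "B > 0" using H by (simp add: B_def)
      have Bu: "B - u > 0" using True H by (simp add: B_def)
      have 1: "1 - 1 / B * u = (B - u) / B" using B by (simp add: field_simps)
      have 2: "B powr (n / 2 - 1) = B powr (n / 2) / B" using B by (simp add: powr_diff)
      have "(1 - u) powr (n / 2 - 1) * (u powr (l - 1) / (B powr (n / 2 - 1) * (B - u))) =
        1 / B powr (n / 2) * (u powr (l - 1) * (1 - u) powr (n / 2 - 1) / (1 - 1 / B * u))"
        unfolding 1 2 using B Bu by (simp add: field_simps)
      moreover have "H + (1 + (- 1) * u) = B - u" "1 - (1 + (- 1) * u) = u" "1 + (- 1) * u = 1 - u" by (simp_all add: B_def)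
      ultimately have "(1 + (- 1) * u) powr (n / 2 - 1) * ((1 - (1 + (- 1) * u)) powr (l - 1) / ((1 + H) powr (n / 2 - 1) * (H + (1 + (- 1) * u)))) =
        1 / (1 + H) powr (n / 2) * (u powr (l - 1) * (1 - u) powr (n / 2 - 1) / (1 - ?x * u))"
        unfolding B_def[symmetric] by (simp only:)
      then have "ennreal ((1 + (- 1) * u) powr (n / 2 - 1) * ((1 - (1 + (- 1) * u)) powr (l - 1) / ((1 + H) powr (n / 2 - 1) * (H + (1 + (- 1) * u))))) =
        ennreal (1 / (1 + H) powr (n / 2)) * ennreal (u powr (l - 1) * (1 - u) powr (n / 2 - 1) / (1 - ?x * u))"
        by (simp only:) (rule ennreal_mult', simp)
      then show ?thesis using True by simp
    next
      case False
      then have "1 + (- 1) * u \<notin> {0<..<1}" by auto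
      then show ?thesis using False by simp
    qed
  qed
  also have "\<dots> = ennreal (1 / (1 + H) powr (n / 2)) * ennreal (Beta l (n / 2) * hyp2F1 1 l (l + n / 2) ?x)"
    by (subst nn_integral_cmult, measurable, subst nn_integral_hyp2F1) (use l n H in auto)
  also have "\<dots> = ennreal (Beta l (n / 2) * (1 / (1 + H) powr (n / 2)) * hyp2F1 1 l (l + n / 2) ?x)"
    by (subst ennreal_mult'[symmetric]) (simp_all add: mult_ac)
  finally show ?thesis .
qed

lemma Beta_reflection_real:
  assumes "0 < l" "l < (1::real)"
  shows "Beta l (1 - l) = pi / sin (l * pi)"
proof -
  have "complex_of_real (Gamma l * Gamma (1 - l)) = of_real (pi / sin (pi * l))"
  proof -
    have "Gamma (1 - complex_of_real l) = complex_of_real (Gamma (1 - l))"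
      using Gamma_complex_of_real[of "1 - l"] by simp
    moreover have "sin (complex_of_real pi * complex_of_real l) = complex_of_real (sin (pi * l))"
      using sin_of_real[of "pi * l"] by simp
    ultimately show ?thesis
      using Gamma_reflection_complex[of "complex_of_real l"]
      by (simp only: Gamma_complex_of_real of_real_mult of_real_divide)
  qed
  then have "Gamma l * Gamma (1 - l) = pi / sin (pi * l)" by (simp only: of_real_eq_iff)
  then show ?thesis by (simp add: Beta_def mult.commute)
qed

lemma c_const_eq:
  assumes d: "d \<ge> 3" and l: "0 < l" "l < 1" and h: "h > 0" and n: "n = d - 1"
  shows "c_const d l h = Gamma (real n / 2) / (pi powr (real n / 2) * Beta l (1 - l)) * (h\<^sup>2) powr (1 - l) *
    ((real n - 2 * l) / 2 * integral {0..1} (\<lambda>t. t ^ (n - 1) / (h\<^sup>2 + t\<^sup>2) powr ((real n - 2 * l) / 2 + 1) * inc_Beta ((1 - t\<^sup>2) / (1 + h\<^sup>2)) l ((real n - 2 * l) / 2))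
     + Beta l (real n / 2) / 2 * (1 / (1 + h\<^sup>2) powr (real n / 2)) * hyp2F1 1 l (l + real n / 2) (1 / (1 + h\<^sup>2)))"
proof -
  have nr: "real d = real n + 1" using d n by (simp add: of_nat_diff)
  have e: "real d - 1 = real n" "(real d + 1) / 2 = real n / 2 + 1" "real d - 2 * l - 1 = real n - 2 * l"
    "(real d - 2 * l + 1) / 2 = (real n - 2 * l) / 2 + 1" "(real d + 2 * l - 1) / 2 = l + real n / 2"
    by (simp_all add: nr field_simps)
  have e': "d - 2 = n - 1" using n by simp
  have s: "sin (l * pi) > 0" using l by (intro sin_gt_zero) auto
  have p: "pi powr (real n / 2 + 1) = pi powr (real n / 2) * pi" by (simp add: powr_add)
  have h2: "h powr (2 * (1 - l)) = (h\<^sup>2) powr (1 - l)"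
  proof -
    have "h\<^sup>2 = h powr 2" using h by simp
    then show ?thesis by (simp only: powr_powr)
  qed
  have K: "sin (l * pi) * Gamma (real n / 2) / pi powr (real n / 2 + 1) = Gamma (real n / 2) / (pi powr (real n / 2) * Beta l (1 - l))"
    unfolding Beta_reflection_real[OF l] p using s by simp
  have B: "Gamma l * Gamma (real n / 2) / (2 * Gamma (real n / 2 + l)) = Beta l (real n / 2) / 2"
    by (simp add: Beta_def add.commute)
  show ?thesis unfolding c_const_def e e' h2 K B ..
qed

text \<open>This identifies c_{d,\<lambda>}: it is the total mass of the swept unit charge divided
  by the area of the unit sphere. The two summands of the density give its two summands.\<close>

lemma nn_integral_disk_balayage:
  assumes d: "d \<ge> 3" and n: "DIM('a::euclidean_space) = d - 1" and l: "0 < l" "l < 1" and h: "h > 0"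
  shows "(\<integral>\<^sup>+y. disk_balayage l (h\<^sup>2) y \<partial>(lborel :: 'a measure)) =
    ennreal (2 * pi powr (real (d - 1) / 2) / Gamma (real (d - 1) / 2) * c_const d l h)"
proof -
  define n where "n = d - 1"
  define H where "H = h\<^sup>2"
  have H: "H > 0" using h by (simp add: H_def)
  have n2: "n \<ge> 2" "real DIM('a) = real n" using d \<open>DIM('a) = d - 1\<close> by (auto simp: n_def)
  define b where "b = (real n - 2 * l) / 2"
  have b: "b > 0" using l n2 by (simp add: b_def)
  define c where "c = half_sphere_area (real n)"
  define K where "K = Gamma (real n / 2) / (pi powr (real n / 2) * Beta l (1 - l)) * H powr (1 - l)"
  have c: "c \<ge> 0" using n2 by (simp add: c_def Gamma_real_pos)
  have K: "K \<ge> 0" using n2 l by (simp add: K_def Gamma_real_pos Beta_def)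
  let ?B = "\<lambda>v. inc_Beta ((1 - v) / (1 + H)) l b"
  define P where "P v = 1 / (H + v) powr (b + 1) * ?B v" for v
  define R where "R v = (1 - v) powr (l - 1) / ((1 + H) powr (real n / 2 - 1) * (H + v))" for v
  have dens: "balayage_density (real n) l H v = K * (b * P v + R v)" for v
    by (simp add: balayage_density_def K_def b_def P_def R_def mult.assoc)
  have [measurable]: "(\<lambda>v. ?B (max 0 v)) \<in> borel_measurable borel"
    by (rule borel_measurable_inc_Beta[OF l(1) b]) (use H in \<open>auto simp: divide_le_eq\<close>)
  have mP [measurable]: "(\<lambda>v. P (max 0 v)) \<in> borel_measurable borel" unfolding P_def by measurable
  have mR [measurable]: "(\<lambda>v. R (max 0 v)) \<in> borel_measurable borel" unfolding R_def by measurable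
  have P: "P v \<ge> 0" if "v \<ge> 0" for v
    unfolding P_def using that H by (intro mult_nonneg_nonneg inc_Beta_nonneg l b) (auto simp: divide_le_eq)
  have R: "R v \<ge> 0" if "v \<ge> 0" for v
    unfolding R_def using that H by (intro divide_nonneg_nonneg mult_nonneg_nonneg) auto
  let ?\<phi> = "\<lambda>v. if v < 1 then ennreal (K * (b * P (max 0 v) + R (max 0 v))) else 0"
  have "(\<integral>\<^sup>+y. disk_balayage l H y \<partial>(lborel :: 'a measure)) = (\<integral>\<^sup>+y. ?\<phi> ((norm y)\<^sup>2) \<partial>(lborel :: 'a measure))"
  proof (rule nn_integral_cong, goal_cases)
    case (1 y)
    show ?case
      using disk_balayage_eq_density[OF l _ H, of y] disk_balayage_outside[of y l H] n2
      by (auto simp: dens max_def)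
  qed
  also have "\<dots> = (\<integral>\<^sup>+v\<in>{0<..}. ennreal (c * v powr (real n / 2 - 1)) * ?\<phi> v \<partial>lborel)"
    unfolding c_def n2(2)[symmetric] by (rule nn_integral_radial) measurable
  also have "\<dots> = (\<integral>\<^sup>+v. ennreal (c * K * b) * (ennreal (v powr (real n / 2 - 1) * P (max 0 v)) * indicator {0<..<1} v) +
      ennreal (c * K) * (ennreal (v powr (real n / 2 - 1) * R (max 0 v)) * indicator {0<..<1} v) \<partial>lborel)"
  proof (rule nn_integral_cong, goal_cases)
    case (1 v)
    show ?case
    proof (cases "v \<in> {0<..<1}")
      case True
      have nn: "0 \<le> P (max 0 v)" "0 \<le> R (max 0 v)" by (auto intro: P R)
      have "ennreal (c * v powr (real n / 2 - 1)) * ennreal (K * (b * P (max 0 v) + R (max 0 v))) =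
        ennreal (c * v powr (real n / 2 - 1) * (K * (b * P (max 0 v) + R (max 0 v))))"
        using c by (intro ennreal_mult'[symmetric]) auto
      also have "c * v powr (real n / 2 - 1) * (K * (b * P (max 0 v) + R (max 0 v))) =
        c * K * b * (v powr (real n / 2 - 1) * P (max 0 v)) + c * K * (v powr (real n / 2 - 1) * R (max 0 v))"
        by (simp add: algebra_simps)
      also have "ennreal \<dots> = ennreal (c * K * b * (v powr (real n / 2 - 1) * P (max 0 v))) + ennreal (c * K * (v powr (real n / 2 - 1) * R (max 0 v)))"
        using c K b nn by (intro ennreal_plus) auto
      also have "\<dots> = ennreal (c * K * b) * ennreal (v powr (real n / 2 - 1) * P (max 0 v)) + ennreal (c * K) * ennreal (v powr (real n / 2 - 1) * R (max 0 v))"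
        using c K b by (intro arg_cong2[where f = "(+)"] ennreal_mult') auto
      finally show ?thesis using True by simp
    qed auto
  qed
  also have "\<dots> = ennreal (c * K * b) * (\<integral>\<^sup>+v\<in>{0<..<1}. ennreal (v powr (real n / 2 - 1) * P (max 0 v)) \<partial>lborel) +
      ennreal (c * K) * (\<integral>\<^sup>+v\<in>{0<..<1}. ennreal (v powr (real n / 2 - 1) * R (max 0 v)) \<partial>lborel)"
    by (subst nn_integral_add, measurable, subst (1 2) nn_integral_cmult) measurable
  also have "(\<integral>\<^sup>+v\<in>{0<..<1}. ennreal (v powr (real n / 2 - 1) * P (max 0 v)) \<partial>lborel) =
     (\<integral>\<^sup>+v\<in>{0<..<1}. ennreal (v powr (real n / 2 - 1) * P v) \<partial>lborel)"
    by (intro nn_integral_cong) (auto simp: indicator_def max_def)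
  also have "\<dots> = ennreal (2 * integral {0..1} (\<lambda>t. t ^ (n - 1) / (H + t\<^sup>2) powr (b + 1) * inc_Beta ((1 - t\<^sup>2) / (1 + H)) l b))"
    unfolding P_def by (rule nn_integral_balayage_inc_Beta_part[OF n2(1) b l(1) H])
  also have "(\<integral>\<^sup>+v\<in>{0<..<1}. ennreal (v powr (real n / 2 - 1) * R (max 0 v)) \<partial>lborel) =
     (\<integral>\<^sup>+v\<in>{0<..<1}. ennreal (v powr (real n / 2 - 1) * R v) \<partial>lborel)"
    by (intro nn_integral_cong) (auto simp: indicator_def max_def)
  also have "\<dots> = ennreal (Beta l (real n / 2) * (1 / (1 + H) powr (real n / 2)) * hyp2F1 1 l (l + real n / 2) (1 / (1 + H)))"
    unfolding R_def using n2 by (intro nn_integral_balayage_hyp2F1_part l H) simp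
  also have "ennreal (c * K * b) * ennreal (2 * integral {0..1} (\<lambda>t. t ^ (n - 1) / (H + t\<^sup>2) powr (b + 1) * inc_Beta ((1 - t\<^sup>2) / (1 + H)) l b)) +
      ennreal (c * K) * ennreal (Beta l (real n / 2) * (1 / (1 + H) powr (real n / 2)) * hyp2F1 1 l (l + real n / 2) (1 / (1 + H))) =
    ennreal (2 * c * c_const d l h)" (is "?c1 * ennreal (2 * ?I) + ?c2 * ennreal ?Y = _")
  proof -
    have Bnn: "inc_Beta ((1 - t\<^sup>2) / (1 + H)) l b \<ge> 0" for t
    proof -
      have "1 - t\<^sup>2 \<le> 1 + H" using H zero_le_power2[of t] by linarith
      then show ?thesis using H by (intro inc_Beta_nonneg l b) (simp add: divide_le_eq)
    qed
    \<comment> \<open>The function \<open>integral\<close> has value 0 where the integrand is not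
      integrable, so the sign is settled in either case.\<close>
    have I: "?I \<ge> 0"
    proof (cases "(\<lambda>t. t ^ (n - 1) / (H + t\<^sup>2) powr (b + 1) * inc_Beta ((1 - t\<^sup>2) / (1 + H)) l b) integrable_on {0..1}")
      case True
      then show ?thesis
        by (rule integral_nonneg) (intro mult_nonneg_nonneg divide_nonneg_nonneg Bnn, auto)
    qed (simp add: not_integrable_integral)
    have Y: "?Y \<ge> 0" using l n2 H hyp2F1_nonneg[of l "real n / 2" "1 / (1 + H)"]
      by (intro mult_nonneg_nonneg) (auto simp: Beta_def Gamma_real_pos)
    have comb: "?c1 * ennreal (2 * I) + ?c2 * ennreal Y = ennreal (c * K * b * (2 * I) + c * K * Y)"
      if "I \<ge> 0" "Y \<ge> 0" for I Y
      using c K b that by (simp add: ennreal_mult'[symmetric] ennreal_plus[symmetric] del: ennreal_plus)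
    have "?c1 * ennreal (2 * ?I) + ?c2 * ennreal ?Y = ennreal (c * K * b * (2 * ?I) + c * K * ?Y)"
      by (rule comb[OF I Y])
    also have "c * K * b * (2 * ?I) + c * K * ?Y = 2 * c * c_const d l h"
      unfolding c_const_eq[OF d l h n_def] H_def[symmetric] b_def[symmetric] K_def[symmetric]
      by (simp add: algebra_simps)
    finally show ?thesis .
  qed
  finally show ?thesis unfolding H_def c_def n_def by simp
qed



text \<open>The same mass from the layers. With p = s/2 the mass of E_w is proportional to w^p, that
  is, to the integral of p u^(p-1) over (0, w). After an exchange the layers enter through G(u), and
  the integral of u^(p-1) G(u) over (0, 1) is an incomplete Beta function; the constants collapse to
  1 / Beta(p, 1 - \<lambda>).\<close>

lemma nn_integral_disk_balayage_inc_Beta: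
  assumes n: "n = real DIM('a::euclidean_space)" and l: "0 < l" "l < 1" and s: "n - 2 + 2 * l > 0" and H: "H > 0"
  shows "(\<integral>\<^sup>+y. disk_balayage l H y \<partial>(lborel :: 'a measure)) =
    ennreal (inc_Beta (1 / (1 + H)) ((n - 2 + 2 * l) / 2) (1 - l) / Beta ((n - 2 + 2 * l) / 2) (1 - l))"
proof -
  have npos: "n > 0" using n by simp
  define p where "p = (n - 2 + 2 * l) / 2"
  have p: "p > 0" using s by (simp add: p_def)
  define m where "m = half_sphere_area n * Beta (n / 2) l"
  have m: "m \<ge> 0" using npos l by (simp add: m_def Gamma_real_pos Beta_def)
  define k where "k = Gamma (n / 2) / (pi powr (n / 2) * Beta l (1 - l))"
  have k: "k \<ge> 0" using npos l by (simp add: k_def Gamma_real_pos Beta_def)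
  let ?A = "ennreal (balayage_mass n l H 1)" and ?g = "\<lambda>w. ennreal (n / 2 * balayage_mass n l H w / (w + H))"
  have mass: "(\<integral>\<^sup>+y. ball_weight l w y \<partial>(lborel :: 'a measure)) = ennreal m * (\<integral>\<^sup>+u\<in>{0<..<w}. ennreal (p * u powr (p - 1)) \<partial>lborel)"
    if w: "w > 0" for w
  proof -
    have "(\<integral>\<^sup>+u\<in>{0<..<w}. ennreal (p * u powr (p - 1)) \<partial>lborel) = (\<integral>\<^sup>+u. ennreal p * (ennreal (u powr (p - 1)) * indicator {0<..<w} u) \<partial>lborel)"
      using p by (intro nn_integral_cong) (auto simp: ennreal_mult indicator_def)
    also have "\<dots> = ennreal p * ennreal (w powr p / p)"
      using p w by (subst nn_integral_cmult, measurable, subst nn_integral_powr_Ioo) auto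
    also have "\<dots> = ennreal (w powr p)" using p by (simp add: ennreal_mult[symmetric])
    finally have 1: "(\<integral>\<^sup>+u\<in>{0<..<w}. ennreal (p * u powr (p - 1)) \<partial>lborel) = ennreal (w powr p)" .
    have "n / 2 + l - 1 = p" by (simp add: p_def field_simps)
    then show ?thesis
      using nn_integral_ball_weight[OF l w, where 'a = 'a] m
      unfolding 1 n[symmetric] m_def[symmetric] by (simp add: ennreal_mult)
  qed
  have "(\<integral>\<^sup>+y. disk_balayage l H y \<partial>(lborel :: 'a measure)) =
    (\<integral>\<^sup>+y. ?A * ball_weight l 1 y \<partial>(lborel :: 'a measure)) +
    (\<integral>\<^sup>+y. (\<integral>\<^sup>+w. ?g w * indicator {0<..<1} w * ball_weight l w y \<partial>lborel) \<partial>(lborel :: 'a measure))"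
    unfolding disk_balayage_def n[symmetric] by (subst nn_integral_add) (measurable, simp only: mult_ac)
  also have "(\<integral>\<^sup>+y. (\<integral>\<^sup>+w. ?g w * indicator {0<..<1} w * ball_weight l w y \<partial>lborel) \<partial>(lborel :: 'a measure)) =
    (\<integral>\<^sup>+w. (\<integral>\<^sup>+y. ?g w * indicator {0<..<1} w * ball_weight l w y \<partial>(lborel :: 'a measure)) \<partial>lborel)"
    by (rule lborel_pair.Fubini') measurable
  also have "\<dots> = (\<integral>\<^sup>+w. (\<integral>\<^sup>+u. ennreal m * (ennreal (p * u powr (p - 1)) * indicator {0<..<1} u * (?g w * indicator {u<..<1} w)) \<partial>lborel) \<partial>lborel)"
  proof (rule nn_integral_cong, goal_cases)
    case (1 w)
    have "(\<integral>\<^sup>+y. ?g w * indicator {0<..<1} w * ball_weight l w y \<partial>(lborel :: 'a measure)) =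
      ?g w * indicator {0<..<1} w * (\<integral>\<^sup>+y. ball_weight l w y \<partial>(lborel :: 'a measure))"
      by (rule nn_integral_cmult) measurable
    also have "\<dots> = ?g w * indicator {0<..<1} w * (ennreal m * (\<integral>\<^sup>+u\<in>{0<..<w}. ennreal (p * u powr (p - 1)) \<partial>lborel))"
      by (cases "w > 0") (simp_all only: mass, simp)
    also have "\<dots> = (?g w * indicator {0<..<1} w * ennreal m) * (\<integral>\<^sup>+u\<in>{0<..<w}. ennreal (p * u powr (p - 1)) \<partial>lborel)"
      by (simp only: mult.assoc)
    also have "\<dots> = (\<integral>\<^sup>+u. (?g w * indicator {0<..<1} w * ennreal m) * (ennreal (p * u powr (p - 1)) * indicator {0<..<w} u) \<partial>lborel)"
      by (rule nn_integral_cmult[symmetric]) measurable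
    also have "\<dots> = (\<integral>\<^sup>+u. ennreal m * (ennreal (p * u powr (p - 1)) * indicator {0<..<1} u * (?g w * indicator {u<..<1} w)) \<partial>lborel)"
      by (intro nn_integral_cong) (auto simp: indicator_def mult_ac)
    finally show ?case .
  qed
  also have "\<dots> = (\<integral>\<^sup>+u. (\<integral>\<^sup>+w. ennreal m * (ennreal (p * u powr (p - 1)) * indicator {0<..<1} u * (?g w * indicator {u<..<1} w)) \<partial>lborel) \<partial>lborel)"
    by (rule lborel_pair.Fubini') (simp add: indicator_def)
  also have "\<dots> = (\<integral>\<^sup>+u. ennreal m * (ennreal (p * u powr (p - 1)) * indicator {0<..<1} u * (\<integral>\<^sup>+w\<in>{u<..<1}. ?g w \<partial>lborel)) \<partial>lborel)"
  proof (rule nn_integral_cong, goal_cases)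
    case (1 u)
    have "(\<integral>\<^sup>+w. (ennreal m * (ennreal (p * u powr (p - 1)) * indicator {0<..<1} u)) * (?g w * indicator {u<..<1} w) \<partial>lborel) =
      (ennreal m * (ennreal (p * u powr (p - 1)) * indicator {0<..<1} u)) * (\<integral>\<^sup>+w\<in>{u<..<1}. ?g w \<partial>lborel)"
      by (rule nn_integral_cmult) measurable
    then show ?case
      by (simp only: mult.assoc)
  qed
  also have "(\<integral>\<^sup>+y. ?A * ball_weight l 1 y \<partial>(lborel :: 'a measure)) =
    (\<integral>\<^sup>+u. ennreal m * (ennreal (p * u powr (p - 1)) * indicator {0<..<1} u * ?A) \<partial>lborel)"
    by (subst nn_integral_cmult, measurable, subst mass, simp, subst nn_integral_cmult[symmetric], measurable,
        subst nn_integral_cmult[symmetric], measurable) (simp only: mult_ac)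
  finally have 1: "(\<integral>\<^sup>+y. disk_balayage l H y \<partial>(lborel :: 'a measure)) =
    (\<integral>\<^sup>+u. ennreal m * (ennreal (p * u powr (p - 1)) * indicator {0<..<1} u * ?A) \<partial>lborel) +
    (\<integral>\<^sup>+u. ennreal m * (ennreal (p * u powr (p - 1)) * indicator {0<..<1} u * (\<integral>\<^sup>+w\<in>{u<..<1}. ?g w \<partial>lborel)) \<partial>lborel)" .
  have [measurable]: "(\<lambda>u. \<integral>\<^sup>+w\<in>{u<..<1}. ?g w \<partial>lborel) \<in> borel_measurable borel"
    unfolding indicator_def greaterThanLessThan_iff by measurable
  have "(\<integral>\<^sup>+y. disk_balayage l H y \<partial>(lborel :: 'a measure)) =
    (\<integral>\<^sup>+u. ennreal m * (ennreal (p * u powr (p - 1)) * indicator {0<..<1} u * ?A) +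
      ennreal m * (ennreal (p * u powr (p - 1)) * indicator {0<..<1} u * (\<integral>\<^sup>+w\<in>{u<..<1}. ?g w \<partial>lborel)) \<partial>lborel)"
    unfolding 1 by (rule nn_integral_add[symmetric]) measurable
  also have "\<dots> = (\<integral>\<^sup>+u. ennreal (m * p * (k * H powr (1 - l))) *
     (ennreal ((u - 0) powr (p - 1) * (u + H) powr (- (n - 2) / 2 - 1)) * indicator {0<..<1} u) \<partial>lborel)"
  proof (rule nn_integral_cong, goal_cases)
    case (1 u)
    show ?case
    proof (cases "u \<in> {0<..<1}")
      case True
      then have u: "0 \<le> u" "u \<le> 1" by auto
      have e: "- (n - 2) / 2 - 1 = - n / 2" by (simp add: field_simps)
      have "ennreal m * (ennreal (p * u powr (p - 1)) * ?A) + ennreal m * (ennreal (p * u powr (p - 1)) * (\<integral>\<^sup>+w\<in>{u<..<1}. ?g w \<partial>lborel)) =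
        ennreal m * (ennreal (p * u powr (p - 1)) * ennreal (balayage_mass n l H u))"
        unfolding balayage_mass_layers[OF l npos H u, symmetric] by (simp only: distrib_left)
      also have "\<dots> = ennreal (m * (p * u powr (p - 1) * balayage_mass n l H u))"
        using m p by (simp add: ennreal_mult')
      also have "m * (p * u powr (p - 1) * balayage_mass n l H u) =
        (m * p * (k * H powr (1 - l))) * (u powr (p - 1) * (u + H) powr (- n / 2))"
        by (simp add: balayage_mass_def k_def)
      also have "ennreal \<dots> = ennreal (m * p * (k * H powr (1 - l))) * ennreal (u powr (p - 1) * (u + H) powr (- n / 2))"
        using m p k by (intro ennreal_mult') simp
      finally show ?thesis using True unfolding e by simp
    qed simp
  qed
  \<comment> \<open>\<open>nn_integral_layers\<close> is reused with p in place of \<lambda>, n - 2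
    in place of n, and v = 0.\<close>
  also have "\<dots> = ennreal (m * p * (k * H powr (1 - l))) *
      ennreal ((0 + H) powr (- ((n - 2 - 2 * p) / 2) - 1) * inc_Beta ((1 - 0) / (1 + H)) p ((n - 2 - 2 * p) / 2 + 1))"
  proof -
    have b: "(n - 2 - 2 * p) / 2 + 1 > 0" using l by (simp add: p_def field_simps)
    show ?thesis
      by (subst nn_integral_cmult, measurable, subst nn_integral_layers[OF p b H]) auto
  qed
  also have "(n - 2 - 2 * p) / 2 = - l" by (simp add: p_def field_simps)
  also have "ennreal (m * p * (k * H powr (1 - l))) * ennreal ((0 + H) powr (- (- l) - 1) * inc_Beta ((1 - 0) / (1 + H)) p (- l + 1)) =
    ennreal (m * p * (k * H powr (1 - l)) * ((0 + H) powr (- (- l) - 1) * inc_Beta ((1 - 0) / (1 + H)) p (- l + 1)))"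
    using m p k by (intro ennreal_mult'[symmetric]) simp
  also have "m * p * (k * H powr (1 - l)) * ((0 + H) powr (- (- l) - 1) * inc_Beta ((1 - 0) / (1 + H)) p (- l + 1)) =
    (H powr (1 - l) * H powr (l - 1)) * (m * p * k) * inc_Beta (1 / (1 + H)) p (1 - l)"
    by simp
  also have "H powr (1 - l) * H powr (l - 1) = 1" using H by (simp add: powr_add[symmetric])
  also have "m * p * k = 1 / Beta p (1 - l)"
  proof -
    have pos: "Gamma (n / 2) > 0" "Beta l (1 - l) > 0" "Beta p (1 - l) > 0"
      using npos l p by (auto simp: Gamma_real_pos Beta_def)
    have "m * p * k = (half_sphere_area n) * (Gamma (n / 2) / pi powr (n / 2)) * (Beta (n / 2) l * p) / Beta l (1 - l)"
      by (simp add: m_def k_def)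
    also have "\<dots> = Beta (n / 2) l * p / Beta l (1 - l)"
      using less_imp_neq[OF pos(1)] by simp
    also have "\<dots> = Beta (n / 2) l * p / (Beta (n / 2) l * p * Beta p (1 - l))"
      using Beta_dimension_identity[OF l s npos] by (simp add: p_def)
    also have "\<dots> = 1 / Beta p (1 - l)"
    proof -
      have "Beta (n / 2) l > 0" using npos l by (simp add: Beta_def Gamma_real_pos)
      then have "Beta (n / 2) l * p \<noteq> 0" using less_imp_neq[OF mult_pos_pos[OF _ p], symmetric] by blast
      then show ?thesis by simp
    qed
    finally show ?thesis .
  qed
  finally show ?thesis by (simp add: p_def)
qed

text \<open>The two mass computations compared. On the right h occurs only in the upper limit of an
  incomplete Beta function, whereas the definition of c_{d,\<lambda>} has it under an integral and
  in a series. Nonnegativity of c_{d,\<lambda>} allows \<open>ennreal\<close> to be removed.\<close>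

lemma c_const_eq_inc_Beta:
  assumes d: "d \<ge> 3" "DIM('a::euclidean_space) = d - 1" and l: "0 < l" "l < 1" and h: "h > 0" and c: "0 \<le> c_const d l h"
  shows "2 * pi powr (real (d - 1) / 2) / Gamma (real (d - 1) / 2) * c_const d l h =
    inc_Beta (1 / (1 + h\<^sup>2)) ((real d - 3 + 2 * l) / 2) (1 - l) / Beta ((real d - 3 + 2 * l) / 2) (1 - l)"
proof -
  let ?p = "(real d - 3 + 2 * l) / 2"
  have e: "real (d - 1) - 2 + 2 * l = real d - 3 + 2 * l" using d by (simp add: of_nat_diff)
  have p: "?p > 0" using d l by simp
  have "ennreal (2 * pi powr (real (d - 1) / 2) / Gamma (real (d - 1) / 2) * c_const d l h) =
    ennreal (inc_Beta (1 / (1 + h\<^sup>2)) ?p (1 - l) / Beta ?p (1 - l))"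
    using nn_integral_disk_balayage[OF d l h] nn_integral_disk_balayage_inc_Beta[of "real (d - 1)" l "h\<^sup>2", where 'a = 'a] d l h
    unfolding e by simp
  moreover have "0 \<le> 2 * pi powr (real (d - 1) / 2) / Gamma (real (d - 1) / 2) * c_const d l h"
    using c d by (intro mult_nonneg_nonneg divide_nonneg_nonneg) (auto simp: Gamma_real_pos less_imp_le)
  moreover have "0 \<le> inc_Beta (1 / (1 + h\<^sup>2)) ?p (1 - l) / Beta ?p (1 - l)"
  proof -
    have "Beta p (1 - l) > 0" if "p > 0" for p using that l by (simp add: Beta_def Gamma_real_pos)
    moreover have "1 / (1 + h\<^sup>2) \<le> 1" using zero_le_power2[of h] by (subst divide_le_eq_1_pos) linarith+
    ultimately show ?thesis using p l by (intro divide_nonneg_nonneg inc_Beta_nonneg less_imp_le[of 0 "Beta _ _"]) simp_all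
  qed
  ultimately show ?thesis by simp
qed

lemma c_const_nonneg:
  assumes d: "d \<ge> 3" and l: "0 < l" "l < 1" and h: "h > 0"
  shows "0 \<le> c_const d l h"
proof -
  define n where "n = d - 1"
  have n: "real n \<ge> 2" using d by (simp add: n_def)
  let ?b = "(real n - 2 * l) / 2"
  have b: "?b > 0" using n l by simp
  have I: "0 \<le> integral {0..1} (\<lambda>t. t ^ (n - 1) / (h\<^sup>2 + t\<^sup>2) powr (?b + 1) * inc_Beta ((1 - t\<^sup>2) / (1 + h\<^sup>2)) l ?b)" (is "0 \<le> integral _ ?f")
  proof (cases "?f integrable_on {0..1}")
    case True
    have le: "(1 - t\<^sup>2) / (1 + h\<^sup>2) \<le> 1" for t :: real
    proof -
      have "1 - t\<^sup>2 \<le> 1 + h\<^sup>2" using zero_le_power2[of t] zero_le_power2[of h] by linarith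
      then show ?thesis by (simp add: divide_le_eq add_pos_nonneg)
    qed
    show ?thesis
      by (rule integral_nonneg[OF True]) (intro mult_nonneg_nonneg divide_nonneg_nonneg inc_Beta_nonneg l b le, auto)
  qed (simp add: not_integrable_integral)
  have "0 < h\<^sup>2" using h by simp
  then have x: "1 / (1 + h\<^sup>2) < 1" "0 \<le> 1 / (1 + h\<^sup>2)"
    by (subst divide_less_eq_1_pos; linarith) simp
  have "0 \<le> hyp2F1 1 l (l + real n / 2) (1 / (1 + h\<^sup>2))"
    using x l n by (intro hyp2F1_nonneg) auto
  moreover have "0 \<le> Beta l (real n / 2)" "0 \<le> Gamma (real n / 2) / (pi powr (real n / 2) * Beta l (1 - l))"
    using l n by (auto simp: Beta_def Gamma_real_pos less_imp_le)
  ultimately show ?thesis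
    unfolding c_const_eq[OF d l h n_def] using I b
    by (intro mult_nonneg_nonneg add_nonneg_nonneg) auto
qed

section \<open>Dictionary between the functions of the statement and the swept charge\<close>

lemma balayage_prefactor:
  assumes d: "d \<ge> 3" and l: "0 < l" "l < 1" and h: "h > 0"
  shows "sin (l * pi) * Gamma ((real d - 1) / 2) / pi powr ((real d + 1) / 2) * h powr (2 * (1 - l)) =
    Gamma ((real d - 1) / 2) / (pi powr ((real d - 1) / 2) * Beta l (1 - l)) * (h\<^sup>2) powr (1 - l)"
proof -
  have e: "(real d + 1) / 2 = (real d - 1) / 2 + 1" by (simp add: field_simps)
  have p: "pi powr ((real d - 1) / 2 + 1) = pi powr ((real d - 1) / 2) * pi" by (simp add: powr_add)
  have h2: "h powr (2 * (1 - l)) = (h\<^sup>2) powr (1 - l)"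
  proof -
    have "h\<^sup>2 = h powr 2" using h by simp
    then show ?thesis by (simp only: powr_powr)
  qed
  show ?thesis unfolding e p h2 Beta_reflection_real[OF l] by simp
qed

lemma F_fun_eq:
  assumes d: "d \<ge> 3" and l: "0 < l" "l < 1" and h: "h > 0"
  shows "F_fun d l q h r = - q * balayage_density (real d - 1) l (h\<^sup>2) (r\<^sup>2)"
proof -
  have e: "real d - 2 * l - 1 = real d - 1 - 2 * l" "(real d - 2 * l + 1) / 2 = (real d - 1 - 2 * l) / 2 + 1"
    "(real d - 3) / 2 = (real d - 1) / 2 - 1" by (simp_all add: field_simps)
  show ?thesis
    unfolding F_fun_def balayage_density_def balayage_prefactor[OF d l h, symmetric] e
    by simp
qed

text \<open>The right-hand side is C_Q + F(0), the value of f at the centre of the disk.\<close>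

lemma p_fun_eq:
  assumes d: "d \<ge> 3" and l: "0 < l" "l < 1" and h: "h > 0"
  shows "p_fun d l q h = C_const d l q h - q * balayage_density (real d - 1) l (h\<^sup>2) 0"
proof -
  define n where "n = real d - 1"
  define b where "b = (n - 2 * l) / 2"
  define A where "A = sin (l * pi) * Gamma (n / 2) / pi powr ((real d + 1) / 2)"
  define I where "I = inc_Beta (1 / (1 + h\<^sup>2)) l b"
  define B where "B = (1 + h\<^sup>2) powr (n / 2 - 1)"
  have e: "(real d - 2 * l - 1) / 2 = b" "(real d - 3) / 2 = n / 2 - 1"
    by (simp_all add: b_def n_def field_simps)
  have hp: "(h\<^sup>2) powr x = h powr (2 * x)" for x
  proof -
    have "h\<^sup>2 = h powr 2" using h by simp
    then show ?thesis by (simp only: powr_powr)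
  qed
  have h1: "h powr (2 * (1 - l)) * (1 / (h\<^sup>2) powr (b + 1)) = 1 / h ^ (d - 1)"
  proof -
    have "h powr (2 * (1 - l)) * (1 / (h\<^sup>2) powr (b + 1)) = h powr (2 * (1 - l) - 2 * (b + 1))"
    proof -
      have "h powr x * (1 / h powr y) = h powr (x - y)" for x y by (simp add: powr_diff)
      then show ?thesis unfolding hp .
    qed
    also have "2 * (1 - l) - 2 * (b + 1) = - real (d - 1)" using d by (simp add: b_def n_def of_nat_diff field_simps)
    also have "h powr (- real (d - 1)) = 1 / h ^ (d - 1)"
      using h by (simp only: powr_minus_divide powr_realpow)
    finally show ?thesis .
  qed
  have h2: "h powr (2 * (1 - l)) / h\<^sup>2 = 1 / h powr (2 * l)"
  proof -
    have "h powr (2 * (1 - l)) = h powr 2 / h powr (2 * l)" by (simp add: powr_diff[symmetric] algebra_simps)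
    then show ?thesis using h by simp
  qed
  have "balayage_density n l (h\<^sup>2) 0 = A * h powr (2 * (1 - l)) *
    (b * (1 / (h\<^sup>2) powr (b + 1)) * I + 1 / (B * h\<^sup>2))"
    using balayage_prefactor[OF d l h]
    by (simp add: balayage_density_def n_def[symmetric] A_def b_def I_def B_def)
  also have "\<dots> = A * (b * (h powr (2 * (1 - l)) * (1 / (h\<^sup>2) powr (b + 1))) * I + (h powr (2 * (1 - l)) / h\<^sup>2) / B)"
    by (simp add: algebra_simps)
  also have "\<dots> = A * (b * (1 / h ^ (d - 1)) * I + 1 / (h powr (2 * l) * B))"
    unfolding h1 h2 by simp
  finally have bd: "balayage_density (real d - 1) l (h\<^sup>2) 0 = A * (b * (1 / h ^ (d - 1)) * I + 1 / (h powr (2 * l) * B))"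
    by (simp only: n_def)
  show ?thesis
    unfolding bd p_fun_def C_const_def e
    by (simp add: A_def I_def B_def n_def)
qed


section \<open>Positivity of the density and the main theorem\<close>

lemma inc_Beta_mono:
  assumes "a > 0" "b > 0" "z \<le> (1::real)"
  shows "inc_Beta z a b \<le> inc_Beta 1 a b"
  unfolding inc_Beta_def using assms
  by (intro integral_subset_le inc_Beta_integrable) auto

text \<open>The one summand whose continuity is not immediate is c_{d,\<lambda>}, which
  \<open>c_const_eq_inc_Beta\<close> replaces by an incomplete Beta function. The type
  \<open>'a\<close> supplies the space of dimension d - 1 in which the two masses are
  compared.\<close>

lemma continuous_on_p_fun:
  assumes d: "d \<ge> 3" "DIM('a::euclidean_space) = d - 1" and l: "0 < l" "l < 1" and h: "h\<^sub>1 > 0"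
  shows "continuous_on {h\<^sub>1..h\<^sub>2} (p_fun d l q)"
proof -
  let ?S = "{h\<^sub>1..h\<^sub>2}"
  have pos: "x > 0" if "x \<in> ?S" for x using that h by simp
  let ?p = "(real d - 3 + 2 * l) / 2" and ?b = "(real d - 2 * l - 1) / 2"
  have p: "?p > 0" and b: "?b > 0" using d l by simp_all
  define W where "W = 2 * pi powr (real (d - 1) / 2) / Gamma (real (d - 1) / 2)"
  have W: "W > 0" using d by (simp add: W_def Gamma_real_pos)
  have inc: "continuous_on ?S (\<lambda>x. inc_Beta (1 / (1 + x\<^sup>2)) a b')" if "a > 0" "b' > 0" for a b'
  proof (rule continuous_on_compose2[OF continuous_on_inc_Beta[OF that]])
    show "continuous_on ?S (\<lambda>x. 1 / (1 + x\<^sup>2))"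
      by (intro continuous_intros) (auto simp: add_nonneg_eq_0_iff)
    show "(\<lambda>x. 1 / (1 + x\<^sup>2)) ` ?S \<subseteq> {0..1}"
    proof (rule image_subsetI)
      fix x :: real
      have "0 \<le> x\<^sup>2" by simp
      then have "1 / (1 + x\<^sup>2) \<le> 1" by (subst divide_le_eq_1_pos) linarith+
      moreover have "0 \<le> 1 / (1 + x\<^sup>2)" by simp
      ultimately show "1 / (1 + x\<^sup>2) \<in> {0..1}" by (simp only: atLeastAtMost_iff simp_thms)
    qed
  qed
  have c_cont: "continuous_on ?S (c_const d l)"
  proof (rule continuous_on_eq)
    show "continuous_on ?S (\<lambda>x. inc_Beta (1 / (1 + x\<^sup>2)) ?p (1 - l) * (1 / (Beta ?p (1 - l) * W)))"
      using p l by (intro continuous_on_mult[OF inc continuous_on_const]) simp_all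
    fix x assume "x \<in> ?S"
    then have "W * c_const d l x = inc_Beta (1 / (1 + x\<^sup>2)) ?p (1 - l) / Beta ?p (1 - l)"
      unfolding W_def using pos d(1) l by (intro c_const_eq_inc_Beta[OF d l] c_const_nonneg) auto
    moreover have "c_const d l x = W * c_const d l x / W" using W by simp
    ultimately have "c_const d l x = (inc_Beta (1 / (1 + x\<^sup>2)) ?p (1 - l) / Beta ?p (1 - l)) / W"
      by (simp only:)
    also have "\<dots> = inc_Beta (1 / (1 + x\<^sup>2)) ?p (1 - l) * (1 / (Beta ?p (1 - l) * W))" by simp
    finally show "inc_Beta (1 / (1 + x\<^sup>2)) ?p (1 - l) * (1 / (Beta ?p (1 - l) * W)) = c_const d l x" ..

  qed
  have nz: "x \<noteq> 0" if "x \<in> ?S" for x using pos[OF that] by simp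
  have nz2: "1 + x\<^sup>2 \<noteq> (0::real)" for x
  proof -
    have "0 \<le> x\<^sup>2" by simp
    then show ?thesis by linarith
  qed
  have c2: "continuous_on ?S (\<lambda>x. 1 / x ^ (d - 1))"
    by (intro continuous_on_divide continuous_on_const continuous_on_power continuous_on_id) (simp add: nz)
  have "continuous_on ?S (\<lambda>x. x powr (2 * l) * (1 + x\<^sup>2) powr ((real d - 3) / 2))"
    by (intro continuous_on_mult continuous_on_powr continuous_on_add continuous_on_power continuous_on_id continuous_on_const)
       (use nz nz2 in blast)+
  then have c3: "continuous_on ?S (\<lambda>x. 1 / (x powr (2 * l) * (1 + x\<^sup>2) powr ((real d - 3) / 2)))"
    by (intro continuous_on_divide continuous_on_const) (simp_all add: nz nz2)
  note c4 = continuous_on_mult[OF continuous_on_mult[OF continuous_on_const c2] inc[OF l(1) b]]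
  show ?thesis
    unfolding p_fun_def
    by (rule continuous_on_diff[OF
          continuous_on_mult[OF continuous_on_const continuous_on_add[OF continuous_on_const continuous_on_mult[OF continuous_on_const c_cont]]]
          continuous_on_mult[OF continuous_on_const continuous_on_add[OF c4 c3]]])
qed

text \<open>A nonpositive value beyond the largest root would, by the intermediate value theorem,
  produce a further root, because p is positive far out.\<close>

lemma p_fun_pos:
  assumes d: "d \<ge> 3" "DIM('a::euclidean_space) = d - 1" and l: "0 < l" "l < 1" and q: "q > 0"
    and root: "is_largest_positive_root (p_fun d l q) h\<^sub>0" and h: "h > h\<^sub>0"
  shows "p_fun d l q h > 0"
proof (rule ccontr)
  assume "\<not> p_fun d l q h > 0"
  then have neg: "p_fun d l q h \<le> 0" by simp
  have h0: "h\<^sub>0 > 0" and max: "\<And>y. y > 0 \<Longrightarrow> p_fun d l q y = 0 \<Longrightarrow> y \<le> h\<^sub>0"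
    using root by (auto simp: is_largest_positive_root_def)
  let ?b = "(real d - 2 * l - 1) / 2"
  have b: "?b > 0" using d l by simp
  define k where "k = 2 * Gamma ((real d - 1) / 2 + l) / (Gamma l * Gamma ((real d - 1) / 2))"
  define k' where "k' = Gamma ((real d - 1) / 2) / (2 * pi powr ((real d - 1) / 2))"
  define A where "A = q * sin (l * pi) * Gamma ((real d - 1) / 2) / pi powr ((real d + 1) / 2)"
  define M where "M = inc_Beta 1 l ?b"
  have G: "Gamma ((real d - 1) / 2) > 0" "Gamma l > 0" "Gamma ((real d - 1) / 2 + l) > 0"
  proof -
    have "real d \<ge> 3" using d by simp
    then show "Gamma ((real d - 1) / 2) > 0" "Gamma l > 0" "Gamma ((real d - 1) / 2 + l) > 0"
      using l by (auto intro!: Gamma_real_pos add_nonneg_pos)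
  qed
  have k: "k > 0" "k' > 0" unfolding k_def k'_def using G by (auto intro!: divide_pos_pos mult_pos_pos)
  have s: "sin (l * pi) > 0" using l by (intro sin_gt_zero) auto
  have A: "A \<ge> 0" unfolding A_def using q s G(1) by (intro divide_nonneg_nonneg mult_nonneg_nonneg) auto
  \<comment> \<open>A lower bound for p on y \<ge> 1: the nonnegative contribution of
    c_{d,\<lambda>} is dropped, the incomplete Beta function is replaced by its complete value, and
    the power of 1 + y^2 in the denominator by 1. As y tends to infinity, only k k' > 0
    survives.\<close>
  define U where "U y = k * k' - A * (?b * (1 / y ^ (d - 1)) * M + y powr (- (2 * l)))" for y
  have lower: "U y \<le> p_fun d l q y" if y: "y \<ge> 1" for y
  proof -
    have y0: "y > 0" using y by simp
    have "0 \<le> k * (q * c_const d l y)"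
      using k q c_const_nonneg[OF d(1) l y0] by simp
    then have 1: "k * k' \<le> k * (k' + q * c_const d l y)" by (simp add: distrib_left)
    have "1 / (1 + y\<^sup>2) \<le> 1" using zero_le_power2[of y] by (subst divide_le_eq_1_pos) linarith+
    then have "inc_Beta (1 / (1 + y\<^sup>2)) l ?b \<le> M" unfolding M_def by (intro inc_Beta_mono l b)
    then have 2: "?b * (1 / y ^ (d - 1)) * inc_Beta (1 / (1 + y\<^sup>2)) l ?b \<le> ?b * (1 / y ^ (d - 1)) * M"
      using b y0 by (intro mult_left_mono) auto
    have "1 \<le> (1 + y\<^sup>2) powr ((real d - 3) / 2)"
      using d by (intro ge_one_powr_ge_zero) auto
    then have "y powr (2 * l) * 1 \<le> y powr (2 * l) * (1 + y\<^sup>2) powr ((real d - 3) / 2)"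
      by (intro mult_left_mono) auto
    then have "1 / (y powr (2 * l) * (1 + y\<^sup>2) powr ((real d - 3) / 2)) \<le> 1 / (y powr (2 * l))"
      using y0 less_le_trans[OF zero_less_one \<open>1 \<le> (1 + y\<^sup>2) powr ((real d - 3) / 2)\<close>]
      by (intro divide_left_mono mult_pos_pos) simp_all
    then have 3: "1 / (y powr (2 * l) * (1 + y\<^sup>2) powr ((real d - 3) / 2)) \<le> y powr (- (2 * l))"
      by (simp add: powr_minus_divide)
    have "A * (?b * (1 / y ^ (d - 1)) * inc_Beta (1 / (1 + y\<^sup>2)) l ?b + 1 / (y powr (2 * l) * (1 + y\<^sup>2) powr ((real d - 3) / 2)))
      \<le> A * (?b * (1 / y ^ (d - 1)) * M + y powr (- (2 * l)))"
      using A by (intro mult_left_mono add_mono 2 3)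
    then show ?thesis
      unfolding U_def p_fun_def k_def[symmetric] k'_def[symmetric] A_def[symmetric] using 1 by linarith
  qed
  have "(U \<longlongrightarrow> k * k' - A * (?b * 0 * M + 0)) at_top"
    unfolding U_def
  proof (intro tendsto_intros)
    show "((\<lambda>y::real. 1 / y ^ (d - 1)) \<longlongrightarrow> 0) at_top"
      using d by (intro real_tendsto_divide_at_top[OF tendsto_const] filterlim_pow_at_top filterlim_ident) auto
    show "((\<lambda>y::real. y powr (- (2 * l))) \<longlongrightarrow> 0) at_top"
      using l by (intro tendsto_neg_powr filterlim_ident) auto
  qed
  then have "eventually (\<lambda>y. U y > 0) at_top"
    by (rule order_tendstoD(1)) (use k in simp)
  then have "eventually (\<lambda>y. U y > 0 \<and> y \<ge> 1 \<and> y \<ge> h) at_top"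
    by (intro eventually_conj eventually_ge_at_top)
  then obtain h' where h': "U h' > 0" "h' \<ge> 1" "h' \<ge> h"
    by (auto simp: eventually_at_top_linorder)
  then have "p_fun d l q h' \<ge> 0" using lower[of h'] by simp
  then obtain y where "h \<le> y" "p_fun d l q y = 0"
    using IVT'[of "p_fun d l q" h 0 h'] neg h'(3) continuous_on_p_fun[OF d l, of h h' q] h h0 by auto
  then show False using max[of y] h h0 by simp
qed

text \<open>By \<open>disk_balayage_le\<close> the swept density at r is at most (1 -
  r^2)^(\<lambda>-1) times its value at the centre; hence f(r) is at least (1 - r^2)^(\<lambda>-1)
  p(h).\<close>

lemma f_density_nonneg:
  assumes d: "d \<ge> 3" "DIM('a::euclidean_space) = d - 1" and l: "0 < l" "l < 1" and q: "q > 0" and h: "h > 0"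
    and p: "p_fun d l q h > 0" and r: "0 \<le> r" "r < 1"
  shows "f_density d l q h r \<ge> 0"
proof -
  let ?bal = "balayage_density (real d - 1) l (h\<^sup>2)"
  have H: "h\<^sup>2 > 0" using h by simp
  have n: "real DIM('a) = real d - 1" "DIM('a) \<ge> 2" "real d - 1 \<ge> 2" using d by (simp_all add: of_nat_diff)
  have r2: "r\<^sup>2 < 1" using r by (simp add: power_less_one_iff)
  obtain e :: 'a where e: "norm e = 1" using vector_choose_size[of 1] by auto
  have ne: "norm (r *\<^sub>R e) = r" using e r by simp
  have "disk_balayage l (h\<^sup>2) (r *\<^sub>R e) \<le> ennreal ((1 - r\<^sup>2) powr (l - 1)) * disk_balayage l (h\<^sup>2) (0 :: 'a)"
    using disk_balayage_le[OF l H, of "r *\<^sub>R e"] r2 unfolding ne by simp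
  then have "ennreal (?bal (r\<^sup>2)) \<le> ennreal ((1 - r\<^sup>2) powr (l - 1)) * ennreal (?bal 0)"
    using disk_balayage_eq_density[OF l n(2) H, of "r *\<^sub>R e"] disk_balayage_eq_density[OF l n(2) H, of 0] r2
    unfolding ne n(1) by simp
  also have "\<dots> = ennreal ((1 - r\<^sup>2) powr (l - 1) * ?bal 0)"
    by (rule ennreal_mult'[symmetric]) simp
  finally have le: "?bal (r\<^sup>2) \<le> (1 - r\<^sup>2) powr (l - 1) * ?bal 0"
    using balayage_density_nonneg[OF l n(3) H, of 0] by (subst (asm) ennreal_le_iff) auto
  have "0 \<le> (1 - r\<^sup>2) powr (l - 1) * p_fun d l q h" using p by simp
  also have "\<dots> = C_const d l q h * (1 - r\<^sup>2) powr (l - 1) - q * ((1 - r\<^sup>2) powr (l - 1) * ?bal 0)"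
    unfolding p_fun_eq[OF d(1) l h] by (simp add: algebra_simps)
  also have "\<dots> \<le> C_const d l q h * (1 - r\<^sup>2) powr (l - 1) - q * ?bal (r\<^sup>2)"
    using le q by (intro diff_left_mono mult_left_mono) auto
  also have "\<dots> = f_density d l q h r"
    unfolding f_density_def F_fun_eq[OF d(1) l h] by simp
  finally show ?thesis .
qed

lemma borel_measurable_f_density:
  assumes "d \<ge> 3" "0 < l" "l < 1"
  shows "f_density d l q h \<in> borel_measurable borel"
proof -
  have b: "(real d - 2 * l - 1) / 2 > 0" using assms by simp
  have "(1 - r\<^sup>2) / (1 + h\<^sup>2) \<le> 1" for r :: real
  proof -
    have "1 - r\<^sup>2 \<le> 1 + h\<^sup>2" "0 < 1 + h\<^sup>2" using zero_le_power2[of r] zero_le_power2[of h] by linarith+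
    then show ?thesis by (simp add: divide_le_eq)
  qed
  then have [measurable]: "(\<lambda>r. inc_Beta ((1 - r\<^sup>2) / (1 + h\<^sup>2)) l ((real d - 2 * l - 1) / 2)) \<in> borel_measurable borel"
    by (intro borel_measurable_inc_Beta assms(2) b) auto
  show ?thesis unfolding f_density_def F_fun_def by measurable
qed

text \<open>Undoes the polar coordinates: the measure has density f(|y|) with respect to Lebesgue
  measure on the hyperplane. The unit sphere is null, so the open ball can be used, which is where f
  is shown to be nonnegative.\<close>

lemma nn_integral_radial_disk_measure:
  fixes g :: "real \<times> (real ^ 'm) \<Rightarrow> ennreal"
  assumes d: "CARD('m) = d - 1" and [measurable]: "f \<in> borel_measurable borel" "g \<in> borel_measurable borel"
  shows "(\<integral>\<^sup>+x. g x \<partial>radial_disk_measure d f) =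
    (\<integral>\<^sup>+y. (if norm y < 1 then ennreal (f (norm y)) else 0) * g (0, y) \<partial>lborel)"
proof -
  let ?S = "surface_measure :: (real ^ 'm) measure"
  interpret S: finite_measure ?S by (rule finite_measure_surface_measure)
  have mT: "(\<lambda>(r, u). (0 :: real, r *\<^sub>R u)) \<in> borel_measurable (lborel \<Otimes>\<^sub>M ?S)"
    using borel_measurable_Pair[OF borel_measurable_const measurable_scaleR_surface_measure, of "0 :: real"]
    by (simp add: case_prod_unfold)
  have mg: "(\<lambda>(r, u). g (0, r *\<^sub>R u)) \<in> borel_measurable (lborel \<Otimes>\<^sub>M ?S)"
    using measurable_compose[OF mT assms(3)] by (simp add: case_prod_unfold)
  have mf: "(\<lambda>(r, u). ennreal (f r * r ^ (d - 2)) * indicator {0..1} r) \<in> borel_measurable (lborel \<Otimes>\<^sub>M ?S)"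
    by measurable
  let ?G = "\<lambda>y. (if norm y \<le> 1 then ennreal (f (norm y)) else 0) * g (0, y)"
  have [measurable]: "(\<lambda>y :: real ^ 'm. g (0, y)) \<in> borel_measurable borel"
    by (rule measurable_compose[OF _ assms(3)]) simp
  have "(\<integral>\<^sup>+x. g x \<partial>radial_disk_measure d f) =
    (\<integral>\<^sup>+p. (case p of (r, u) \<Rightarrow> ennreal (f r * r ^ (d - 2)) * indicator {0..1} r) * (case p of (r, u) \<Rightarrow> g (0, r *\<^sub>R u)) \<partial>(lborel \<Otimes>\<^sub>M ?S))"
  proof -
    let ?N = "density (lborel \<Otimes>\<^sub>M ?S) (\<lambda>(r, u). ennreal (f r * r ^ (d - 2)) * indicator {0..1} r)"
    have "(\<integral>\<^sup>+x. g x \<partial>radial_disk_measure d f) = (\<integral>\<^sup>+p. g (case p of (r, u) \<Rightarrow> (0, r *\<^sub>R u)) \<partial>?N)"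
      unfolding radial_disk_measure_def by (rule nn_integral_distr) (simp_all add: mT assms(3))
    also have "\<dots> = (\<integral>\<^sup>+p. (case p of (r, u) \<Rightarrow> g (0, r *\<^sub>R u)) \<partial>?N)"
      by (intro nn_integral_cong) (simp add: case_prod_unfold)
    also have "\<dots> = (\<integral>\<^sup>+p. (case p of (r, u) \<Rightarrow> ennreal (f r * r ^ (d - 2)) * indicator {0..1} r) * (case p of (r, u) \<Rightarrow> g (0, r *\<^sub>R u)) \<partial>(lborel \<Otimes>\<^sub>M ?S))"
      by (rule nn_integral_density[OF mf mg])
    finally show ?thesis .
  qed
  also have "\<dots> = (\<integral>\<^sup>+r. (\<integral>\<^sup>+u. ennreal (f r * r ^ (d - 2)) * indicator {0..1} r * g (0, r *\<^sub>R u) \<partial>?S) \<partial>lborel)"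
    using S.nn_integral_fst[OF borel_measurable_times_ennreal[OF mf mg]] by (simp only: prod.case)
  also have "\<dots> = (\<integral>\<^sup>+r\<in>{0<..}. ennreal (r ^ (DIM(real ^ 'm) - 1)) * (\<integral>\<^sup>+u. ?G (r *\<^sub>R u) \<partial>?S) \<partial>lborel)"
  proof (intro nn_integral_cong_AE, use AE_lborel_singleton[of 0] in eventually_elim)
    fix r :: real assume "r \<noteq> 0"
    have mu: "(\<lambda>u. g (0, r *\<^sub>R u)) \<in> borel_measurable ?S"
      using measurable_compose[OF measurable_Pair1' mg, of r] by (simp add: case_prod_unfold)
    show "(\<integral>\<^sup>+u. ennreal (f r * r ^ (d - 2)) * indicator {0..1} r * g (0, r *\<^sub>R u) \<partial>?S) =
      ennreal (r ^ (DIM(real ^ 'm) - 1)) * (\<integral>\<^sup>+u. ?G (r *\<^sub>R u) \<partial>?S) * indicator {0<..} r"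
    proof (cases "r > 0")
      case True
      have "(\<integral>\<^sup>+u. ?G (r *\<^sub>R u) \<partial>?S) = (\<integral>\<^sup>+u. (if r \<le> 1 then ennreal (f r) else 0) * g (0, r *\<^sub>R u) \<partial>?S)"
        using True by (intro nn_integral_cong) (auto simp: space_surface_measure)
      also have "\<dots> = (if r \<le> 1 then ennreal (f r) else 0) * (\<integral>\<^sup>+u. g (0, r *\<^sub>R u) \<partial>?S)"
        by (rule nn_integral_cmult[OF mu])
      finally have 1: "(\<integral>\<^sup>+u. ?G (r *\<^sub>R u) \<partial>?S) = \<dots>" .
      have 2: "DIM(real ^ 'm) - 1 = d - 2" using d by simp
      show ?thesis
      proof -
        have "ennreal (f r * r ^ (d - 2)) = ennreal (f r) * ennreal (r ^ (d - 2))"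
          by (rule ennreal_mult'') (use True in simp)
        then show ?thesis unfolding 1 2 nn_integral_cmult[OF mu] using True
          by (cases "r \<le> 1") (simp_all add: mult_ac)
      qed
    next
      case False
      then have "indicator {0..1} r = (0 :: ennreal)" using \<open>r \<noteq> 0\<close> by simp
      with False show ?thesis by simp
    qed
  qed
  also have "\<dots> = (\<integral>\<^sup>+y. ?G y \<partial>lborel)"
    by (rule nn_integral_polar[of ?G, symmetric]) measurable
  also have "\<dots> = (\<integral>\<^sup>+y. (if norm y < 1 then ennreal (f (norm y)) else 0) * g (0, y) \<partial>lborel)"
  proof -
    have "sphere 0 1 \<in> null_sets (lborel :: (real ^ 'm) measure)"
    proof -
      have "sphere 0 1 \<in> null_sets (lebesgue :: (real ^ 'm) measure)"
        using negligible_sphere[of "0 :: real ^ 'm" 1] by (simp only: negligible_iff_null_sets)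
      then show ?thesis by (subst (asm) null_sets_completion_iff) simp_all
    qed
    from AE_not_in[OF this] have "AE y in (lborel :: (real ^ 'm) measure). norm y \<noteq> 1"
      by (simp only: mem_sphere_0)
    then show ?thesis
    proof (intro nn_integral_cong_AE, eventually_elim)
      fix y :: "real ^ 'm" assume "norm y \<noteq> 1"
      then have "norm y \<le> 1 \<longleftrightarrow> norm y < 1" by linarith
      then show "?G y = (if norm y < 1 then ennreal (f (norm y)) else 0) * g (0, y)" by (simp only:)
    qed
  qed
  finally show ?thesis .
qed

lemma unit_disk_eq: "(unit_disk :: (real \<times> (real ^ 'm)) set) = {0} \<times> cball 0 1"
proof -
  have eq: "(\<Sum>i\<in>UNIV. (y $ i)\<^sup>2) \<le> 1 \<longleftrightarrow> norm y \<le> 1" for y :: "real ^ 'm"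
    unfolding norm_vec_def L2_set_def real_norm_def power2_abs real_sqrt_le_1_iff ..
  show ?thesis
    unfolding unit_disk_def eq by (rule set_eqI) (simp add: mem_Times_iff)
qed

text \<open>The equivalence expresses existence and uniqueness at once. Nonnegativity of f on [0, 1)
  is asserted alongside, since \<open>radial_disk_measure\<close> cuts off negative values and would
  otherwise not have f as its density.\<close>

theorem theorem2p6:
  fixes d :: nat and s l q h h\<^sub>p :: real
    and Q :: "real \<times> (real^'m) \<Rightarrow> ennreal"
  assumes "d \<ge> 3" and "CARD('m) = d - 1"
    and "0 < l" and "l < 1" and "s = (real d - 3) + 2 * l"
    and "q > 0" and "h > 0"
    and "\<forall>r u. 0 \<le> r \<and> r \<le> 1 \<and> u \<in> sphere 0 1 \<longrightarrow>
           Q (0, r *\<^sub>R u) = ennreal (q / (r\<^sup>2 + h\<^sup>2) powr (s / 2))"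
    and "is_largest_positive_root (p_fun d l q) h\<^sub>p"
    and "h > max (h_minus d l q) h\<^sub>p"
  shows "(\<forall>\<mu>. is_extremal_measure s Q unit_disk \<mu> \<longleftrightarrow>
             \<mu> = radial_disk_measure d (f_density d l q h))
    \<and> (\<forall>r. 0 \<le> r \<and> r < 1 \<longrightarrow> f_density d l q h r \<ge> 0)
    \<and> C_const d l q h > 0"
proof -
  note d = \<open>d \<ge> 3\<close> and l = \<open>0 < l\<close> \<open>l < 1\<close> and q = \<open>q > 0\<close> and h = \<open>h > 0\<close>
  define n where "n = real CARD('m)"
  have n: "n = real d - 1" "n \<ge> 2" "n > 0" using d \<open>CARD('m) = d - 1\<close> by (simp_all add: n_def of_nat_diff)
  have dim: "DIM(real ^ 'm) = d - 1" "real DIM(real ^ 'm) = n" using \<open>CARD('m) = d - 1\<close> by (simp_all add: n_def)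
  have s: "s = real CARD('m) - 2 + 2 * l" "s > 0" using \<open>s = _\<close> n l by (simp_all add: n_def[symmetric])
  have H: "h\<^sup>2 > 0" using h by simp
  define f where "f = f_density d l q h"
  define C where "C = C_const d l q h"
  have [measurable]: "f \<in> borel_measurable borel"
    unfolding f_def by (rule borel_measurable_f_density[OF d l])
  have p: "p_fun d l q h > 0"
    using \<open>h > max _ _\<close> by (intro p_fun_pos[OF d dim(1) l q \<open>is_largest_positive_root _ _\<close>]) simp
  have f_nonneg: "f r \<ge> 0" if "0 \<le> r" "r < 1" for r
    unfolding f_def by (rule f_density_nonneg[OF d dim(1) l q h p that])
  define c\<^sub>0 where "c\<^sub>0 = half_sphere_area n"
  have c0: "c\<^sub>0 > 0" using n by (simp add: c\<^sub>0_def Gamma_real_pos)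
  have B: "Beta (n / 2) l > 0" "Beta l (1 - l) > 0" using n(3) l by (simp_all add: Beta_def Gamma_real_pos)
  have c_nn: "c_const d l h \<ge> 0" by (rule c_const_nonneg[OF d l h])
  \<comment> \<open>In this form C is read off from masses: C times the mass
    \<open>c\<^sub>0 * Beta (n / 2) l\<close> of E_1 equals 1 plus q times the mass of the swept
    charge, so the difference of the two charges has mass 1.\<close>
  have C_eq: "C = 2 / Beta (n / 2) l * (1 / (2 * c\<^sub>0) + q * c_const d l h)"
    unfolding C_def C_const_def n(1)[symmetric] by (simp add: Beta_def c\<^sub>0_def mult.commute)
  have C: "C > 0" unfolding C_eq using B c0 q c_nn by (intro mult_pos_pos add_pos_nonneg) auto

  define D :: "real ^ 'm \<Rightarrow> ennreal" where "D y = (if norm y < 1 then ennreal (f (norm y)) else 0)" for y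
  have [measurable]: "D \<in> borel_measurable borel" unfolding D_def[abs_def] by measurable
  \<comment> \<open>The formula f = C E_1 - q (swept density) in additive form. Both the mass and
    the weighted potential of \<open>D\<close> are obtained by integrating it.\<close>
  have split: "D y + ennreal q * disk_balayage l (h\<^sup>2) y = ennreal C * ball_weight l 1 y" for y
  proof (cases "norm y < 1")
    case True
    then have y2: "(norm y)\<^sup>2 < 1" by (simp add: power_less_one_iff)
    let ?bal = "balayage_density n l (h\<^sup>2) ((norm y)\<^sup>2)"
    have bal: "disk_balayage l (h\<^sup>2) y = ennreal ?bal" "0 \<le> ?bal"
      using disk_balayage_eq_density[OF l _ H y2] balayage_density_nonneg[OF l n(2) H, of "(norm y)\<^sup>2"] n dim by simp_all
    have "f (norm y) + q * ?bal = C * (1 - (norm y)\<^sup>2) powr (l - 1)"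
      unfolding f_def f_density_def F_fun_eq[OF d l h] C_def n(1) by simp
    then have "ennreal (f (norm y)) + ennreal q * ennreal ?bal = ennreal C * ennreal ((1 - (norm y)\<^sup>2) powr (l - 1))"
      using f_nonneg[of "norm y"] True q C bal(2)
      by (simp add: ennreal_mult[symmetric] ennreal_plus[symmetric] del: ennreal_plus)
    then show ?thesis using True y2 by (simp add: D_def bal(1) ball_weight_def)
  next
    case False
    then have y2: "1 \<le> (norm y)\<^sup>2" by (simp add: one_le_power)
    then have "ball_weight l 1 y = 0"
      unfolding ball_weight_def by (intro if_not_P) linarith
    then show ?thesis using False by (simp add: D_def disk_balayage_outside[OF y2])
  qed
  define \<mu>\<^sub>0 where "\<mu>\<^sub>0 = (radial_disk_measure d f :: (real \<times> (real ^ 'm)) measure)"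
  have int: "(\<integral>\<^sup>+x. g x \<partial>\<mu>\<^sub>0) = (\<integral>\<^sup>+y. D y * g (0, y) \<partial>lborel)"
    if "g \<in> borel_measurable borel" for g
    unfolding \<mu>\<^sub>0_def D_def by (rule nn_integral_radial_disk_measure[OF \<open>CARD('m) = d - 1\<close> _ that]) measurable
  have sets0: "sets \<mu>\<^sub>0 = sets borel" by (simp add: \<mu>\<^sub>0_def radial_disk_measure_def)
  have D_mass: "(\<integral>\<^sup>+y. D y \<partial>lborel) = 1"
  proof -
    let ?m = "2 * c\<^sub>0 * c_const d l h"
    have m: "q * ?m \<ge> 0" using q c0 c_nn by simp
    have "(\<integral>\<^sup>+y. D y \<partial>lborel) + ennreal q * (\<integral>\<^sup>+y. disk_balayage l (h\<^sup>2) y \<partial>(lborel :: (real ^ 'm) measure)) =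
      (\<integral>\<^sup>+y. D y + ennreal q * disk_balayage l (h\<^sup>2) y \<partial>lborel)"
      by (subst nn_integral_add) (auto simp: nn_integral_cmult)
    also have "\<dots> = ennreal C * (\<integral>\<^sup>+y. ball_weight l 1 y \<partial>(lborel :: (real ^ 'm) measure))"
      unfolding split by (rule nn_integral_cmult) measurable
    also have "\<dots> = ennreal C * ennreal (c\<^sub>0 * Beta (n / 2) l)"
      using nn_integral_ball_weight[OF l zero_less_one, where 'a = "real ^ 'm"] unfolding dim(2) c\<^sub>0_def by simp
    also have "\<dots> = ennreal (C * (c\<^sub>0 * Beta (n / 2) l))"
      using C by (intro ennreal_mult'[symmetric]) simp
    also have "C * (c\<^sub>0 * Beta (n / 2) l) = 1 + q * ?m"
      unfolding C_eq using B(1) c0 by (simp add: field_simps)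
    also have "ennreal \<dots> = 1 + ennreal (q * ?m)"
      using m by (subst ennreal_plus) auto
    also have "(\<integral>\<^sup>+y. disk_balayage l (h\<^sup>2) y \<partial>(lborel :: (real ^ 'm) measure)) = ennreal ?m"
    proof -
      have "real (d - 1) = n" using d n by (simp add: of_nat_diff)
      then show ?thesis using nn_integral_disk_balayage[OF d dim(1) l h] by (simp add: c\<^sub>0_def)
    qed
    also have "ennreal q * ennreal ?m = ennreal (q * ?m)" using q by (intro ennreal_mult'[symmetric]) simp
    finally have "ennreal (q * ?m) + (\<integral>\<^sup>+y. D y \<partial>lborel) = ennreal (q * ?m) + 1" by (simp only: add.commute)
    then show ?thesis by (subst (asm) ennreal_add_left_cancel) auto
  qed
  have \<mu>\<^sub>0: "\<mu>\<^sub>0 \<in> unit_measures_on unit_disk"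
  proof -
    have sp: "space \<mu>\<^sub>0 = UNIV" using sets_eq_imp_space_eq[OF sets0] by simp
    have em: "emeasure \<mu>\<^sub>0 A = (\<integral>\<^sup>+y. D y * indicator A (0, y) \<partial>lborel)" if A: "A \<in> sets borel" for A
    proof -
      have "emeasure \<mu>\<^sub>0 A = (\<integral>\<^sup>+x. indicator A x \<partial>\<mu>\<^sub>0)"
        using A sets0 by (intro nn_integral_indicator[symmetric]) simp
      then show ?thesis using A by (subst (asm) int) auto
    qed
    have "prob_space \<mu>\<^sub>0"
      by (rule prob_spaceI) (simp add: sp em D_mass)
    moreover have "emeasure \<mu>\<^sub>0 (- unit_disk) = 0"
    proof -
      have "emeasure \<mu>\<^sub>0 (- unit_disk) = (\<integral>\<^sup>+y. D y * indicator (- unit_disk) (0, y) \<partial>lborel)"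
        unfolding unit_disk_eq by (intro em sets.compl_sets borel_closed[THEN borel_comp] closed_Times) auto
      also have "\<dots> = (\<integral>\<^sup>+y. 0 \<partial>(lborel :: (real ^ 'm) measure))"
        by (intro nn_integral_cong) (auto simp: D_def unit_disk_eq indicator_def)
      finally show ?thesis by simp
    qed
    ultimately show ?thesis using sets0 by (simp add: unit_measures_on_def)
  qed
  define Q\<^sub>0 where "Q\<^sub>0 x = ennreal q * ennreal (((norm (snd x))\<^sup>2 + h\<^sup>2) powr (- s / 2))" for x :: "real \<times> (real ^ 'm)"
  have [measurable]: "(\<lambda>x :: real \<times> (real ^ 'm). norm (snd x)) \<in> borel_measurable borel"
    by (intro borel_measurable_continuous_onI continuous_intros)
  have Q0_meas: "Q\<^sub>0 \<in> borel_measurable borel" unfolding Q\<^sub>0_def[abs_def] by measurable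
  have Q0: "Q x = Q\<^sub>0 x" if "x \<in> unit_disk" for x
  proof -
    obtain y where y: "x = (0, y)" "norm y \<le> 1" using \<open>x \<in> unit_disk\<close> by (auto simp: unit_disk_eq)
    obtain e :: "real ^ 'm" where e: "norm e = 1" using vector_choose_size[of 1] by auto
    \<comment> \<open>The field is given in polar coordinates; at the centre the direction is
      arbitrary and any unit vector serves.\<close>
    define u where "u = (if y = 0 then e else y /\<^sub>R norm y)"
    have u: "u \<in> sphere 0 1" "y = norm y *\<^sub>R u" using e by (auto simp: u_def)
    have "Q (0, norm y *\<^sub>R u) = ennreal (q / ((norm y)\<^sup>2 + h\<^sup>2) powr (s / 2))"
      using \<open>\<forall>r u. _\<close>[rule_format, of "norm y" u] y u by simp
    then have "Q x = ennreal (q / ((norm y)\<^sup>2 + h\<^sup>2) powr (s / 2))" using u(2) y(1) by simp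
    also have "q / ((norm y)\<^sup>2 + h\<^sup>2) powr (s / 2) = q * ((norm y)\<^sup>2 + h\<^sup>2) powr (- s / 2)"
      by (simp add: powr_minus_divide)
    finally show ?thesis using q by (simp add: Q\<^sub>0_def y(1) ennreal_mult')
  qed
  have const: "(\<integral>\<^sup>+y. riesz_kernel s x y \<partial>\<mu>\<^sub>0) + Q\<^sub>0 x = ennreal (C * (c\<^sub>0 * Beta l (1 - l)))" if "x \<in> unit_disk" for x
  proof -
    obtain z where z: "x = (0, z)" "norm z \<le> 1" using \<open>x \<in> unit_disk\<close> by (auto simp: unit_disk_eq)
    have ker: "riesz_kernel s (0 :: real, z) (0, y) = riesz_kernel s z y" for y
      by (simp add: riesz_kernel_def norm_Pair)
    have "(\<integral>\<^sup>+y. riesz_kernel s x y \<partial>\<mu>\<^sub>0) = riesz_potential s D z"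
      unfolding riesz_potential_def by (subst int) (simp_all add: z(1) ker mult.commute)
    moreover have "Q\<^sub>0 x = ennreal q * riesz_potential s (disk_balayage l (h\<^sup>2)) z"
      using riesz_potential_disk_balayage[OF l s H z(2)] by (simp add: Q\<^sub>0_def z(1))
    \<comment> \<open>On the disk the field of the point charge is q times the potential of the
      swept charge, so it adds up with the potential of \<open>D\<close> to that of C E_1, which is
      constant there.\<close>
    ultimately have "(\<integral>\<^sup>+y. riesz_kernel s x y \<partial>\<mu>\<^sub>0) + Q\<^sub>0 x =
      (\<integral>\<^sup>+y. riesz_kernel s z y * D y + ennreal q * (riesz_kernel s z y * disk_balayage l (h\<^sup>2) y) \<partial>lborel)"
      unfolding riesz_potential_def by (subst nn_integral_add) (auto simp: nn_integral_cmult)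
    also have "\<dots> = (\<integral>\<^sup>+y. ennreal C * (riesz_kernel s z y * ball_weight l 1 y) \<partial>lborel)"
    proof (rule nn_integral_cong, goal_cases)
      case (1 y)
      have "riesz_kernel s z y * (D y + ennreal q * disk_balayage l (h\<^sup>2) y) = riesz_kernel s z y * (ennreal C * ball_weight l 1 y)"
        by (simp only: split)
      then show ?case
        by (simp only: distrib_left mult_ac)
    qed
    also have "\<dots> = ennreal C * riesz_potential s (ball_weight l 1) z"
      unfolding riesz_potential_def by (rule nn_integral_cmult) measurable
    also have "riesz_potential s (ball_weight l 1) z = ennreal (c\<^sub>0 * Beta l (1 - l))"
      using riesz_potential_ball_weight_inside[OF l _ zero_less_one, of s z] z(2) s
      by (simp add: c\<^sub>0_def n_def power_le_one)
    also have "ennreal C * \<dots> = ennreal (C * (c\<^sub>0 * Beta l (1 - l)))"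
      using C by (intro ennreal_mult'[symmetric]) simp
    finally show ?thesis .
  qed
  have D_closed: "unit_disk \<in> sets (borel :: (real \<times> (real ^ 'm)) measure)"
    unfolding unit_disk_eq by (intro borel_closed closed_Times) auto
  have "is_extremal_measure s Q unit_disk \<mu> \<longleftrightarrow> \<mu> = \<mu>\<^sub>0" for \<mu>
    by (rule is_extremal_measure_iff[OF s(2) D_closed Q0_meas Q0 \<mu>\<^sub>0 _ const]) simp_all
  then show ?thesis using f_nonneg C unfolding \<mu>\<^sub>0_def f_def C_def by blast
qed

end
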